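(* Let $\mathcal{K}$ be a directed $2$-complex, let $p$ be a $1$-path in $\mathcal{K}$, and let $\widetilde{\mathcal{K}}_p$ be the universal $2$-cover of $\mathcal{K}$ with base $p$, with root $\tilde p$. Then the connected component $\mathrm{Sq}(\widetilde{\mathcal{K}}_p,\tilde p)$ of the Squier complex of $\widetilde{\mathcal{K}}_p$ is homeomorphic to the universal cover of the connected component $\mathrm{Sq}(\mathcal{K},p)$ of the Squier complex of $\mathcal{K}$.
   Context: Directed $2$-complexes. A directed $2$-complex $\mathcal{K}$ is a directed graph together with a set $\mathbf{F}$ of $2$-cells and maps $\lceil\cdot\rceil,\lfloor\cdot\rfloor\colon\mathbf{F}\to\mathbf{P}$ (top, bottom), ${}^{-1}\colon\mathbf{F}\to\mathbf{F}$ (inverse), where $\mathbf{P}$ is the set of all directed paths of the graph including empty paths (called $1$-paths; initial and terminal vertices are $\iota(p),\tau(p)$). It is required that for each $f$ the paths $\lceil f\rceil,\lfloor f\rfloor$ are non-empty with common initial vertex $\iota(f)$ and common terminal vertex $\tau(f)$, and that ${}^{-1}$ is an involution without fixed points with $\lceil f^{-1}\rceil=\lfloor f\rfloor$, $\lfloor f^{-1}\rfloor=\lceil f\rceil$. An orientation $\mathbf{F}=\mathbf{F}^+\sqcup\mathbf{F}^-$, $\mathbf{F}^-=(\mathbf{F}^+)^{-1}$, gives positive and negative $2$-cells. An atomic $2$-path is a triple $(p,f,q)$ with $p,q$ $1$-paths, $f\in\mathbf{F}$, $\tau(p)=\iota(f)$, $\tau(f)=\iota(q)$; its top is $p\lceil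 f\rceil q$ and its bottom is $p\lfloor f\rfloor q$. Squier complex. A semi-cubical complex is a family of disjoint sets $M_n$ ($n\ge0$) of $n$-cubes with face maps $\lambda_i^k\colon M_n\to M_{n-1}$ ($1\le i\le n$, $k=0,1$) satisfying $\lambda^k_i\lambda^{k'}_j=\lambda^{k'}_{j-1}\lambda^k_i$ for $i<j$ (the rightmost map acts first); its realization is the quotient of the disjoint union of Euclidean cubes $c(x)\cong[0,1]^n$ ($x\in M_n$) identifying the face $[0,1]^{i-1}\times\{k\}\times[0,1]^{n-i}$ of $c(x)$ with $c(\lambda_i^k(x))$. $\mathrm{Sq}(\mathcal{K})$ is the semi-cubical complex whose $n$-cubes are the thin diagrams with $n$ cells, i.e. formal sums $c=\varepsilon(u_0)+f_1+\varepsilon(u_1)+\cdots+f_n+\varepsilon(u_n)$ with $u_i$ $1$-paths (possibly empty), $f_i\in\mathbf{F}^-$, $\tau(u_{i-1})=\iota(f_i)$, $\tau(f_i)=\iota(u_i)$; the face $\lambda_i^0(c)$ (resp. $\lambda_i^1(c)$) replaces $\varepsilon(u_{i-1})+f_i+\varepsilon(u_i)$ by $\varepsilon(u_{i-1}\lceil f_i\rceil u_i)$ (resp. $\varepsilon(u_{i-1}\lfloor f_i\rfloor u_i)$). Thus vertices are $1$-paths of $\mathcal{K}$. The realization does not depend on the orientation. $\mathrm{Sq}(\mathcal{K})$ is not distinguished from its realization, and $\mathrm{Sq}(\mathcal{K},p)$ is the connected component containing the vertex $p$. Rooted $2$-trees. Let $w$ be a simple directed arc subdivided into edges, regarded as a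 directed $2$-complex $\mathcal{K}_0$ without $2$-cells. Consider an ascending chain $\mathcal{K}_0\subseteq\mathcal{K}_1\subseteq\cdots$ where $\mathcal{K}_{n+1}$ is obtained from $\mathcal{K}_n$ by adding new $2$-cells (with their inverses) so that for each positive $f\in\mathcal{K}_{n+1}\setminus\mathcal{K}_n$ the path $\lceil f\rceil$ is in $\mathcal{K}_n$, $\lfloor f\rfloor$ is a simple arc meeting $\mathcal{K}_n$ only at its endpoints, and the arcs $\lfloor f\rfloor$ for different positive $f\in\mathcal{K}_{n+1}\setminus\mathcal{K}_n$ are disjoint except for endpoints. The union $\bigcup_n\mathcal{K}_n$ is a rooted $2$-tree with root $w$. Universal $2$-covers. A directed $2$-complex over $\mathcal{K}$ is a directed $2$-complex $\mathcal{M}$ with a morphism $\phi\colon\mathcal{M}\to\mathcal{K}$ sending vertices to vertices, edges to edges, $2$-cells to $2$-cells and preserving $\iota,\tau$, top, bottom, inverse. The $2$-star of a $1$-path $q$ is the set of atomic $2$-paths with top $q$; for a $1$-path $\tilde q$ in $\mathcal{M}$, $\phi$ induces the local map from the $2$-star of $\tilde q$ to the $2$-star of $\phi(\tilde q)$. A universal $2$-cover of $\mathcal{K}$ with base $p$ is a directed $2$-complex $\mathcal{M}$ over $\mathcal{K}$ such that (U1) $\mathcal{M}$ is a rooted $2$-tree with root $\tilde p$, where $\phi(\tilde p)=p$; (U2) for any $1$-path $\tilde q$ in $\mathcal{M}$ from $\iota(\tilde p)$ to $\tau(\tilde p)$ the local map of $\mathcal{M}$ at $\tilde q$ is bijective.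 It exists and is unique up to isomorphism over $\mathcal{K}$; it is denoted $\widetilde{\mathcal{K}}_p$. *)

theory Defs
  imports "HOL-Analysis.Analysis" "Graph_Theory.Graph_Theory"
begin

section \<open>Directed 2-complexes\<close>

text \<open>A 1-path is a pair of its initial vertex and its list of arcs, so that there is one empty
  1-path at every vertex.\<close>

type_synonym ('v, 'e) onepath = "'v \<times> 'e list"

record ('v, 'e, 'f) two_complex =
  graph :: "('v, 'e) pre_digraph"
  cells :: "'f set"
  ctop :: "'f \<Rightarrow> ('v, 'e) onepath"
  cbot :: "'f \<Rightarrow> ('v, 'e) onepath"
  cinv :: "'f \<Rightarrow> 'f"

definition onepaths :: "('v, 'e, 'f) two_complex \<Rightarrow> ('v, 'e) onepath set" where
  "onepaths K = {(u, es). \<exists>v. pre_digraph.awalk (graph K) u es v}"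

definition pverts :: "('v, 'e, 'f) two_complex \<Rightarrow> ('v, 'e) onepath \<Rightarrow> 'v list" where
  "pverts K q = pre_digraph.awalk_verts (graph K) (fst q) (snd q)"

definition pstart :: "('v, 'e) onepath \<Rightarrow> 'v" where
  "pstart q = fst q"

definition pend :: "('v, 'e, 'f) two_complex \<Rightarrow> ('v, 'e) onepath \<Rightarrow> 'v" where
  "pend K q = last (pverts K q)"

text \<open>Concatenation of 1-paths; meaningful if the first ends where the second starts.\<close>

definition pconcat :: "('v, 'e) onepath \<Rightarrow> ('v, 'e) onepath \<Rightarrow> ('v, 'e) onepath" (infixr "\<cdot>\<cdot>" 70) where
  "q \<cdot>\<cdot> r = (fst q, snd q @ snd r)"

definition directed_two_complex :: "('v, 'e, 'f) two_complex \<Rightarrow> bool" where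
  "directed_two_complex K \<longleftrightarrow>
     wf_digraph (graph K) \<and>
     (\<forall>f\<in>cells K.
        ctop K f \<in> onepaths K \<and> cbot K f \<in> onepaths K \<and>
        snd (ctop K f) \<noteq> [] \<and> snd (cbot K f) \<noteq> [] \<and>
        pstart (ctop K f) = pstart (cbot K f) \<and> pend K (ctop K f) = pend K (cbot K f) \<and>
        cinv K f \<in> cells K \<and> cinv K f \<noteq> f \<and> cinv K (cinv K f) = f \<and>
        ctop K (cinv K f) = cbot K f \<and> cbot K (cinv K f) = ctop K f)"

definition cstart :: "('v, 'e, 'f) two_complex \<Rightarrow> 'f \<Rightarrow> 'v" where
  "cstart K f = pstart (ctop K f)"

definition cend :: "('v, 'e, 'f) two_complex \<Rightarrow> 'f \<Rightarrow> 'v" where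
  "cend K f = pend K (ctop K f)"

text \<open>An orientation is given by its set of positive cells.\<close>

definition orientation :: "('v, 'e, 'f) two_complex \<Rightarrow> 'f set \<Rightarrow> bool" where
  "orientation K P \<longleftrightarrow> P \<subseteq> cells K \<and> cinv K ` P = cells K - P"

definition atomic_two_paths ::
  "('v, 'e, 'f) two_complex \<Rightarrow> (('v, 'e) onepath \<times> 'f \<times> ('v, 'e) onepath) set" where
  "atomic_two_paths K =
     {(q, f, r). q \<in> onepaths K \<and> f \<in> cells K \<and> r \<in> onepaths K \<and>
                 pend K q = cstart K f \<and> cend K f = pstart r}"

definition two_star ::
  "('v, 'e, 'f) two_complex \<Rightarrow> ('v, 'e) onepath \<Rightarrow> (('v, 'e) onepath \<times> 'f \<times> ('v, 'e) onepath) set" where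
  "two_star K s = {(q, f, r) \<in> atomic_two_paths K. q \<cdot>\<cdot> ctop K f \<cdot>\<cdot> r = s}"


section \<open>Semi-cubical complexes and their realization\<close>

text \<open>In \<open>face X i k\<close> the direction \<open>i\<close> counts from 1, and \<open>k\<close> is \<open>False\<close> for the faces
  \<open>\<lambda>\<^sub>i\<^sup>0\<close> and \<open>True\<close> for the faces \<open>\<lambda>\<^sub>i\<^sup>1\<close>.\<close>

record 'c cubical =
  cubes :: "nat \<Rightarrow> 'c set"
  face :: "nat \<Rightarrow> bool \<Rightarrow> 'c \<Rightarrow> 'c"

definition semi_cubical :: "'c cubical \<Rightarrow> bool" where
  "semi_cubical X \<longleftrightarrow>
     (\<forall>m n. m \<noteq> n \<longrightarrow> cubes X m \<inter> cubes X n = {}) \<and>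
     (\<forall>n. \<forall>x\<in>cubes X n. \<forall>i\<in>{1..n}. \<forall>k. face X i k x \<in> cubes X (n - 1)) \<and>
     (\<forall>n. \<forall>x\<in>cubes X n. \<forall>i j k l. 1 \<le> i \<and> i < j \<and> j \<le> n \<longrightarrow>
        face X i k (face X j l x) = face X (j - 1) l (face X i k x))"

text \<open>Points of the standard cube are functions on \<open>{1..n}\<close>, extended by \<open>undefined\<close>.\<close>

definition unit_cube :: "nat \<Rightarrow> (nat \<Rightarrow> real) topology" where
  "unit_cube n = product_topology (\<lambda>_. top_of_set {0..1}) {1..n}"

text \<open>The inclusion of the \<open>(n-1)\<close>-cube as the face of the \<open>n\<close>-cube on which coordinate \<open>i\<close> is
  \<open>0\<close> or \<open>1\<close>.\<close>

definition face_inclusion :: "nat \<Rightarrow> nat \<Rightarrow> bool \<Rightarrow> (nat \<Rightarrow> real) \<Rightarrow> (nat \<Rightarrow> real)" where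
  "face_inclusion n i k s =
     (\<lambda>j\<in>{1..n}. if j < i then s j else if j = i then of_bool k else s (j - 1))"

type_synonym 'c cube_point = "(nat \<times> 'c) \<times> (nat \<Rightarrow> real)"

definition cube_sum :: "'c cubical \<Rightarrow> 'c cube_point topology" where
  "cube_sum X = sum_topology (\<lambda>(n, x). unit_cube n) (SIGMA n:UNIV. cubes X n)"

definition gluing :: "'c cubical \<Rightarrow> 'c cube_point rel" where
  "gluing X =
     {(((n, x), face_inclusion n i k s), ((n - 1, face X i k x), s)) | n x i k s.
        x \<in> cubes X n \<and> i \<in> {1..n} \<and> s \<in> topspace (unit_cube (n - 1))}"

definition glue_class :: "'c cubical \<Rightarrow> 'c cube_point \<Rightarrow> 'c cube_point set" where
  "glue_class X a = (gluing X \<union> (gluing X)\<inverse>)\<^sup>* `` {a}"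

definition quotient_topology :: "'a topology \<Rightarrow> ('a \<Rightarrow> 'b) \<Rightarrow> 'b topology" where
  "quotient_topology X q =
     topology (\<lambda>U. U \<subseteq> q ` topspace X \<and> openin X {x \<in> topspace X. q x \<in> U})"

lemma openin_quotient_topology:
  "openin (quotient_topology X q) U \<longleftrightarrow>
     U \<subseteq> q ` topspace X \<and> openin X {x \<in> topspace X. q x \<in> U}"
proof -
  have "istopology (\<lambda>U. U \<subseteq> q ` topspace X \<and> openin X {x \<in> topspace X. q x \<in> U})"
  proof -
    have 1: "{x \<in> topspace X. q x \<in> S \<inter> T} =
             {x \<in> topspace X. q x \<in> S} \<inter> {x \<in> topspace X. q x \<in> T}" for S T
      by auto
    have 2: "{x \<in> topspace X. q x \<in> \<Union>\<K>} = (\<Union>S\<in>\<K>. {x \<in> topspace X. q x \<in> S})" for \<K>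
      by auto
    show ?thesis
      unfolding istopology_def 1 2 by blast
  qed
  then show ?thesis
    by (simp add: quotient_topology_def topology_inverse')
qed

lemma topspace_quotient_topology [simp]: "topspace (quotient_topology X q) = q ` topspace X"
proof -
  have "{x \<in> topspace X. q x \<in> q ` topspace X} = topspace X"
    by auto
  then have "openin (quotient_topology X q) (q ` topspace X)"
    by (simp add: openin_quotient_topology)
  then show ?thesis
    by (meson openin_quotient_topology openin_subset openin_topspace subset_antisym)
qed

lemma quotient_map_quotient_topology: "quotient_map X (quotient_topology X q) q"
  by (simp add: quotient_map_def openin_quotient_topology)

definition realization :: "'c cubical \<Rightarrow> 'c cube_point set topology" where
  "realization X = quotient_topology (cube_sum X) (glue_class X)"

text \<open>The only point of the 0-dimensional cube is the everywhere undefined function.\<close>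

definition vertex_point :: "'c cubical \<Rightarrow> 'c \<Rightarrow> 'c cube_point set" where
  "vertex_point X x = glue_class X ((0, x), \<lambda>_. undefined)"

definition realization_component :: "'c cubical \<Rightarrow> 'c \<Rightarrow> 'c cube_point set topology" where
  "realization_component X x =
     subtopology (realization X) (connected_component_of_set (realization X) (vertex_point X x))"


section \<open>Squier complexes\<close>

text \<open>The thin diagram \<open>\<epsilon>(u\<^sub>0) + f\<^sub>1 + \<epsilon>(u\<^sub>1) + \<dots> + f\<^sub>n + \<epsilon>(u\<^sub>n)\<close> is represented by
  \<open>(u\<^sub>0, [(f\<^sub>1, u\<^sub>1), \<dots>, (f\<^sub>n, u\<^sub>n)])\<close>.\<close>

type_synonym ('v, 'e, 'f) diagram = "('v, 'e) onepath \<times> ('f \<times> ('v, 'e) onepath) list"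

fun thin_diagram :: "('v, 'e, 'f) two_complex \<Rightarrow> 'f set \<Rightarrow> ('v, 'e, 'f) diagram \<Rightarrow> bool" where
  "thin_diagram K P (u, []) \<longleftrightarrow> u \<in> onepaths K"
| "thin_diagram K P (u, (f, v) # c) \<longleftrightarrow>
     u \<in> onepaths K \<and> f \<in> cells K - P \<and> pend K u = cstart K f \<and> cend K f = pstart v \<and>
     thin_diagram K P (v, c)"

definition cell_side :: "('v, 'e, 'f) two_complex \<Rightarrow> bool \<Rightarrow> 'f \<Rightarrow> ('v, 'e) onepath" where
  "cell_side K k f = (if k then cbot K f else ctop K f)"

text \<open>The first equation and the index \<open>0\<close> are outside the range \<open>1 \<le> i \<le> n\<close> of directions.\<close>

fun diagram_face ::
  "('v, 'e, 'f) two_complex \<Rightarrow> nat \<Rightarrow> bool \<Rightarrow> ('v, 'e, 'f) diagram \<Rightarrow> ('v, 'e, 'f) diagram" where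
  "diagram_face K i k (u, []) = (u, [])"
| "diagram_face K 0 k (u, (f, v) # c) = (u, (f, v) # c)"
| "diagram_face K (Suc 0) k (u, (f, v) # c) = (u \<cdot>\<cdot> cell_side K k f \<cdot>\<cdot> v, c)"
| "diagram_face K (Suc (Suc i)) k (u, (f, v) # c) =
     (case diagram_face K (Suc i) k (v, c) of (v', c') \<Rightarrow> (u, (f, v') # c'))"

definition Sq :: "('v, 'e, 'f) two_complex \<Rightarrow> 'f set \<Rightarrow> ('v, 'e, 'f) diagram cubical" where
  "Sq K P = \<lparr> cubes = (\<lambda>n. {c. thin_diagram K P c \<and> length (snd c) = n}),
              face = diagram_face K \<rparr>"

definition Sq_component ::
  "('v, 'e, 'f) two_complex \<Rightarrow> 'f set \<Rightarrow> ('v, 'e) onepath \<Rightarrow>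
     ('v, 'e, 'f) diagram cube_point set topology" where
  "Sq_component K P q = realization_component (Sq K P) (q, [])"

lemma onepaths_pconcat:
  assumes "directed_two_complex K" "q \<in> onepaths K" "r \<in> onepaths K" "pend K q = pstart r"
  shows "q \<cdot>\<cdot> r \<in> onepaths K" "pstart (q \<cdot>\<cdot> r) = pstart q" "pend K (q \<cdot>\<cdot> r) = pend K r"
proof -
  interpret wf_digraph "graph K"
    using assms(1) by (simp add: directed_two_complex_def)
  obtain u es v where q: "q = (u, es)" "awalk u es v"
    using assms(2) by (auto simp: onepaths_def)
  obtain v' fs w where r: "r = (v', fs)" "awalk v' fs w"
    using assms(3) by (auto simp: onepaths_def)
  have "v' = v"
    using assms(4) q r by (auto simp: pend_def pverts_def pstart_def)
  with q r have qr: "awalk u (es @ fs) w"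
    by (simp add: awalk_appendI)
  then show "q \<cdot>\<cdot> r \<in> onepaths K"
    using q r by (auto simp: onepaths_def pconcat_def)
  show "pstart (q \<cdot>\<cdot> r) = pstart q"
    by (simp add: pstart_def pconcat_def)
  from qr q r show "pend K (q \<cdot>\<cdot> r) = pend K r"
    by (auto simp: pend_def pverts_def pconcat_def)
qed

lemma pconcat_assoc: "(q \<cdot>\<cdot> r) \<cdot>\<cdot> s = q \<cdot>\<cdot> (r \<cdot>\<cdot> s)"
  by (simp add: pconcat_def)

lemma thin_diagram_start: "thin_diagram K P c \<Longrightarrow> fst c \<in> onepaths K"
  by (cases "(K, P, c)" rule: thin_diagram.cases) auto

lemma pstart_diagram_face:
  "1 \<le> i \<Longrightarrow> pstart (fst (diagram_face K i k c)) = pstart (fst c)"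
  by (cases "(K, i, k, c)" rule: diagram_face.cases)
    (auto simp: pstart_def pconcat_def split: prod.splits)

lemma thin_diagram_face:
  "\<lbrakk>directed_two_complex K; thin_diagram K P c; 1 \<le> i; i \<le> length (snd c)\<rbrakk> \<Longrightarrow>
     thin_diagram K P (diagram_face K i k c) \<and>
     length (snd (diagram_face K i k c)) = length (snd c) - 1"
proof (induction K i k c rule: diagram_face.induct)
  case (3 K k u f v c)
  then have f: "f \<in> cells K" and "v \<in> onepaths K"
    using thin_diagram_start by fastforce+
  have dK: "directed_two_complex K" by fact
  then have "cell_side K k f \<in> onepaths K" "pstart (cell_side K k f) = cstart K f"
      "pend K (cell_side K k f) = cend K f"
    using f by (auto simp: directed_two_complex_def cell_side_def cstart_def cend_def)
  then show ?case using dK 3 \<open>v \<in> onepaths K\<close>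
    by (cases c) (auto simp: onepaths_pconcat)
next
  case (4 K i k u f v c)
  obtain v' c' where vc: "diagram_face K (Suc i) k (v, c) = (v', c')" by fastforce
  then have "pstart v' = pstart v" using pstart_diagram_face[of "Suc i" K k "(v, c)"] by simp
  then show ?case using 4 vc by auto
qed auto

lemma diagram_face_commute:
  "1 \<le> i \<Longrightarrow> i < j \<Longrightarrow> j \<le> length (snd c) \<Longrightarrow>
   diagram_face K i k (diagram_face K j l c) = diagram_face K (j - 1) l (diagram_face K i k c)"
proof (induction K j l c arbitrary: i rule: diagram_face.induct)
  case (4 K j k' u f v c)
  obtain i' where i: "i = Suc i'" using 4(2) by (cases i) auto
  obtain g w c'' where c: "c = (g, w) # c''" using 4 by (cases c) auto
  show ?case
  proof (cases i')
    case 0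
    then show ?thesis using i c by (cases j) (auto simp: pconcat_def split: prod.splits)
  next
    case (Suc m)
    then obtain j' where "j = Suc j'" using i 4 by (cases j) auto
    then show ?thesis using i Suc 4 by (auto split: prod.splits)
  qed
qed auto

lemma semi_cubical_Sq:
  assumes "directed_two_complex K"
  shows "semi_cubical (Sq K P)"
  unfolding semi_cubical_def Sq_def
  using thin_diagram_face[OF assms] diagram_face_commute by auto


section \<open>Rooted 2-trees and universal 2-covers\<close>

text \<open>\<open>growth_step M (V, E, F) (V', E', F')\<close>: the subcomplex of \<open>M\<close> with vertices \<open>V'\<close>, edges \<open>E'\<close>
  and cells \<open>F'\<close> is obtained from the one given by \<open>(V, E, F)\<close> by adding cells whose tops lie in
  the latter along with new arcs as their bottoms; \<open>S\<close> is the set of new positive cells.\<close>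

definition growth_step ::
  "('v, 'e, 'f) two_complex \<Rightarrow> 'v set \<times> 'e set \<times> 'f set \<Rightarrow> 'v set \<times> 'e set \<times> 'f set \<Rightarrow> bool" where
  "growth_step M = (\<lambda>(V, E, F) (V', E', F').
     \<exists>S \<subseteq> cells M.
       S \<inter> F = {} \<and> cinv M ` S \<inter> F = {} \<and> S \<inter> cinv M ` S = {} \<and>
       V' = V \<union> (\<Union>f\<in>S. set (pverts M (cbot M f))) \<and>
       E' = E \<union> (\<Union>f\<in>S. set (snd (cbot M f))) \<and>
       F' = F \<union> S \<union> cinv M ` S \<and>
       (\<forall>f\<in>S. set (pverts M (ctop M f)) \<subseteq> V \<and> set (snd (ctop M f)) \<subseteq> E \<and>
          distinct (pverts M (cbot M f)) \<and>
          set (pverts M (cbot M f)) \<inter> V = {cstart M f, cend M f} \<and>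
          set (snd (cbot M f)) \<inter> E = {}) \<and>
       (\<forall>f\<in>S. \<forall>g\<in>S. f \<noteq> g \<longrightarrow>
          set (pverts M (cbot M f)) \<inter> set (pverts M (cbot M g))
            \<subseteq> {cstart M f, cend M f} \<inter> {cstart M g, cend M g} \<and>
          set (snd (cbot M f)) \<inter> set (snd (cbot M g)) = {}))"

definition rooted_two_tree :: "('v, 'e, 'f) two_complex \<Rightarrow> ('v, 'e) onepath \<Rightarrow> bool" where
  "rooted_two_tree M w \<longleftrightarrow>
     directed_two_complex M \<and> w \<in> onepaths M \<and> distinct (pverts M w) \<and>
     (\<exists>V E F.
        V 0 = set (pverts M w) \<and> E 0 = set (snd w) \<and> F 0 = {} \<and>
        (\<forall>n. growth_step M (V n, E n, F n) (V (Suc n), E (Suc n), F (Suc n))) \<and>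
        verts (graph M) = (\<Union>n::nat. V n) \<and> arcs (graph M) = (\<Union>n. E n) \<and> cells M = (\<Union>n. F n))"

record ('w, 'd, 'g, 'v, 'e, 'f) two_complex_map =
  vmap :: "'w \<Rightarrow> 'v"
  emap :: "'d \<Rightarrow> 'e"
  cmap :: "'g \<Rightarrow> 'f"

definition pmap ::
  "('w, 'd, 'g, 'v, 'e, 'f) two_complex_map \<Rightarrow> ('w, 'd) onepath \<Rightarrow> ('v, 'e) onepath" where
  "pmap \<phi> q = (vmap \<phi> (fst q), map (emap \<phi>) (snd q))"

definition two_complex_morphism ::
  "('w, 'd, 'g) two_complex \<Rightarrow> ('v, 'e, 'f) two_complex \<Rightarrow>
     ('w, 'd, 'g, 'v, 'e, 'f) two_complex_map \<Rightarrow> bool" where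
  "two_complex_morphism M K \<phi> \<longleftrightarrow>
     vmap \<phi> ` verts (graph M) \<subseteq> verts (graph K) \<and>
     (\<forall>e\<in>arcs (graph M).
        emap \<phi> e \<in> arcs (graph K) \<and>
        tail (graph K) (emap \<phi> e) = vmap \<phi> (tail (graph M) e) \<and>
        head (graph K) (emap \<phi> e) = vmap \<phi> (head (graph M) e)) \<and>
     (\<forall>f\<in>cells M.
        cmap \<phi> f \<in> cells K \<and>
        ctop K (cmap \<phi> f) = pmap \<phi> (ctop M f) \<and>
        cbot K (cmap \<phi> f) = pmap \<phi> (cbot M f) \<and>
        cinv K (cmap \<phi> f) = cmap \<phi> (cinv M f))"

definition local_map ::
  "('w, 'd, 'g, 'v, 'e, 'f) two_complex_map \<Rightarrow>
     ('w, 'd) onepath \<times> 'g \<times> ('w, 'd) onepath \<Rightarrow> ('v, 'e) onepath \<times> 'f \<times> ('v, 'e) onepath" where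
  "local_map \<phi> = (\<lambda>(q, f, r). (pmap \<phi> q, cmap \<phi> f, pmap \<phi> r))"

definition universal_two_cover ::
  "('v, 'e, 'f) two_complex \<Rightarrow> ('v, 'e) onepath \<Rightarrow> ('w, 'd, 'g) two_complex \<Rightarrow>
     ('w, 'd, 'g, 'v, 'e, 'f) two_complex_map \<Rightarrow> ('w, 'd) onepath \<Rightarrow> bool" where
  "universal_two_cover K p M \<phi> w \<longleftrightarrow>
     directed_two_complex M \<and> two_complex_morphism M K \<phi> \<and>
     rooted_two_tree M w \<and> pmap \<phi> w = p \<and>
     (\<forall>q\<in>onepaths M. pstart q = pstart w \<and> pend M q = pend M w \<longrightarrow>
        bij_betw (local_map \<phi>) (two_star M q) (two_star K (pmap \<phi> q)))"


section \<open>Universal covers of topological spaces\<close>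

text \<open>Counterparts for abstract topologies of the library notions \<^const>\<open>covering_space\<close> and
  \<^const>\<open>simply_connected\<close>, which are about subsets of a type. Loops are contracted relative
  to their base point.\<close>

definition covering_projection :: "'a topology \<Rightarrow> 'b topology \<Rightarrow> ('a \<Rightarrow> 'b) \<Rightarrow> bool" where
  "covering_projection E B \<pi> \<longleftrightarrow>
     continuous_map E B \<pi> \<and> \<pi> ` topspace E = topspace B \<and>
     (\<forall>b\<in>topspace B. \<exists>U. openin B U \<and> b \<in> U \<and>
        (\<exists>\<V>. \<Union>\<V> = {e \<in> topspace E. \<pi> e \<in> U} \<and> (\<forall>V\<in>\<V>. openin E V) \<and> pairwise disjnt \<V> \<and>
           (\<forall>V\<in>\<V>. homeomorphic_map (subtopology E V) (subtopology B U) \<pi>)))"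

definition simply_connected_topology :: "'a topology \<Rightarrow> bool" where
  "simply_connected_topology X \<longleftrightarrow>
     path_connected_space X \<and>
     (\<forall>g x. pathin X g \<and> g 0 = x \<and> g 1 = x \<longrightarrow>
        homotopic_with (\<lambda>h. h 0 = x \<and> h 1 = x) (top_of_set {0..1}) X g (\<lambda>_. x))"

definition universal_cover :: "'a topology \<Rightarrow> 'b topology \<Rightarrow> ('a \<Rightarrow> 'b) \<Rightarrow> bool" where
  "universal_cover E B \<pi> \<longleftrightarrow> covering_projection E B \<pi> \<and> simply_connected_topology E"

end

theory Submission
  imports Defs
begin

text \<open>
  Let \<open>a\<close> and \<open>b\<close> be the ends of the root of the universal 2-cover \<open>Kt\<close>. The proof studies the
  complex \<open>Sq_between\<close> of all thin diagrams of \<open>Kt\<close> from \<open>a\<close> to \<open>b\<close>. It is a union of components of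
  the Squier complex of \<open>Kt\<close>, it covers a union of components of the Squier complex of \<open>K\<close>, and
  it is contractible; hence both unions are single components and the covering is universal.

  \<^bold>\<open>The covering.\<close> Orient \<open>Kt\<close> by pulling back the orientation of \<open>K\<close>, so that the morphism maps
  thin diagrams to thin diagrams. If one face of a thin diagram of \<open>K\<close> has been lifted, then the
  diagram has exactly one lift with this face (\<open>unique_coface_lift\<close>): the 1-path that
  takes the place of the missing cell is cut out by counting edges, and (U2), applied to a 1-path
  from \<open>a\<close> to \<open>b\<close> that runs through it, provides the cell. A map of cubical complexes along which
  cofaces lift uniquely induces a covering of realizations (\<open>covering_projection_proj\<close>). For an
  evenly covered neighbourhood, round the coordinates that are close to 0 or 1; the points that are
  rounded into a given cube \<open>y\<close> form an open set, and its preimage is the disjoint union of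
  the analogous sets for the cubes over \<open>y\<close>.

  \<^bold>\<open>The contraction.\<close> A point of a Squier complex is described by a word whose letters are edges and
  cells with weights in \<open>[0,1]\<close>, where a cell of weight 0 or 1 may be replaced by its top or
  bottom. In these terms \<open>f\<close> with weight \<open>t\<close> is the inverse of \<open>f\<close> with weight \<open>1 - t\<close>, so the
  realization does not depend on the orientation (\<open>realization_Sq_between_orientation\<close>), and
  the cells in thin diagrams may be taken to be those that have been attached along their tops.
  A word from \<open>a\<close> to \<open>b\<close> in one stage of the construction of \<open>Kt\<close> cannot leave an arc that is new
  at this stage before its end (\<open>bottoms_traversed\<close>). So it can be pushed across all the new cells
  simultaneously, by decreasing their weights from 1 to 0, into the previous stage. Doing this stage after stage
  moves every word to the root. There are infinitely many stages, but each cube meets only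
  finitely many of them, so they can be performed in the intervals \<open>[1/(i+2), 1/(i+1)]\<close>, with the
  identity at time 0 (\<open>simply_connected_tree_Sq\<close>).
\<close>

section \<open>Points and maps of realizations\<close>

lemma in_topspace_cube_sum [simp]:
  "((n, x), s) \<in> topspace (cube_sum X) \<longleftrightarrow> x \<in> cubes X n \<and> s \<in> topspace (unit_cube n)"
  by (simp add: cube_sum_def)

lemma topspace_realization: "topspace (realization X) = glue_class X ` topspace (cube_sum X)"
  by (simp add: realization_def)

lemma quotient_map_glue_class: "quotient_map (cube_sum X) (realization X) (glue_class X)"
  by (simp add: realization_def quotient_map_quotient_topology)

lemma topspace_unit_cube: "topspace (unit_cube n) = PiE {1..n} (\<lambda>_. {0..1})"
  by (simp add: unit_cube_def)

lemma continuous_map_into_unit_cube: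
  "continuous_map Z (unit_cube n) f \<longleftrightarrow>
     f ` topspace Z \<subseteq> extensional {1..n} \<and>
     (\<forall>i\<in>{1..n}. continuous_map Z (top_of_set {0..1}) (\<lambda>z. f z i))"
  by (auto simp: unit_cube_def continuous_map_componentwise)

lemma face_inclusion_in_unit_cube:
  assumes "s \<in> topspace (unit_cube (n - 1))" "i \<in> {1..n}"
  shows "face_inclusion n i k s \<in> topspace (unit_cube n)"
  using assms by (force simp: topspace_unit_cube face_inclusion_def PiE_iff)

lemma glue_class_eq_iff:
  "glue_class X a = glue_class X b \<longleftrightarrow> (a, b) \<in> (gluing X \<union> (gluing X)\<inverse>)\<^sup>*"
proof -
  let ?R = "(gluing X \<union> (gluing X)\<inverse>)\<^sup>*"
  have "sym ?R"
    by (intro sym_rtrancl) (auto intro: symI)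
  then show ?thesis
    unfolding glue_class_def by (auto dest: symD intro: rtrancl_trans)
qed

lemma glue_class_face:
  assumes "x \<in> cubes X n" "i \<in> {1..n}" "s \<in> topspace (unit_cube (n - 1))"
  shows "glue_class X ((n, x), face_inclusion n i k s) = glue_class X ((n - 1, face X i k x), s)"
  unfolding glue_class_eq_iff using assms by (intro r_into_rtrancl) (auto simp: gluing_def)

definition respects_gluing :: "'c cubical \<Rightarrow> ('c cube_point \<Rightarrow> 'b) \<Rightarrow> bool" where
  "respects_gluing X F \<longleftrightarrow>
     (\<forall>n. \<forall>x\<in>cubes X n. \<forall>i\<in>{1..n}. \<forall>k. \<forall>s\<in>topspace (unit_cube (n - 1)).
        F ((n, x), face_inclusion n i k s) = F ((n - 1, face X i k x), s))"

lemma respects_gluing_eq: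
  assumes "respects_gluing X F" "glue_class X a = glue_class X b"
  shows "F a = F b"
proof -
  have *: "F u = F v" if "(u, v) \<in> gluing X" for u v
    using that assms(1) by (auto simp: gluing_def respects_gluing_def)
  have "(a, b) \<in> (gluing X \<union> (gluing X)\<inverse>)\<^sup>*"
    using assms(2) by (simp add: glue_class_eq_iff)
  then show ?thesis
    by induction (auto dest: *)
qed

definition glue_lift :: "('c cube_point \<Rightarrow> 'b) \<Rightarrow> 'c cube_point set \<Rightarrow> 'b" where
  "glue_lift F C = F (SOME a. a \<in> C)"

lemma glue_lift [simp]:
  assumes "respects_gluing X F"
  shows "glue_lift F (glue_class X a) = F a"
proof -
  have "a \<in> glue_class X a"
    by (simp add: glue_class_def)
  then have "(SOME b. b \<in> glue_class X a) \<in> glue_class X a"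
    by (rule someI)
  then have "glue_class X a = glue_class X (SOME b. b \<in> glue_class X a)"
    unfolding glue_class_eq_iff by (simp add: glue_class_def)
  then show ?thesis
    unfolding glue_lift_def using respects_gluing_eq[OF assms] by metis
qed

lemma continuous_map_glue_class:
  assumes "x \<in> cubes X n"
  shows "continuous_map (unit_cube n) (realization X) (\<lambda>s. glue_class X ((n, x), s))"
proof -
  have "continuous_map (unit_cube n) (cube_sum X) (\<lambda>s. ((n, x), s))"
    unfolding cube_sum_def
    using continuous_map_component_injection[of "(n, x)" "SIGMA n:UNIV. cubes X n"
        "\<lambda>(n, x). unit_cube n"] assms by simp
  from continuous_map_compose[OF this quotient_imp_continuous_map[OF quotient_map_glue_class]]
  show ?thesis
    by (simp add: o_def)
qed

text \<open>Each summand is open in the sum, so that a box around a point can be chosen inside one summand.\<close>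

lemma continuous_map_prod_sum_topology:
  assumes "\<And>i. i \<in> I \<Longrightarrow> continuous_map (prod_topology (T i) Z) W (\<lambda>(s, z). F (i, s) z)"
  shows "continuous_map (prod_topology (sum_topology T I) Z) W (\<lambda>(a, z). F a z)"
  unfolding continuous_map
proof (intro conjI allI impI)
  show "(\<lambda>(a, z). F a z) ` topspace (prod_topology (sum_topology T I) Z) \<subseteq> topspace W"
    using assms[THEN continuous_map_image_subset_topspace] by fastforce
next
  fix U assume U: "openin W U"
  show "openin (prod_topology (sum_topology T I) Z)
          {x \<in> topspace (prod_topology (sum_topology T I) Z). (case x of (a, z) \<Rightarrow> F a z) \<in> U}"
    unfolding openin_prod_topology_alt
  proof (intro allI impI)
    fix a z
    assume az: "(a, z) \<in> {x \<in> topspace (prod_topology (sum_topology T I) Z).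
                            (case x of (a, z) \<Rightarrow> F a z) \<in> U}"
    obtain i s where a: "a = (i, s)" "i \<in> I" "s \<in> topspace (T i)"
      using az by auto
    let ?P = "{x \<in> topspace (prod_topology (T i) Z). (case x of (s, z) \<Rightarrow> F (i, s) z) \<in> U}"
    have "openin (prod_topology (T i) Z) ?P"
      using openin_continuous_map_preimage[OF assms[OF a(2)] U] by simp
    moreover have "(s, z) \<in> ?P"
      using az a by auto
    ultimately obtain A B where AB: "openin (T i) A" "openin Z B" "s \<in> A" "z \<in> B" "A \<times> B \<subseteq> ?P"
      unfolding openin_prod_topology_alt by meson
    have "openin (sum_topology T I) (Pair i ` A)"
      using open_map_component_injection[OF a(2), of T] AB(1) unfolding open_map_def by blast
    moreover have "Pair i ` A \<times> B \<subseteq>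
        {x \<in> topspace (prod_topology (sum_topology T I) Z). (case x of (a, z) \<Rightarrow> F a z) \<in> U}"
      using AB(5) a openin_subset[OF AB(1)] openin_subset[OF AB(2)] by fastforce
    ultimately show "\<exists>A B. openin (sum_topology T I) A \<and> openin Z B \<and> a \<in> A \<and> z \<in> B \<and>
        A \<times> B \<subseteq> {x \<in> topspace (prod_topology (sum_topology T I) Z).
                    (case x of (a, z) \<Rightarrow> F a z) \<in> U}"
      using AB a by blast
  qed
qed

text \<open>Homotopies on a realization are constructed cube by cube. This is legitimate because the
  product with a locally compact Hausdorff space preserves quotient maps.\<close>

lemma continuous_map_glue_lift_prod:
  assumes Z: "locally_compact_space Z" "Hausdorff_space Z"
    and F: "\<And>z. z \<in> topspace Z \<Longrightarrow> respects_gluing X (\<lambda>a. F a z)"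
    and cont: "\<And>n x. x \<in> cubes X n \<Longrightarrow>
      continuous_map (prod_topology (unit_cube n) Z) W (\<lambda>(s, z). F ((n, x), s) z)"
  shows "continuous_map (prod_topology (realization X) Z) W (\<lambda>(C, z). glue_lift (\<lambda>a. F a z) C)"
proof -
  have q: "quotient_map (prod_topology (cube_sum X) Z) (prod_topology (realization X) Z)
             (\<lambda>(a, z). (glue_class X a, z))"
    using Z quotient_map_prod_left[OF _ _ quotient_map_glue_class] by blast
  have "continuous_map (prod_topology (cube_sum X) Z) W (\<lambda>(a, z). F a z)"
    unfolding cube_sum_def
    by (rule continuous_map_prod_sum_topology) (use cont in auto)
  then have "continuous_map (prod_topology (cube_sum X) Z) W
      ((\<lambda>(C, z). glue_lift (\<lambda>a. F a z) C) \<circ> (\<lambda>(a, z). (glue_class X a, z)))"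
    by (rule continuous_map_eq) (use F in auto)
  then show ?thesis
    using continuous_compose_quotient_map[OF q] by blast
qed

lemma continuous_map_glue_lift:
  assumes F: "respects_gluing X F"
    and cont: "\<And>n x. x \<in> cubes X n \<Longrightarrow> continuous_map (unit_cube n) W (\<lambda>s. F ((n, x), s))"
  shows "continuous_map (realization X) W (glue_lift F)"
proof -
  have "continuous_map (cube_sum X) W (glue_lift F \<circ> glue_class X)"
    unfolding continuous_map
  proof (intro conjI allI impI)
    show "(glue_lift F \<circ> glue_class X) ` topspace (cube_sum X) \<subseteq> topspace W"
      using cont[THEN continuous_map_image_subset_topspace] F
      by (fastforce simp: image_subset_iff)
  next
    fix U assume "openin W U"
    then have "openin (unit_cube n) {s \<in> topspace (unit_cube n). F ((n, x), s) \<in> U}"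
      if "x \<in> cubes X n" for n x
      using openin_continuous_map_preimage[OF cont[OF that]] by simp
    then show "openin (cube_sum X) {a \<in> topspace (cube_sum X). (glue_lift F \<circ> glue_class X) a \<in> U}"
      using F by (auto simp: cube_sum_def openin_sum_topology)
  qed
  then show ?thesis
    using continuous_compose_quotient_map[OF quotient_map_glue_class] by blast
qed

lemma openin_realization_glue_image:
  assumes S: "S \<subseteq> topspace (cube_sum X)" and sat: "respects_gluing X (\<lambda>a. a \<in> S)"
  shows "glue_class X a \<in> glue_class X ` S \<longleftrightarrow> a \<in> S"
    and "openin (realization X) (glue_class X ` S) \<longleftrightarrow>
           (\<forall>n. \<forall>x\<in>cubes X n. openin (unit_cube n) {s. ((n, x), s) \<in> S})"
proof -
  show *: "glue_class X a \<in> glue_class X ` S \<longleftrightarrow> a \<in> S" for a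
    using respects_gluing_eq[OF sat] by blast
  have "openin (realization X) (glue_class X ` S) \<longleftrightarrow>
          openin (cube_sum X) {a \<in> topspace (cube_sum X). glue_class X a \<in> glue_class X ` S}"
    unfolding realization_def openin_quotient_topology using S by blast
  also have "{a \<in> topspace (cube_sum X). glue_class X a \<in> glue_class X ` S} = S"
    using * S by auto
  also have "openin (cube_sum X) S \<longleftrightarrow>
      (\<forall>n. \<forall>x\<in>cubes X n. openin (unit_cube n) {s. ((n, x), s) \<in> S})"
    using S by (auto simp: cube_sum_def openin_sum_topology)
  finally show "openin (realization X) (glue_class X ` S) \<longleftrightarrow>
           (\<forall>n. \<forall>x\<in>cubes X n. openin (unit_cube n) {s. ((n, x), s) \<in> S})" .
qed

lemma openin_realization:
  "openin (realization X) W \<longleftrightarrow> W \<subseteq> topspace (realization X) \<and>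
     (\<forall>n. \<forall>x\<in>cubes X n. openin (unit_cube n)
        {s \<in> topspace (unit_cube n). glue_class X ((n, x), s) \<in> W})"
proof -
  have "openin (realization X) W \<longleftrightarrow> W \<subseteq> topspace (realization X) \<and>
          openin (cube_sum X) {a \<in> topspace (cube_sum X). glue_class X a \<in> W}"
    unfolding realization_def openin_quotient_topology by simp
  also have "openin (cube_sum X) {a \<in> topspace (cube_sum X). glue_class X a \<in> W} \<longleftrightarrow>
    (\<forall>n. \<forall>x\<in>cubes X n. openin (unit_cube n)
        {s \<in> topspace (unit_cube n). glue_class X ((n, x), s) \<in> W})"
    by (auto simp: cube_sum_def openin_sum_topology)
  finally show ?thesis .
qed

section \<open>Unions of components\<close>

definition restrict_cubes :: "'c cubical \<Rightarrow> 'c set \<Rightarrow> 'c cubical" where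
  "restrict_cubes X A = \<lparr>cubes = \<lambda>n. cubes X n \<inter> A, face = face X\<rparr>"

text \<open>A set of cubes with this property is a union of components, since neither passing to a face
  nor to a coface leads out of it.\<close>

definition component_closed :: "'c cubical \<Rightarrow> 'c set \<Rightarrow> bool" where
  "component_closed X A \<longleftrightarrow>
     (\<forall>n. \<forall>x\<in>cubes X n. \<forall>i\<in>{1..n}. \<forall>k. face X i k x \<in> A \<longleftrightarrow> x \<in> A)"

lemma restrict_cubes_simps [simp]:
  "cubes (restrict_cubes X A) n = cubes X n \<inter> A" "face (restrict_cubes X A) = face X"
  by (simp_all add: restrict_cubes_def)

lemma semi_cubical_restrict_cubes:
  assumes "semi_cubical X" "component_closed X A"
  shows "semi_cubical (restrict_cubes X A)"
  using assms unfolding semi_cubical_def component_closed_def restrict_cubes_simps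
  by (intro conjI allI ballI impI) (blast | simp)+

context
  fixes X :: "'c cubical" and A :: "'c set"
  assumes A: "component_closed X A"
begin

text \<open>Gluing never leads out of \<open>A\<close>. The classes are therefore equal as sets, which makes the
  realization of the restriction a subspace rather than a copy of one.\<close>

lemma glue_class_restrict_cubes:
  assumes "snd (fst a) \<in> A"
  shows "glue_class (restrict_cubes X A) a = glue_class X a"
proof -
  let ?R = "gluing (restrict_cubes X A) \<union> (gluing (restrict_cubes X A))\<inverse>"
  have "snd (fst b) \<in> A \<and> (a, b) \<in> ?R\<^sup>*" if "(a, b) \<in> (gluing X \<union> (gluing X)\<inverse>)\<^sup>*" for b
    using that
  proof induction
    case base
    then show ?case using assms by simp
  next
    case (step b c)
    then have "snd (fst c) \<in> A" "(b, c) \<in> ?R"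
      using A unfolding gluing_def component_closed_def by auto
    with step show ?case
      by (meson rtrancl.rtrancl_into_rtrancl)
  qed
  moreover have "gluing (restrict_cubes X A) \<subseteq> gluing X"
    unfolding gluing_def by simp blast
  then have "?R\<^sup>* \<subseteq> (gluing X \<union> (gluing X)\<inverse>)\<^sup>*"
    by (intro rtrancl_mono) auto
  ultimately show ?thesis
    unfolding glue_class_def by auto
qed

definition sub_points :: "'c cube_point set set" where
  "sub_points = glue_class X ` {a \<in> topspace (cube_sum X). snd (fst a) \<in> A}"

lemma glue_class_in_sub_points:
  assumes "x \<in> cubes X n" "s \<in> topspace (unit_cube n)"
  shows "glue_class X ((n, x), s) \<in> sub_points \<longleftrightarrow> x \<in> A"
proof -
  have sat: "respects_gluing X (\<lambda>a. snd (fst a) \<in> A)"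
    using A by (simp add: respects_gluing_def component_closed_def)
  then have eq: "snd (fst a) \<in> A \<longleftrightarrow> x \<in> A" if "glue_class X ((n, x), s) = glue_class X a" for a
    using respects_gluing_eq[OF sat that] by simp
  show ?thesis
  proof
    assume "glue_class X ((n, x), s) \<in> sub_points"
    then show "x \<in> A"
      unfolding sub_points_def using eq by blast
  next
    assume "x \<in> A"
    then have "((n, x), s) \<in> {a \<in> topspace (cube_sum X). snd (fst a) \<in> A}"
      using assms by simp
    then show "glue_class X ((n, x), s) \<in> sub_points"
      unfolding sub_points_def by (rule imageI)
  qed
qed

text \<open>A cube lies either inside \<open>sub_points\<close> or outside of it.\<close>

lemma sub_points_clopen:
  "openin (realization X) sub_points" "closedin (realization X) sub_points"
proof -
  have sub: "sub_points \<subseteq> topspace (realization X)"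
    unfolding sub_points_def topspace_realization by auto
  have "{s \<in> topspace (unit_cube n). glue_class X ((n, x), s) \<in> sub_points} =
      (if x \<in> A then topspace (unit_cube n) else {})" if "x \<in> cubes X n" for n x
    using glue_class_in_sub_points[OF that] by auto
  then have "openin (unit_cube n)
      {s \<in> topspace (unit_cube n). glue_class X ((n, x), s) \<in> sub_points}" if "x \<in> cubes X n" for n x
    using that by simp
  with sub show "openin (realization X) sub_points"
    by (simp add: openin_realization)
  have "{s \<in> topspace (unit_cube n).
        glue_class X ((n, x), s) \<in> topspace (realization X) - sub_points} =
      (if x \<in> A then {} else topspace (unit_cube n))" if "x \<in> cubes X n" for n x
    using glue_class_in_sub_points[OF that] that by (auto simp: topspace_realization)
  then have "openin (unit_cube n) {s \<in> topspace (unit_cube n).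
        glue_class X ((n, x), s) \<in> topspace (realization X) - sub_points}"
    if "x \<in> cubes X n" for n x
    using that by (cases "x \<in> A") (simp_all only: if_True if_False openin_empty openin_topspace)
  with sub show "closedin (realization X) sub_points"
    unfolding closedin_def openin_realization by blast
qed

lemma realization_restrict_cubes:
  "realization (restrict_cubes X A) = subtopology (realization X) sub_points"
proof -
  have top: "topspace (realization (restrict_cubes X A)) = sub_points"
    unfolding topspace_realization sub_points_def using glue_class_restrict_cubes
    by (fastforce simp: image_iff)
  have "openin (realization (restrict_cubes X A)) W \<longleftrightarrow> W \<subseteq> sub_points \<and> openin (realization X) W" for W
  proof (cases "W \<subseteq> sub_points")
    case True
    have empty: "{s \<in> topspace (unit_cube n). glue_class X ((n, x), s) \<in> W} = {}"
      if "x \<in> cubes X n" "x \<notin> A" for n x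
      using glue_class_in_sub_points[OF that(1)] that True by auto
    have same: "glue_class (restrict_cubes X A) ((n, x), s) = glue_class X ((n, x), s)"
      if "x \<in> A" for n x s
      using glue_class_restrict_cubes that by simp
    have sub: "W \<subseteq> topspace (realization X)"
      using sub_points_clopen openin_subset True by blast
    have "(\<forall>x\<in>cubes X n \<inter> A. openin (unit_cube n)
          {s \<in> topspace (unit_cube n). glue_class (restrict_cubes X A) ((n, x), s) \<in> W}) \<longleftrightarrow>
        (\<forall>x\<in>cubes X n. openin (unit_cube n)
          {s \<in> topspace (unit_cube n). glue_class X ((n, x), s) \<in> W})" for n
      using same empty by (metis (mono_tags, lifting) Collect_cong IntD1 IntD2 IntI openin_empty)
    then show ?thesis
      unfolding openin_realization[of "restrict_cubes X A"] openin_realization[of X] top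
      using True sub by simp
  qed (use top openin_subset in blast)
  then show ?thesis
    using openin_open_subtopology[OF sub_points_clopen(1)] by (auto simp: topology_eq)
qed

lemma realization_component_eq:
  assumes conn: "connected_space (realization (restrict_cubes X A))"
    and x: "x \<in> cubes X 0" "x \<in> A"
  shows "realization_component X x = realization (restrict_cubes X A)"
proof -
  have v: "vertex_point X x \<in> sub_points"
    unfolding vertex_point_def using x by (subst glue_class_in_sub_points) (auto simp: topspace_unit_cube)
  have "connectedin (realization X) sub_points"
    using conn sub_points_clopen(1)[THEN openin_subset]
    by (simp add: connectedin_def realization_restrict_cubes)
  with v have "sub_points \<subseteq> connected_component_of_set (realization X) (vertex_point X x)"
    by (simp add: connected_component_of_maximal)
  moreover have "connected_component_of_set (realization X) (vertex_point X x) \<subseteq> sub_points"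
  proof -
    have "connectedin (realization X) (connected_component_of_set (realization X) (vertex_point X x))"
      by (rule connectedin_connected_component_of)
    moreover have "vertex_point X x \<in> connected_component_of_set (realization X) (vertex_point X x)"
      using v sub_points_clopen(1)[THEN openin_subset] connected_component_of_refl by fastforce
    ultimately show ?thesis
      using v sub_points_clopen connectedin_clopen_cases unfolding disjnt_def by blast
  qed
  ultimately show ?thesis
    by (simp add: realization_component_def realization_restrict_cubes)
qed

end

section \<open>Coverings of cubical complexes\<close>

lemma realization_pointE:
  assumes "C \<in> topspace (realization X)"
  obtains n x s where "C = glue_class X ((n, x), s)" "x \<in> cubes X n" "s \<in> topspace (unit_cube n)"
proof -
  obtain a where "C = glue_class X a" "a \<in> topspace (cube_sum X)"
    using assms unfolding topspace_realization by blast
  then show ?thesis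
    using that by (cases a) auto
qed

text \<open>The pattern \<open>p\<close> prescribes one of the two ends for some of the coordinates. Faces are taken
  from the last coordinate to the first, so that the coordinates still to be treated keep their
  numbers.\<close>

primrec pattern_face :: "'c cubical \<Rightarrow> (nat \<Rightarrow> bool option) \<Rightarrow> nat \<Rightarrow> 'c \<Rightarrow> 'c" where
  "pattern_face X p 0 x = x"
| "pattern_face X p (Suc j) x =
     pattern_face X p j (case p (Suc j) of None \<Rightarrow> x | Some k \<Rightarrow> face X (Suc j) k x)"

primrec pattern_dim :: "(nat \<Rightarrow> bool option) \<Rightarrow> nat \<Rightarrow> nat \<Rightarrow> nat" where
  "pattern_dim p 0 n = n"
| "pattern_dim p (Suc j) n = pattern_dim p j (case p (Suc j) of None \<Rightarrow> n | Some k \<Rightarrow> n - 1)"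

definition nearby_end :: "real \<Rightarrow> real \<Rightarrow> bool option" where
  "nearby_end \<delta> t = (if t < \<delta> then Some False else if t > 1 - \<delta> then Some True else None)"

lemma face_inclusion_below: "1 \<le> l \<Longrightarrow> l < i \<Longrightarrow> i \<le> n \<Longrightarrow> face_inclusion n i k s l = s l"
  by (simp add: face_inclusion_def)

lemma face_inclusion_above: "i \<le> l \<Longrightarrow> l < n \<Longrightarrow> face_inclusion n i k s (Suc l) = s l"
  by (simp add: face_inclusion_def)

lemma pattern_face_cong:
  "(\<And>i. i \<in> {1..j} \<Longrightarrow> p i = q i) \<Longrightarrow> pattern_face X p j x = pattern_face X q j x"
  by (induction j arbitrary: x) auto

lemma pattern_face_in_cubes:
  assumes "semi_cubical X"
  shows "x \<in> cubes X n \<Longrightarrow> j \<le> n \<Longrightarrow> pattern_face X p j x \<in> cubes X (pattern_dim p j n)"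
proof (induction j arbitrary: x n)
  case (Suc j)
  have "face X (Suc j) k x \<in> cubes X (n - 1)" for k
    using assms Suc.prems unfolding semi_cubical_def by simp
  then show ?case
    using Suc by (auto split: option.split)
qed simp

text \<open>A coordinate equal to 0 or 1 is rounded to itself. So a point on the boundary of a cube is
  rounded into the same cube when it is regarded as a point of the face.\<close>

lemma pattern_face_face_inclusion:
  assumes X: "semi_cubical X" and \<delta>: "0 < \<delta>" "\<delta> < 1 / 2"
  shows "x \<in> cubes X n \<Longrightarrow> 1 \<le> i \<Longrightarrow> i \<le> j \<Longrightarrow> j \<le> m \<Longrightarrow> j \<le> n \<Longrightarrow>
    pattern_face X (\<lambda>l. nearby_end \<delta> (face_inclusion m i k s l)) j x =
    pattern_face X (\<lambda>l. nearby_end \<delta> (s l)) (j - 1) (face X i k x)"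
proof (induction j arbitrary: x n)
  case (Suc j)
  let ?p = "\<lambda>l. nearby_end \<delta> (face_inclusion m i k s l)"
  let ?q = "\<lambda>l. nearby_end \<delta> (s l)"
  show ?case
  proof (cases "i = Suc j")
    case True
    have "?p (Suc j) = Some k"
      using True Suc.prems \<delta> by (auto simp: face_inclusion_def nearby_end_def)
    moreover have "pattern_face X ?p j y = pattern_face X ?q j y" for y
      by (rule pattern_face_cong) (use True Suc.prems in \<open>auto simp: face_inclusion_def\<close>)
    ultimately show ?thesis
      using True by simp
  next
    case False
    then have i: "1 \<le> i" "i \<le> j"
      using Suc.prems by auto
    then obtain j' where j': "j = Suc j'"
      by (cases j) auto
    have pq: "?p (Suc j) = ?q j"
      using False i Suc.prems by (auto simp: face_inclusion_def)
    have "pattern_face X ?p j (case ?q j of None \<Rightarrow> x | Some l \<Rightarrow> face X (Suc j) l x) =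
          pattern_face X ?q (j - 1) (case ?q j of None \<Rightarrow> face X i k x
             | Some l \<Rightarrow> face X j l (face X i k x))"
    proof (cases "?q j")
      case None
      then show ?thesis
        using Suc.IH[of x n] i Suc.prems by simp
    next
      case (Some l)
      have "face X i k (face X (Suc j) l x) = face X j l (face X i k x)"
        using X i Suc.prems unfolding semi_cubical_def by (metis diff_Suc_1 le_imp_less_Suc)
      moreover have "face X (Suc j) l x \<in> cubes X (n - 1)"
        using X i Suc.prems unfolding semi_cubical_def by simp
      ultimately show ?thesis
        using Suc.IH[of "face X (Suc j) l x" "n - 1"] i Suc.prems Some by simp
    qed
    moreover have "pattern_face X ?p (Suc j) x =
        pattern_face X ?p j (case ?p (Suc j) of None \<Rightarrow> x | Some l \<Rightarrow> face X (Suc j) l x)"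
      by (rule pattern_face.simps)
    moreover have "pattern_face X ?q j y = pattern_face X ?q (j - 1)
        (case ?q j of None \<Rightarrow> y | Some l \<Rightarrow> face X j l y)" for y
      unfolding j' by simp
    ultimately show ?thesis
      using pq by simp
  qed
qed simp

text \<open>The points that are rounded into the cube \<open>y\<close> with threshold \<open>\<delta>\<close>. Coordinates equal to
  a threshold are excluded to obtain an open set.\<close>

definition star_points :: "'c cubical \<Rightarrow> real \<Rightarrow> 'c \<Rightarrow> 'c cube_point set" where
  "star_points X \<delta> y = {((n, x), s). x \<in> cubes X n \<and> s \<in> topspace (unit_cube n) \<and>
     (\<forall>i\<in>{1..n}. s i \<noteq> \<delta> \<and> s i \<noteq> 1 - \<delta>) \<and>
     pattern_face X (\<lambda>i. nearby_end \<delta> (s i)) n x = y}"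

definition cell_star :: "'c cubical \<Rightarrow> real \<Rightarrow> 'c \<Rightarrow> 'c cube_point set set" where
  "cell_star X \<delta> y = glue_class X ` star_points X \<delta> y"

lemma star_points_subset: "star_points X \<delta> y \<subseteq> topspace (cube_sum X)"
  by (auto simp: star_points_def)

lemma respects_gluing_star_points:
  assumes X: "semi_cubical X" and \<delta>: "0 < \<delta>" "\<delta> < 1 / 2"
  shows "respects_gluing X (\<lambda>a. a \<in> star_points X \<delta> y)"
  unfolding respects_gluing_def
proof (intro allI ballI)
  fix n x i k s
  assume x: "x \<in> cubes X n" and i: "i \<in> {1..n}" and s: "s \<in> topspace (unit_cube (n - 1))"
  have "(\<forall>l\<in>{1..n}. face_inclusion n i k s l \<noteq> \<delta> \<and> face_inclusion n i k s l \<noteq> 1 - \<delta>) \<longleftrightarrow>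
        (\<forall>l\<in>{1..n - 1}. s l \<noteq> \<delta> \<and> s l \<noteq> 1 - \<delta>)" (is "?L \<longleftrightarrow> ?R")
  proof
    assume L: ?L
    show ?R
    proof
      fix l assume l: "l \<in> {1..n - 1}"
      then have "l < n"
        by auto
      then have "l \<in> {1..n}" "Suc l \<in> {1..n}"
        using l by auto
      from this[THEN bspec[OF L]] show "s l \<noteq> \<delta> \<and> s l \<noteq> 1 - \<delta>"
        using face_inclusion_below[of l i n k s] face_inclusion_above[of i l n k s] l i \<open>l < n\<close>
        by (cases "l < i") auto
    qed
  next
    assume R: ?R
    show ?L
    proof
      fix l assume l: "l \<in> {1..n}"
      show "face_inclusion n i k s l \<noteq> \<delta> \<and> face_inclusion n i k s l \<noteq> 1 - \<delta>"
      proof (cases l i rule: linorder_cases)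
        case less
        then show ?thesis
          using bspec[OF R, of l] l i by (simp add: face_inclusion_def)
      next
        case equal
        then show ?thesis
          using \<delta> l by (cases k) (auto simp: face_inclusion_def)
      next
        case greater
        then show ?thesis
          using bspec[OF R, of "l - 1"] l i by (simp add: face_inclusion_def) linarith
      qed
    qed
  qed
  moreover have "face X i k x \<in> cubes X (n - 1)"
    using X x i unfolding semi_cubical_def by simp
  moreover have "pattern_face X (\<lambda>l. nearby_end \<delta> (face_inclusion n i k s l)) n x =
    pattern_face X (\<lambda>l. nearby_end \<delta> (s l)) (n - 1) (face X i k x)"
    using pattern_face_face_inclusion[OF X \<delta> x] i by simp
  ultimately show "((n, x), face_inclusion n i k s) \<in> star_points X \<delta> y \<longleftrightarrow>
      ((n - 1, face X i k x), s) \<in> star_points X \<delta> y"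
    using x s face_inclusion_in_unit_cube[OF s i] by (simp add: star_points_def)
qed

lemma glue_class_in_cell_star:
  assumes "semi_cubical X" "0 < \<delta>" "\<delta> < 1 / 2"
  shows "glue_class X a \<in> cell_star X \<delta> y \<longleftrightarrow> a \<in> star_points X \<delta> y"
  unfolding cell_star_def
  by (rule openin_realization_glue_image(1)[OF star_points_subset respects_gluing_star_points[OF assms]])

lemma openin_nearby_end:
  "openin (top_of_set {0..1}) {t \<in> {0..1}. t \<noteq> \<delta> \<and> t \<noteq> 1 - \<delta> \<and> nearby_end \<delta> t = q}"
proof -
  consider (lower) "q = Some False" | (upper) "q = Some True" | (mid) "q = None"
    by (cases q) auto
  then show ?thesis
  proof cases
    case lower
    have "{t \<in> {0..1}. t \<noteq> \<delta> \<and> t \<noteq> 1 - \<delta> \<and> nearby_end \<delta> t = q} =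
        {0..1} \<inter> ({..<\<delta>} - {1 - \<delta>})"
      using lower by (auto simp: nearby_end_def split: if_splits)
    then show ?thesis
      by (simp add: openin_open_Int open_Diff)
  next
    case upper
    have "{t \<in> {0..1}. t \<noteq> \<delta> \<and> t \<noteq> 1 - \<delta> \<and> nearby_end \<delta> t = q} =
        {0..1} \<inter> ({1 - \<delta><..} \<inter> {\<delta><..})"
      using upper by (auto simp: nearby_end_def split: if_splits)
    then show ?thesis
      by (simp add: openin_open_Int open_Int)
  next
    case mid
    have "{t \<in> {0..1}. t \<noteq> \<delta> \<and> t \<noteq> 1 - \<delta> \<and> nearby_end \<delta> t = q} =
        {0..1} \<inter> ({\<delta><..<1 - \<delta>})"
      using mid by (auto simp: nearby_end_def split: if_splits)
    then show ?thesis
      by (simp add: openin_open_Int)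
  qed
qed

text \<open>Away from the thresholds the rounding pattern is locally constant: the trace of the star on a
  cube is a union of open boxes, one for each pattern that leads to \<open>y\<close>.\<close>

lemma openin_cell_star:
  assumes X: "semi_cubical X" and \<delta>: "0 < \<delta>" "\<delta> < 1 / 2"
  shows "openin (realization X) (cell_star X \<delta> y)"
  unfolding cell_star_def
    openin_realization_glue_image(2)[OF star_points_subset respects_gluing_star_points[OF X \<delta>]]
proof (intro allI ballI)
  fix n x assume x: "x \<in> cubes X n"
  let ?box = "\<lambda>p. PiE {1..n} (\<lambda>i. {t \<in> {0..1}. t \<noteq> \<delta> \<and> t \<noteq> 1 - \<delta> \<and> nearby_end \<delta> t = p i})"
  have "{s. ((n, x), s) \<in> star_points X \<delta> y} = \<Union> (?box ` {p. pattern_face X p n x = y})"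
  proof (intro set_eqI iffI)
    fix s assume "s \<in> {s. ((n, x), s) \<in> star_points X \<delta> y}"
    then have "s \<in> ?box (\<lambda>i. nearby_end \<delta> (s i))"
        "pattern_face X (\<lambda>i. nearby_end \<delta> (s i)) n x = y"
      by (auto simp: star_points_def topspace_unit_cube PiE_iff)
    then show "s \<in> \<Union> (?box ` {p. pattern_face X p n x = y})"
      by blast
  next
    fix s assume "s \<in> \<Union> (?box ` {p. pattern_face X p n x = y})"
    then obtain p where p: "pattern_face X p n x = y" "s \<in> ?box p"
      by blast
    then have "pattern_face X (\<lambda>i. nearby_end \<delta> (s i)) n x = y"
      by (subst pattern_face_cong[of n _ p]) (auto simp: PiE_iff)
    then show "s \<in> {s. ((n, x), s) \<in> star_points X \<delta> y}"
      using p x by (auto simp: star_points_def topspace_unit_cube PiE_iff)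
  qed
  moreover have "openin (unit_cube n) (?box p)" for p
    unfolding unit_cube_def openin_PiE_gen using openin_nearby_end
    by (intro disjI2 conjI ballI) simp_all
  ultimately show "openin (unit_cube n) {s. ((n, x), s) \<in> star_points X \<delta> y}"
    by auto
qed

text \<open>The combinatorial counterpart of a covering: once a face of a cube has been lifted, there is
  exactly one way to lift the cube.\<close>

locale cubical_covering =
  fixes X :: "'a cubical" and Y :: "'b cubical" and f :: "'a \<Rightarrow> 'b"
  assumes X: "semi_cubical X" and Y: "semi_cubical Y"
    and image: "f ` cubes X n = cubes Y n"
    and f_face: "x \<in> cubes X n \<Longrightarrow> i \<in> {1..n} \<Longrightarrow> f (face X i k x) = face Y i k (f x)"
    and unique_coface: "y \<in> cubes Y n \<Longrightarrow> i \<in> {1..n} \<Longrightarrow> x' \<in> cubes X (n - 1) \<Longrightarrow>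
      f x' = face Y i k y \<Longrightarrow> \<exists>!x. x \<in> cubes X n \<and> f x = y \<and> face X i k x = x'"
begin

definition point_map :: "'a cube_point \<Rightarrow> 'b cube_point set" where
  "point_map = (\<lambda>((n, x), s). glue_class Y ((n, f x), s))"

definition proj :: "'a cube_point set \<Rightarrow> 'b cube_point set" where
  "proj = glue_lift point_map"

lemma f_cubes: "x \<in> cubes X n \<Longrightarrow> f x \<in> cubes Y n"
  using image by blast

lemma face_cubes: "x \<in> cubes X n \<Longrightarrow> i \<in> {1..n} \<Longrightarrow> face X i k x \<in> cubes X (n - 1)"
  using X unfolding semi_cubical_def by blast

lemma respects_gluing_point_map: "respects_gluing X point_map"
  using glue_class_face[of _ Y] f_cubes f_face
  by (simp add: respects_gluing_def point_map_def)

lemma proj_glue_class [simp]: "proj (glue_class X ((n, x), s)) = glue_class Y ((n, f x), s)"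
  unfolding proj_def by (subst glue_lift[OF respects_gluing_point_map]) (simp add: point_map_def)

lemma continuous_map_proj: "continuous_map (realization X) (realization Y) proj"
  unfolding proj_def
  by (rule continuous_map_glue_lift[OF respects_gluing_point_map])
    (simp add: point_map_def continuous_map_glue_class f_cubes)

lemma lift_gluing:
  assumes "(a, b) \<in> gluing Y \<union> (gluing Y)\<inverse>" "a = ((n, f x), s)" "x \<in> cubes X n"
  shows "\<exists>n' x' s'. b = ((n', f x'), s') \<and> x' \<in> cubes X n' \<and>
           glue_class X ((n', x'), s') = glue_class X ((n, x), s)"
proof -
  consider "(a, b) \<in> gluing Y" | "(b, a) \<in> gluing Y"
    using assms(1) by blast
  then show ?thesis
  proof cases
    case 1
    then obtain i k s' where "s = face_inclusion n i k s'" "b = ((n - 1, face Y i k (f x)), s')"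
        "i \<in> {1..n}" "s' \<in> topspace (unit_cube (n - 1))"
      using assms(2) by (auto simp: gluing_def)
    then show ?thesis
      using glue_class_face[OF assms(3)] f_face[OF assms(3)] face_cubes[OF assms(3)] by metis
  next
    case 2
    then obtain m y i k where b: "b = ((m, y), face_inclusion m i k s)" "n = m - 1"
        "f x = face Y i k y" "i \<in> {1..m}" "s \<in> topspace (unit_cube (m - 1))" "y \<in> cubes Y m"
      using assms(2) by (auto simp: gluing_def)
    then obtain x' where x': "x' \<in> cubes X m" "f x' = y" "face X i k x' = x"
      using unique_coface[of y m i x k] assms(3) by blast
    then have "glue_class X ((m, x'), face_inclusion m i k s) = glue_class X ((n, x), s)"
      using glue_class_face[OF x'(1) b(4,5)] b(2) by simp
    then show ?thesis
      using x' b(1) by blast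
  qed
qed

text \<open>A chain of gluings in \<open>Y\<close> lifts step by step: passing to a face is possible because \<open>f\<close> commutes
  with faces, passing to a coface because cofaces lift.\<close>

lemma fibre_lift:
  assumes "glue_class Y ((n, f x), s) = glue_class Y b" "x \<in> cubes X n"
  shows "\<exists>n' x' s'. b = ((n', f x'), s') \<and> x' \<in> cubes X n' \<and>
           glue_class X ((n', x'), s') = glue_class X ((n, x), s)"
proof -
  have "(((n, f x), s), b) \<in> (gluing Y \<union> (gluing Y)\<inverse>)\<^sup>*"
    using assms(1) by (simp add: glue_class_eq_iff)
  then show ?thesis
  proof induction
    case base
    then show ?case using assms(2) by blast
  next
    case (step b c)
    then show ?case using lift_gluing by metis
  qed
qed

lemma open_map_proj: "open_map (realization X) (realization Y) proj"
  unfolding open_map_def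
proof (intro allI impI)
  fix W assume W: "openin (realization X) W"
  have "openin (unit_cube n) {s \<in> topspace (unit_cube n). glue_class Y ((n, y), s) \<in> proj ` W}"
    if "y \<in> cubes Y n" for n y
  proof -
    have "{s \<in> topspace (unit_cube n). glue_class Y ((n, y), s) \<in> proj ` W} =
      (\<Union>x\<in>{x \<in> cubes X n. f x = y}. {s \<in> topspace (unit_cube n). glue_class X ((n, x), s) \<in> W})"
      (is "?L = ?R")
    proof
      show "?L \<subseteq> ?R"
      proof
        fix s assume s: "s \<in> ?L"
        then obtain C where C: "C \<in> W" "glue_class Y ((n, y), s) = proj C"
          by auto
        then obtain m x t where x: "C = glue_class X ((m, x), t)" "x \<in> cubes X m"
          using openin_subset[OF W] by (meson realization_pointE subsetD)
        then obtain x' where "f x' = y" "x' \<in> cubes X n" "glue_class X ((n, x'), s) = C"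
          using fibre_lift[of m x t "((n, y), s)"] C by auto
        then show "s \<in> ?R"
          using C s by blast
      qed
      show "?R \<subseteq> ?L"
        by (auto simp: image_iff intro!: bexI)
    qed
    moreover have "openin (unit_cube n) {s \<in> topspace (unit_cube n). glue_class X ((n, x), s) \<in> W}"
      if "x \<in> cubes X n" for x
      using W that unfolding openin_realization by blast
    ultimately show ?thesis
      by auto
  qed
  moreover have "proj ` W \<subseteq> topspace (realization Y)"
    using openin_subset[OF W] continuous_map_proj
    by (meson continuous_map_image_subset_topspace dual_order.trans image_mono)
  ultimately show "openin (realization Y) (proj ` W)"
    unfolding openin_realization by blast
qed

lemma pattern_face_image:
  "x \<in> cubes X n \<Longrightarrow> j \<le> n \<Longrightarrow> f (pattern_face X p j x) = pattern_face Y p j (f x)"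
proof (induction j arbitrary: x n)
  case (Suc j)
  have "f (pattern_face X p j (face X (Suc j) k x)) = pattern_face Y p j (face Y (Suc j) k (f x))" for k
    using face_cubes[of x n "Suc j" k] f_face[of x n "Suc j" k]
      Suc.IH[of "face X (Suc j) k x" "n - 1"] Suc.prems by simp
  then show ?case
    using Suc.IH[of x n] Suc.prems by (simp split: option.split)
qed simp

text \<open>Unique lifting of cofaces, iterated.\<close>

lemma unique_pattern_lift:
  "y \<in> cubes Y n \<Longrightarrow> j \<le> n \<Longrightarrow> x0 \<in> cubes X (pattern_dim p j n) \<Longrightarrow> f x0 = pattern_face Y p j y \<Longrightarrow>
    \<exists>!x. x \<in> cubes X n \<and> f x = y \<and> pattern_face X p j x = x0"
proof (induction j arbitrary: y n)
  case (Suc j)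
  show ?case
  proof (cases "p (Suc j)")
    case None
    then show ?thesis
      using Suc by simp
  next
    case (Some k)
    have j: "Suc j \<in> {1..n}"
      using Suc.prems by simp
    have "face Y (Suc j) k y \<in> cubes Y (n - 1)"
      using Y Suc.prems j unfolding semi_cubical_def by blast
    then have ex1: "\<exists>!w. w \<in> cubes X (n - 1) \<and> f w = face Y (Suc j) k y \<and> pattern_face X p j w = x0"
      using Suc.prems Some by (intro Suc.IH) auto
    then obtain w where w: "w \<in> cubes X (n - 1)" "f w = face Y (Suc j) k y" "pattern_face X p j w = x0"
      by blast
    obtain x where x: "x \<in> cubes X n" "f x = y" "face X (Suc j) k x = w"
      using unique_coface[OF Suc.prems(1) j w(1,2)] by blast
    have "x' = x" if x': "x' \<in> cubes X n" "f x' = y" "pattern_face X p (Suc j) x' = x0" for x'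
    proof -
      have "face X (Suc j) k x' = w"
        using ex1 w face_cubes[OF x'(1) j, of k] f_face[OF x'(1) j, of k] x'(2,3) Some by auto
      then show ?thesis
        using unique_coface[OF Suc.prems(1) j w(1,2)] x x' by blast
    qed
    moreover have "pattern_face X p (Suc j) x = x0"
      using Some x w by simp
    ultimately show ?thesis
      using x by blast
  qed
qed auto

text \<open>The sheets over the star of \<open>y0\<close> are the stars of the cubes over \<open>y0\<close>. A point \<open>(y, t)\<close> of the
  star has exactly one preimage in each sheet by \<open>unique_pattern_lift\<close>, and \<open>fibre_lift\<close> makes
  this independent of the cube that represents the point.\<close>

lemma covering_projection_proj: "covering_projection (realization X) (realization Y) proj"
  unfolding covering_projection_def
proof (intro conjI ballI)
  show "continuous_map (realization X) (realization Y) proj"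
    by (rule continuous_map_proj)
  show "proj ` topspace (realization X) = topspace (realization Y)"
  proof
    show "proj ` topspace (realization X) \<subseteq> topspace (realization Y)"
      using continuous_map_proj by (rule continuous_map_image_subset_topspace)
    show "topspace (realization Y) \<subseteq> proj ` topspace (realization X)"
    proof
      fix C assume "C \<in> topspace (realization Y)"
      then obtain n y s where y: "C = glue_class Y ((n, y), s)" "y \<in> cubes Y n" "s \<in> topspace (unit_cube n)"
        by (auto elim: realization_pointE)
      then obtain x where "x \<in> cubes X n" "f x = y"
        using image[of n] by (metis imageE)
      with y have "C = proj (glue_class X ((n, x), s))" "((n, x), s) \<in> topspace (cube_sum X)"
        by simp_all
      then show "C \<in> proj ` topspace (realization X)"
        unfolding topspace_realization by blast
    qed
  qed
  fix b assume "b \<in> topspace (realization Y)"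
  then obtain m y s where y: "b = glue_class Y ((m, y), s)" "y \<in> cubes Y m" "s \<in> topspace (unit_cube m)"
    by (rule realization_pointE)
  \<comment> \<open>The point itself must not be excluded by the threshold.\<close>
  have "infinite ({0<..<1/2::real} - (s ` {1..m} \<union> (\<lambda>i. 1 - s i) ` {1..m}))"
    by (intro Diff_infinite_finite) (auto simp: infinite_Ioo)
  from infinite_imp_nonempty[OF this]
  obtain \<delta> where "\<delta> \<in> {0<..<1/2::real} - (s ` {1..m} \<union> (\<lambda>i. 1 - s i) ` {1..m})"
    by blast
  then have \<delta>: "0 < \<delta>" "\<delta> < 1 / 2" "\<delta> \<notin> s ` {1..m}" "\<delta> \<notin> (\<lambda>i. 1 - s i) ` {1..m}"
    by auto
  define y0 where "y0 = pattern_face Y (\<lambda>i. nearby_end \<delta> (s i)) m y"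
  define U where "U = cell_star Y \<delta> y0"
  define \<V> where "\<V> = cell_star X \<delta> ` {x0. f x0 = y0 \<and> (\<exists>n. x0 \<in> cubes X n)}"
  have starX: "glue_class X a \<in> cell_star X \<delta> x0 \<longleftrightarrow> a \<in> star_points X \<delta> x0" for a x0
    by (rule glue_class_in_cell_star[OF X \<delta>(1,2)])
  have starY: "glue_class Y a \<in> cell_star Y \<delta> x0 \<longleftrightarrow> a \<in> star_points Y \<delta> x0" for a x0
    by (rule glue_class_in_cell_star[OF Y \<delta>(1,2)])
  have proj_star: "((n, f x), t) \<in> star_points Y \<delta> y0 \<longleftrightarrow>
      ((n, x), t) \<in> star_points X \<delta> (pattern_face X (\<lambda>i. nearby_end \<delta> (t i)) n x) \<and>
      f (pattern_face X (\<lambda>i. nearby_end \<delta> (t i)) n x) = y0"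
    if "x \<in> cubes X n" for n x t
    using that f_cubes pattern_face_image[OF that] by (auto simp: star_points_def)
  have "((m, y), s) \<in> star_points Y \<delta> y0"
    using y \<delta> by (fastforce simp: star_points_def y0_def image_iff)
  then have "b \<in> U"
    unfolding U_def using y starY by simp
  moreover have "openin (realization Y) U"
    unfolding U_def by (rule openin_cell_star[OF Y \<delta>(1,2)])
  moreover have "\<Union>\<V> = {e \<in> topspace (realization X). proj e \<in> U}"
  proof (intro set_eqI iffI)
    fix e assume "e \<in> \<Union>\<V>"
    then obtain x0 n x t where e: "e = glue_class X ((n, x), t)" "((n, x), t) \<in> star_points X \<delta> x0"
        "f x0 = y0"
      unfolding \<V>_def cell_star_def by fastforce
    then have "x \<in> cubes X n" "((n, x), t) \<in> topspace (cube_sum X)"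
        "x0 = pattern_face X (\<lambda>i. nearby_end \<delta> (t i)) n x"
      by (auto simp: star_points_def)
    then show "e \<in> {e \<in> topspace (realization X). proj e \<in> U}"
      using e proj_star by (auto simp: U_def topspace_realization starY)
  next
    fix e assume e: "e \<in> {e \<in> topspace (realization X). proj e \<in> U}"
    then obtain n x t where x: "e = glue_class X ((n, x), t)" "x \<in> cubes X n"
      by (auto elim: realization_pointE)
    let ?x0 = "pattern_face X (\<lambda>i. nearby_end \<delta> (t i)) n x"
    have "e \<in> cell_star X \<delta> ?x0" "f ?x0 = y0"
      using e x proj_star by (auto simp: U_def starY starX)
    moreover have "\<exists>n. ?x0 \<in> cubes X n"
      using pattern_face_in_cubes[OF X x(2)] by blast
    ultimately show "e \<in> \<Union>\<V>"
      unfolding \<V>_def by blast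
  qed
  moreover have "\<forall>V\<in>\<V>. openin (realization X) V"
    unfolding \<V>_def using openin_cell_star[OF X \<delta>(1,2)] by blast
  moreover have "pairwise disjnt \<V>"
  proof (rule pairwiseI)
    fix V V' assume "V \<in> \<V>" "V' \<in> \<V>" "V \<noteq> V'"
    then obtain x0 x1 where V: "V = cell_star X \<delta> x0" "V' = cell_star X \<delta> x1" "x0 \<noteq> x1"
      unfolding \<V>_def by blast
    have "False" if C: "C \<in> V" "C \<in> V'" for C
    proof -
      obtain a where "C = glue_class X a" "a \<in> star_points X \<delta> x0"
        using C(1) unfolding V(1) cell_star_def by blast
      with C(2) V have "a \<in> star_points X \<delta> x0" "a \<in> star_points X \<delta> x1"
        using starX by auto
      with V(3) show False
        by (auto simp: star_points_def)
    qed
    then show "disjnt V V'"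
      by (auto simp: disjnt_iff)
  qed
  moreover have "\<forall>V\<in>\<V>. homeomorphic_map (subtopology (realization X) V)
      (subtopology (realization Y) U) proj"
  proof
    fix V assume V: "V \<in> \<V>"
    obtain x0 where x0: "V = cell_star X \<delta> x0" "f x0 = y0" "\<exists>n. x0 \<in> cubes X n"
      using V unfolding \<V>_def by blast
    have VX: "V \<subseteq> topspace (realization X)" and UY: "U \<subseteq> topspace (realization Y)"
      unfolding x0 U_def
      using openin_cell_star[OF X \<delta>(1,2), THEN openin_subset]
        openin_cell_star[OF Y \<delta>(1,2), THEN openin_subset] by auto
    have "inj_on proj V"
    proof (rule inj_onI)
      fix C D assume C: "C \<in> V" and D: "D \<in> V" and eq: "proj C = proj D"
      obtain n x t where x: "C = glue_class X ((n, x), t)" "((n, x), t) \<in> star_points X \<delta> x0"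
        using C x0 by (fastforce simp: cell_star_def)
      obtain n' x' t' where x': "D = glue_class X ((n', x'), t')" "((n', x'), t') \<in> star_points X \<delta> x0"
        using D x0 by (fastforce simp: cell_star_def)
      have cubes: "x \<in> cubes X n" "x' \<in> cubes X n'"
        using x x' by (auto simp: star_points_def)
      obtain x'' where x'': "f x'' = f x'" "x'' \<in> cubes X n'" "glue_class X ((n', x''), t') = C"
        using fibre_lift[of n x t "((n', f x'), t')"] eq x x' cubes by auto
      then have "((n', x''), t') \<in> star_points X \<delta> x0"
        using C x0 starX by auto
      with x'(2) have pf: "pattern_face X (\<lambda>i. nearby_end \<delta> (t' i)) n' x'' = x0"
          "pattern_face X (\<lambda>i. nearby_end \<delta> (t' i)) n' x' = x0"
        by (auto simp: star_points_def)
      have "x'' = x'"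
        using unique_pattern_lift[of "f x'" n' n' x0 "\<lambda>i. nearby_end \<delta> (t' i)"]
          pf x'' cubes f_cubes pattern_face_image[OF cubes(2), of n' "\<lambda>i. nearby_end \<delta> (t' i)"]
          pattern_face_in_cubes[OF X cubes(2), of n' "\<lambda>i. nearby_end \<delta> (t' i)"]
        by auto
      then show "C = D"
        using x'' x' by simp
    qed
    moreover have "proj ` V = U"
    proof
      show "proj ` V \<subseteq> U"
        using \<open>\<Union>\<V> = _\<close> V by blast
      show "U \<subseteq> proj ` V"
      proof
        fix C assume "C \<in> U"
        then obtain n y t where y: "C = glue_class Y ((n, y), t)" "((n, y), t) \<in> star_points Y \<delta> y0"
          unfolding U_def cell_star_def by fastforce
        let ?p = "\<lambda>i. nearby_end \<delta> (t i)"
        have yn: "y \<in> cubes Y n" "pattern_face Y ?p n y = y0"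
          using y by (auto simp: star_points_def)
        obtain k where k: "x0 \<in> cubes X k"
          using x0 by blast
        have "y0 \<in> cubes Y k" "y0 \<in> cubes Y (pattern_dim ?p n n)"
          using f_cubes[OF k] x0 pattern_face_in_cubes[OF Y yn(1), of n ?p] yn by auto
        then have "k = pattern_dim ?p n n"
          using Y unfolding semi_cubical_def by (metis disjoint_iff)
        then obtain x where x: "x \<in> cubes X n" "f x = y" "pattern_face X ?p n x = x0"
          using unique_pattern_lift[OF yn(1), of n x0 ?p] k yn x0 by auto
        then have "((n, x), t) \<in> star_points X \<delta> x0"
          using y by (auto simp: star_points_def)
        then have "glue_class X ((n, x), t) \<in> V"
          using x0 starX by simp
        moreover have "proj (glue_class X ((n, x), t)) = C"
          using x y by simp
        ultimately show "C \<in> proj ` V"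
          by blast
      qed
    qed
    moreover have "continuous_map (subtopology (realization X) V) (subtopology (realization Y) U) proj"
      using \<open>proj ` V = U\<close> continuous_map_proj
      by (auto simp: continuous_map_in_subtopology continuous_map_from_subtopology)
    moreover have "open_map (subtopology (realization X) V) (subtopology (realization Y) U) proj"
      unfolding open_map_def
    proof (intro allI impI)
      fix W assume "openin (subtopology (realization X) V) W"
      then have "openin (realization X) W" "W \<subseteq> V"
        using \<open>\<forall>V\<in>\<V>. openin (realization X) V\<close> V by (auto simp: openin_open_subtopology)
      then have "openin (realization Y) (proj ` W)" "proj ` W \<subseteq> U"
        using open_map_proj \<open>proj ` V = U\<close> unfolding open_map_def by blast+
      then show "openin (subtopology (realization Y) U) (proj ` W)"
        using \<open>openin (realization Y) U\<close> by (simp add: openin_open_subtopology)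
    qed
    ultimately show "homeomorphic_map (subtopology (realization X) V) (subtopology (realization Y) U) proj"
      using VX UY by (intro bijective_open_imp_homeomorphic_map) (auto simp: Int_absorb1)
  qed
  ultimately show "\<exists>U. openin (realization Y) U \<and> b \<in> U \<and>
        (\<exists>\<V>. \<Union>\<V> = {e \<in> topspace (realization X). proj e \<in> U} \<and>
          (\<forall>V\<in>\<V>. openin (realization X) V) \<and> pairwise disjnt \<V> \<and>
          (\<forall>V\<in>\<V>. homeomorphic_map (subtopology (realization X) V) (subtopology (realization Y) U) proj))"
    by (intro exI[of _ U] exI[of _ \<V>] conjI) assumption+
qed

end

section \<open>Contractions and simple connectivity\<close>

lemma continuous_map_unit_square:
  assumes "continuous_on ({0..1} \<times> {0..1}) f" "f ` ({0..1} \<times> {0..1}) \<subseteq> {0..1}"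
  shows "continuous_map (prod_topology (top_of_set {0..1::real}) (top_of_set {0..1::real}))
           (top_of_set {0..1::real}) f"
  using assms by (simp add: prod_topology_subtopology_eu image_subset_iff_funcset)

lemma homotopic_loops_intro:
  assumes "continuous_map (prod_topology (top_of_set {0..1::real}) (top_of_set {0..1::real})) X h"
    and "\<And>s. s \<in> {0..1} \<Longrightarrow> h (0, s) = p s" "\<And>s. s \<in> {0..1} \<Longrightarrow> h (1, s) = q s"
    and "\<And>t. t \<in> {0..1} \<Longrightarrow> h (t, 0) = x \<and> h (t, 1) = x"
  shows "homotopic_with (\<lambda>h. h 0 = x \<and> h 1 = x) (top_of_set {0..1}) X p q"
  by (subst homotopic_with) (use assms in auto)

text \<open>A contraction moves the base point \<open>x\<close> of a loop along the path \<open>D (x, t)\<close>. To keep the base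
  point fixed, this path is attached to both ends of the loop: the loop is first deformed into
  \<open>D (x, t)\<close> run through forth and back, and then pulled back along it.\<close>

theorem simply_connected_topology_contraction:
  assumes D: "continuous_map (prod_topology X (top_of_set {0..1::real})) X D"
    and D0: "\<And>x. x \<in> topspace X \<Longrightarrow> D (x, 0) = x"
    and D1: "\<And>x. x \<in> topspace X \<Longrightarrow> D (x, 1) = c"
  shows "simply_connected_topology X"
  unfolding simply_connected_topology_def
proof (intro conjI allI impI)
  have path: "pathin X (\<lambda>t. D (x, t))" if "x \<in> topspace X" for x
  proof -
    have "continuous_map (top_of_set {0..1}) (prod_topology X (top_of_set {0..1::real})) (\<lambda>t. (x, t))"
      using that by (intro continuous_map_pairedI) auto
    from continuous_map_compose[OF this D] show ?thesis
      by (simp add: pathin_def o_def)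
  qed
  then have "path_component_of X x c" if "x \<in> topspace X" for x
    unfolding path_component_of_def using D0 D1 that by blast
  then show "path_connected_space X"
    unfolding path_connected_space_iff_path_component
    by (metis path_component_of_sym path_component_of_trans)
next
  fix g :: "real \<Rightarrow> 'a" and x
  assume g: "pathin X g \<and> g 0 = x \<and> g 1 = x"
  then have x: "x \<in> topspace X"
    using path_start_in_topspace by blast
  have gX: "g s \<in> topspace X" if "s \<in> {0..1}" for s
    using g that unfolding pathin_def continuous_map by auto
  have cont: "continuous_map (prod_topology (top_of_set {0..1::real}) (top_of_set {0..1})) X
      (\<lambda>z. D (g (\<theta> z), h z))"
    if "continuous_on ({0..1} \<times> {0..1}) \<theta>" "\<theta> ` ({0..1} \<times> {0..1}) \<subseteq> {0..1}"
      "continuous_on ({0..1} \<times> {0..1}) h" "h ` ({0..1} \<times> {0..1}) \<subseteq> {0..1}"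
    for \<theta> h :: "real \<times> real \<Rightarrow> real"
  proof -
    have "continuous_map (prod_topology (top_of_set {0..1::real}) (top_of_set {0..1})) X (g \<circ> \<theta>)"
      using g continuous_map_unit_square[OF that(1,2)] unfolding pathin_def
      by (blast intro: continuous_map_compose)
    then have "continuous_map (prod_topology (top_of_set {0..1::real}) (top_of_set {0..1}))
        (prod_topology X (top_of_set {0..1})) (\<lambda>z. (g (\<theta> z), h z))"
      using continuous_map_unit_square[OF that(3,4)] by (intro continuous_map_pairedI) (auto simp: o_def)
    from continuous_map_compose[OF this D] show ?thesis
      by (simp add: o_def)
  qed
  \<comment> \<open>At time \<open>t\<close> the loop runs in \<open>[t/(1+2t), (1+t)/(1+2t)]\<close>; at time 1 this is the middle third, on which the tent is at least 1.\<close>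
  define \<theta> where "\<theta> = (\<lambda>z::real \<times> real. max 0 (min 1 (snd z * (1 + 2 * fst z) - fst z)))"
  define tent where "tent = (\<lambda>s::real. min (3 * s) (3 * (1 - s)))"
  have "homotopic_with (\<lambda>h. h 0 = x \<and> h 1 = x) (top_of_set {0..1}) X g (\<lambda>s. D (x, min 1 (tent s)))"
  proof (rule homotopic_loops_intro)
    show "continuous_map (prod_topology (top_of_set {0..1::real}) (top_of_set {0..1})) X
        (\<lambda>z. D (g (\<theta> z), min (fst z) (tent (snd z))))"
      by (rule cont; unfold \<theta>_def tent_def) (auto intro!: continuous_intros)
  next
    fix s :: real assume s: "s \<in> {0..1}"
    have "\<theta> (0, s) = s" "min 0 (tent s) = 0"
      using s by (auto simp: \<theta>_def tent_def)
    then show "D (g (\<theta> (0, s)), min (fst (0, s)) (tent (snd (0, s)))) = g s"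
      using D0 gX s by simp
    consider "s \<le> 1/3" | "1/3 \<le> s" "s \<le> 2/3" | "2/3 \<le> s"
      by linarith
    then show "D (g (\<theta> (1, s)), min (fst (1, s)) (tent (snd (1, s)))) = D (x, min 1 (tent s))"
    proof cases
      case 1
      then have "\<theta> (1, s) = 0"
        by (auto simp: \<theta>_def)
      then show ?thesis
        using g by simp
    next
      case 2
      then have "min 1 (tent s) = 1" "\<theta> (1, s) \<in> {0..1}"
        by (auto simp: \<theta>_def tent_def)
      then show ?thesis
        using D1 gX x by simp
    next
      case 3
      then have "\<theta> (1, s) = 1"
        by (auto simp: \<theta>_def)
      then show ?thesis
        using g by simp
    qed
  next
    fix t :: real assume t: "t \<in> {0..1}"
    have "\<theta> (t, 0) = 0" "\<theta> (t, 1) = 1" "min t (tent 0) = 0" "min t (tent 1) = 0"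
      using t by (auto simp: \<theta>_def tent_def)
    then show "D (g (\<theta> (t, 0)), min (fst (t, 0)) (tent (snd (t, 0)))) = x \<and>
        D (g (\<theta> (t, 1)), min (fst (t, 1)) (tent (snd (t, 1)))) = x"
      using g D0[OF x] by simp
  qed
  moreover have "homotopic_with (\<lambda>h. h 0 = x \<and> h 1 = x) (top_of_set {0..1}) X
      (\<lambda>s. D (x, min 1 (tent s))) (\<lambda>_. x)"
  proof (rule homotopic_loops_intro)
    have "continuous_map (prod_topology (top_of_set {0..1::real}) (top_of_set {0..1})) X
        (\<lambda>z. D (g 0, min (1 - fst z) (tent (snd z))))"
      using cont[of "\<lambda>_. 0" "\<lambda>z. min (1 - fst z) (tent (snd z))"]
      by (force simp: tent_def intro!: continuous_intros)
    then show "continuous_map (prod_topology (top_of_set {0..1::real}) (top_of_set {0..1})) X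
        (\<lambda>z. D (x, min (1 - fst z) (tent (snd z))))"
      using g by simp
  next
    fix s :: real assume "s \<in> {0..1}"
    then have "min (1 - 1) (tent s) = 0"
      by (auto simp: tent_def)
    then show "D (x, min (1 - fst (0, s)) (tent (snd (0, s)))) = D (x, min 1 (tent s))"
        "D (x, min (1 - fst (1, s)) (tent (snd (1, s)))) = x"
      using D0[OF x] by simp_all
  next
    fix t :: real assume t: "t \<in> {0..1}"
    have "min (1 - t) (tent 0) = 0" "min (1 - t) (tent 1) = 0"
      using t by (auto simp: tent_def)
    then show "D (x, min (1 - fst (t, 0)) (tent (snd (t, 0)))) = x \<and>
        D (x, min (1 - fst (t, 1)) (tent (snd (t, 1)))) = x"
      using D0[OF x] by simp
  qed
  ultimately show "homotopic_with (\<lambda>h. h 0 = x \<and> h 1 = x) (top_of_set {0..1}) X g (\<lambda>_. x)"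
    by (rule homotopic_with_trans)
qed

lemma homeomorphic_simply_connected_topology:
  assumes "X homeomorphic_space Y" "simply_connected_topology X"
  shows "simply_connected_topology Y"
  unfolding simply_connected_topology_def
proof (intro conjI allI impI)
  show "path_connected_space Y"
    using assms homeomorphic_path_connected_space simply_connected_topology_def by blast
  obtain f g where fg: "homeomorphic_maps X Y f g"
    using assms(1) unfolding homeomorphic_space_def by blast
  then have f: "continuous_map X Y f" and g: "continuous_map Y X g"
    and inv: "\<And>y. y \<in> topspace Y \<Longrightarrow> f (g y) = y"
    by (auto simp: homeomorphic_maps_def)
  fix p :: "real \<Rightarrow> 'b" and y
  assume p: "pathin Y p \<and> p 0 = y \<and> p 1 = y"
  then have y: "y \<in> topspace Y"
    using path_start_in_topspace by blast
  have "pathin X (g \<circ> p)"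
    using p g unfolding pathin_def by (blast intro: continuous_map_compose)
  then have "homotopic_with (\<lambda>h. h 0 = g y \<and> h 1 = g y) (top_of_set {0..1}) X (g \<circ> p) (\<lambda>_. g y)"
    using assms(2)[unfolded simply_connected_topology_def, THEN conjunct2, rule_format, of "g \<circ> p" "g y"] p
    by simp
  then obtain h where h: "continuous_map (prod_topology (top_of_set {0..1::real}) (top_of_set {0..1})) X h"
      "\<And>s. h (0, s) = g (p s)" "\<And>s. h (1, s) = g y" "\<And>t. t \<in> {0..1} \<Longrightarrow> h (t, 0) = g y \<and> h (t, 1) = g y"
    unfolding homotopic_with_def by auto
  have pY: "p s \<in> topspace Y" if "s \<in> {0..1}" for s
    using p that unfolding pathin_def continuous_map by auto
  show "homotopic_with (\<lambda>h. h 0 = y \<and> h 1 = y) (top_of_set {0..1}) Y p (\<lambda>_. y)"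
    by (rule homotopic_loops_intro[OF continuous_map_compose[OF h(1) f]])
      (use h inv y pY in auto)
qed

section \<open>Points of Squier complexes as words\<close>

text \<open>A word describes a point of the realization: \<open>Cell f t\<close> is the point with coordinate \<open>t\<close> of the
  cell \<open>f\<close>. The cube is obtained by forgetting the weights. Words are easier to manipulate than
  diagrams because they are composed by concatenation and are not interrupted by 1-paths.\<close>

datatype ('e, 'f) letter = Edge 'e | Cell 'f real

fun weights :: "('e, 'f) letter list \<Rightarrow> real list" where
  "weights [] = []"
| "weights (Edge e # w) = weights w"
| "weights (Cell f t # w) = t # weights w"

lemma weights_append [simp]: "weights (w @ w') = weights w @ weights w'"
  by (induction w rule: weights.induct) auto

lemma weights_map_Edge [simp]: "weights (map Edge es) = []"
  by (induction es) auto

definition coords :: "('e, 'f) letter list \<Rightarrow> nat \<Rightarrow> real" where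
  "coords w = (\<lambda>i\<in>{1..length (weights w)}. weights w ! (i - 1))"

fun word_diagram :: "('v, 'e, 'f) two_complex \<Rightarrow> 'v \<Rightarrow> ('e, 'f) letter list \<Rightarrow> ('v, 'e, 'f) diagram" where
  "word_diagram M v [] = ((v, []), [])"
| "word_diagram M v (Edge e # w) =
     (case word_diagram M (head (graph M) e) w of (u, c) \<Rightarrow> ((v, e # snd u), c))"
| "word_diagram M v (Cell f t # w) = ((v, []), (f, fst (word_diagram M (cend M f) w)) #
     snd (word_diagram M (cend M f) w))"

fun valid_word :: "('v, 'e, 'f) two_complex \<Rightarrow> 'f set \<Rightarrow> 'v \<Rightarrow> ('e, 'f) letter list \<Rightarrow> 'v \<Rightarrow> bool" where
  "valid_word M C v [] x \<longleftrightarrow> v = x \<and> v \<in> verts (graph M)"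
| "valid_word M C v (Edge e # w) x \<longleftrightarrow>
     e \<in> arcs (graph M) \<and> tail (graph M) e = v \<and> valid_word M C (head (graph M) e) w x"
| "valid_word M C v (Cell f t # w) x \<longleftrightarrow>
     f \<in> C \<and> t \<in> {0..1} \<and> cstart M f = v \<and> valid_word M C (cend M f) w x"

fun diagram_word :: "('v, 'e, 'f) diagram \<Rightarrow> (nat \<Rightarrow> real) \<Rightarrow> ('e, 'f) letter list" where
  "diagram_word (u, []) s = map Edge (snd u)"
| "diagram_word (u, (f, v) # c) s =
     map Edge (snd u) @ Cell f (s 1) # diagram_word (v, c) (\<lambda>i. s (Suc i))"

fun diagram_end :: "('v, 'e, 'f) two_complex \<Rightarrow> ('v, 'e, 'f) diagram \<Rightarrow> 'v" where
  "diagram_end M (u, []) = pend M u"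
| "diagram_end M (u, (f, v) # c) = diagram_end M (v, c)"

definition diagrams_between :: "('v, 'e, 'f) two_complex \<Rightarrow> 'v \<Rightarrow> 'v \<Rightarrow> ('v, 'e, 'f) diagram set" where
  "diagrams_between M v x = {c. pstart (fst c) = v \<and> diagram_end M c = x}"

definition Sq_between :: "('v, 'e, 'f) two_complex \<Rightarrow> 'f set \<Rightarrow> 'v \<Rightarrow> 'v \<Rightarrow> ('v, 'e, 'f) diagram cubical" where
  "Sq_between M P v x = restrict_cubes (Sq M P) (diagrams_between M v x)"

definition word_point :: "('v, 'e, 'f) two_complex \<Rightarrow> 'v \<Rightarrow> ('e, 'f) letter list \<Rightarrow>
    ('v, 'e, 'f) diagram cube_point" where
  "word_point M v w = ((length (weights w), word_diagram M v w), coords w)"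

text \<open>Weight 0 is the top and weight 1 the bottom of a cell. For thin cells a collapse is exactly
  one of the gluings that define the realization (\<open>gluing_collapse\<close>, \<open>diagram_word_face\<close>).\<close>

definition collapse :: "('v, 'e, 'f) two_complex \<Rightarrow> 'f set \<Rightarrow> ('e, 'f) letter list rel" where
  "collapse M C = {(a @ Cell f (of_bool k) # b, a @ map Edge (snd (cell_side M k f)) @ b) | a f k b. f \<in> C}"

lemma collapse_context:
  assumes "(w, w') \<in> (collapse M C)\<^sup>*"
  shows "(a @ w @ b, a @ w' @ b) \<in> (collapse M C)\<^sup>*"
  using assms
proof induction
  case (step y z)
  then obtain c f k d where "f \<in> C" "y = c @ Cell f (of_bool k) # d"
      "z = c @ map Edge (snd (cell_side M k f)) @ d"
    by (auto simp: collapse_def)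
  then have "f \<in> C" "a @ y @ b = (a @ c) @ Cell f (of_bool k) # (d @ b)"
      "a @ z @ b = (a @ c) @ map Edge (snd (cell_side M k f)) @ (d @ b)"
    by simp_all
  then have "(a @ y @ b, a @ z @ b) \<in> collapse M C"
    unfolding collapse_def by blast
  with step show ?case
    by (meson rtrancl.rtrancl_into_rtrancl)
qed simp

lemma collapse_append:
  assumes "(w1, w1') \<in> (collapse M C)\<^sup>*" "(w2, w2') \<in> (collapse M C)\<^sup>*"
  shows "(w1 @ w2, w1' @ w2') \<in> (collapse M C)\<^sup>*"
  using collapse_context[OF assms(1), of "[]" w2] collapse_context[OF assms(2), of w1' "[]"]
  by auto

lemma collapse_concat_map:
  assumes "\<And>l. l \<in> set w \<Longrightarrow> (g l, h l) \<in> (collapse M C)\<^sup>*"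
  shows "(concat (map g w), concat (map h w)) \<in> (collapse M C)\<^sup>*"
  using assms by (induction w) (auto intro: collapse_append)

lemma diagram_word_cong:
  "(\<And>i. i \<in> {1..length c} \<Longrightarrow> s i = t i) \<Longrightarrow> diagram_word (u, c) s = diagram_word (u, c) t"
proof (induction c arbitrary: u s t)
  case (Cons a c)
  obtain f v where "a = (f, v)"
    by (cases a)
  then show ?case
    using Cons.prems[of 1] Cons.IH[of "\<lambda>i. s (Suc i)" "\<lambda>i. t (Suc i)" v] Cons.prems by auto
qed simp

locale complex2 =
  fixes M :: "('v, 'e, 'f) two_complex"
  assumes complex: "directed_two_complex M"
begin

sublocale wf_digraph "graph M"
  using complex by (simp add: directed_two_complex_def)

lemma pend_awalk: "awalk v es x \<Longrightarrow> pend M (v, es) = x"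
  by (auto simp: pend_def pverts_def)

lemma onepaths_iff: "(v, es) \<in> onepaths M \<longleftrightarrow> awalk v es (pend M (v, es))"
  using pend_awalk by (auto simp: onepaths_def)

lemma cell_awalk:
  assumes "f \<in> cells M"
  shows "awalk (cstart M f) (snd (cell_side M k f)) (cend M f)" "fst (cell_side M k f) = cstart M f"
    "snd (cell_side M k f) \<noteq> []"
proof -
  have "ctop M f \<in> onepaths M" "cbot M f \<in> onepaths M" "fst (ctop M f) = fst (cbot M f)"
      "pend M (ctop M f) = pend M (cbot M f)" "snd (ctop M f) \<noteq> []" "snd (cbot M f) \<noteq> []"
    using complex assms by (auto simp: directed_two_complex_def pstart_def)
  then show "awalk (cstart M f) (snd (cell_side M k f)) (cend M f)" "fst (cell_side M k f) = cstart M f"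
      "snd (cell_side M k f) \<noteq> []"
    by (cases "ctop M f"; cases "cbot M f"; auto simp: onepaths_iff cell_side_def cstart_def cend_def pstart_def)+
qed

lemma cinv_cell:
  assumes "f \<in> cells M"
  shows "cinv M f \<in> cells M" "cinv M (cinv M f) = f" "cell_side M k (cinv M f) = cell_side M (\<not> k) f"
    "cstart M (cinv M f) = cstart M f" "cend M (cinv M f) = cend M f"
  using complex assms by (auto simp: directed_two_complex_def cell_side_def cstart_def cend_def)

lemma valid_word_ends:
  assumes "valid_word M C v w x" "C \<subseteq> cells M"
  shows "v \<in> verts (graph M)" "x \<in> verts (graph M)"
proof -
  have "cstart M f \<in> verts (graph M)" if "f \<in> cells M" for f
    using cell_awalk(1)[OF that] by auto
  then have "v \<in> verts (graph M) \<and> x \<in> verts (graph M)"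
    using assms
  proof (induction w arbitrary: v)
    case (Cons l w)
    then show ?case by (cases l) auto
  qed auto
  then show "v \<in> verts (graph M)" "x \<in> verts (graph M)"
    by auto
qed

lemma valid_word_append:
  assumes "C \<subseteq> cells M"
  shows "valid_word M C v (w @ w') x \<longleftrightarrow> (\<exists>y. valid_word M C v w y \<and> valid_word M C y w' x)"
proof
  assume "valid_word M C v (w @ w') x"
  then show "\<exists>y. valid_word M C v w y \<and> valid_word M C y w' x"
  proof (induction w arbitrary: v)
    case Nil
    then show ?case using valid_word_ends[OF _ assms] by auto
  next
    case (Cons l w)
    then show ?case by (cases l) auto
  qed
next
  assume "\<exists>y. valid_word M C v w y \<and> valid_word M C y w' x"
  then show "valid_word M C v (w @ w') x"
  proof (induction w arbitrary: v)
    case (Cons l w)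
    then show ?case by (cases l) auto
  qed auto
qed

lemma valid_word_edges: "valid_word M C v (map Edge es) x \<longleftrightarrow> awalk v es x"
  by (induction es arbitrary: v) (auto simp: awalk_Nil_iff awalk_Cons_iff)

lemma valid_word_mono: "valid_word M C v w x \<Longrightarrow> C \<subseteq> D \<Longrightarrow> valid_word M D v w x"
  by (induction M C v w x rule: valid_word.induct) auto

lemma pstart_word_diagram [simp]: "pstart (fst (word_diagram M v w)) = v"
  by (cases "(M, v, w)" rule: word_diagram.cases) (auto simp: pstart_def split: prod.splits)

lemma length_word_diagram: "length (snd (word_diagram M v w)) = length (weights w)"
  by (induction M v w rule: word_diagram.induct) (auto split: prod.splits)

lemma diagram_end_Cons:
  assumes "e \<in> arcs (graph M)" "u \<in> onepaths M" "fst u = head (graph M) e"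
  shows "diagram_end M ((tail (graph M) e, e # snd u), c) = diagram_end M (u, c)"
proof (cases c)
  case Nil
  have "awalk (fst u) (snd u) (pend M u)"
    using assms(2) onepaths_iff by (metis prod.collapse)
  then have "awalk (tail (graph M) e) (e # snd u) (pend M u)"
    using assms by (simp add: awalk_Cons_iff)
  then show ?thesis
    using Nil pend_awalk by simp
next
  case (Cons a c')
  then show ?thesis by (cases a) simp
qed

lemma thin_diagram_Cons:
  assumes "e \<in> arcs (graph M)" "thin_diagram M P (u, c)" "fst u = head (graph M) e"
  shows "thin_diagram M P ((tail (graph M) e, e # snd u), c)"
proof -
  have u: "u \<in> onepaths M"
    using thin_diagram_start[OF assms(2)] by simp
  then have "awalk (fst u) (snd u) (pend M u)"
    using onepaths_iff by (metis prod.collapse)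
  then have aw: "awalk (tail (graph M) e) (e # snd u) (pend M u)"
    using assms by (simp add: awalk_Cons_iff)
  then have "(tail (graph M) e, e # snd u) \<in> onepaths M"
      "pend M (tail (graph M) e, e # snd u) = pend M u"
    using pend_awalk onepaths_iff by auto
  then show ?thesis
    using assms(2) by (cases c) auto
qed

lemma word_diagram_thin:
  assumes "valid_word M (cells M - P) v w x"
  shows "thin_diagram M P (word_diagram M v w)" "diagram_end M (word_diagram M v w) = x"
proof -
  have "thin_diagram M P (word_diagram M v w) \<and> diagram_end M (word_diagram M v w) = x"
    using assms
  proof (induction w arbitrary: v)
    case Nil
    then have "awalk v [] v"
      by (auto simp: awalk_Nil_iff)
    then show ?case
      using Nil pend_awalk by (auto simp: onepaths_def)
  next
    case (Cons l w)
    show ?case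
    proof (cases l)
      case (Edge e)
      obtain u c where uc: "word_diagram M (head (graph M) e) w = (u, c)"
        by fastforce
      then have u: "fst u = head (graph M) e"
        using pstart_word_diagram[of "head (graph M) e" w] by (simp add: pstart_def)
      have IH: "thin_diagram M P (u, c)" "diagram_end M (u, c) = x"
        using Cons Edge uc by fastforce+
      then show ?thesis
        using thin_diagram_Cons[OF _ IH(1) u] diagram_end_Cons[OF _ _ u] thin_diagram_start[OF IH(1)]
          Cons.prems Edge uc by auto
    next
      case (Cell f t)
      have "cstart M f = v" and f: "f \<in> cells M - P"
        using Cons.prems Cell by auto
      then have "awalk v [] v"
        using cell_awalk(1)[of f True] by (auto simp: awalk_Nil_iff)
      then have "(v, []) \<in> onepaths M" "pend M (v, []) = v"
        using pend_awalk by (auto simp: onepaths_def)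
      then show ?thesis
        using Cons Cell f \<open>cstart M f = v\<close> by (auto simp: pstart_word_diagram)
    qed
  qed
  then show "thin_diagram M P (word_diagram M v w)" "diagram_end M (word_diagram M v w) = x"
    by auto
qed

lemma diagram_end_face:
  "thin_diagram M P (u, c) \<Longrightarrow> 1 \<le> i \<Longrightarrow> i \<le> length c \<Longrightarrow>
     diagram_end M (diagram_face M i k (u, c)) = diagram_end M (u, c)"
proof (induction c arbitrary: u i)
  case (Cons a c)
  obtain f v where a: "a = (f, v)"
    by (cases a)
  have paths: "u \<in> onepaths M" "v \<in> onepaths M" "f \<in> cells M" "pend M u = cstart M f" "cend M f = pstart v"
      "thin_diagram M P (v, c)"
    using Cons.prems thin_diagram_start a by fastforce+
  show ?case
  proof (cases "i = 1")
    case True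
    have side: "cell_side M k f \<in> onepaths M" "pstart (cell_side M k f) = cstart M f"
        "pend M (cell_side M k f) = cend M f"
      using complex paths(3) by (auto simp: directed_two_complex_def cell_side_def cstart_def cend_def)
    have "pend M (u \<cdot>\<cdot> cell_side M k f \<cdot>\<cdot> v) = pend M v"
      using onepaths_pconcat[OF complex side(1) paths(2)] side paths
        onepaths_pconcat[OF complex paths(1), of "cell_side M k f \<cdot>\<cdot> v"] by simp
    then show ?thesis
      using True a by (cases c) auto
  next
    case False
    then obtain j where j: "i = Suc (Suc j)"
      using Cons.prems by (cases i; cases "i - 1") auto
    then show ?thesis
      using Cons.IH[OF paths(6), of "Suc j"] Cons.prems a by (auto split: prod.splits)
  qed
qed simp

lemma component_closed_diagrams_between:
  "component_closed (Sq M P) (diagrams_between M v x)"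
  unfolding component_closed_def
proof (intro allI ballI)
  fix n c i k assume c: "c \<in> cubes (Sq M P) n" and i: "i \<in> {1..n}"
  then have "diagram_end M (diagram_face M i k c) = diagram_end M c"
    using diagram_end_face[of P "fst c" "snd c" i k] by (simp add: Sq_def)
  moreover have "pstart (fst (diagram_face M i k c)) = pstart (fst c)"
    using pstart_diagram_face[of i M k c] i by auto
  ultimately show "face (Sq M P) i k c \<in> diagrams_between M v x \<longleftrightarrow> c \<in> diagrams_between M v x"
    by (simp add: Sq_def diagrams_between_def)
qed

lemma cubes_Sq_between:
  "c \<in> cubes (Sq_between M P v x) n \<longleftrightarrow>
     thin_diagram M P c \<and> length (snd c) = n \<and> pstart (fst c) = v \<and> diagram_end M c = x"
  by (auto simp: Sq_between_def Sq_def diagrams_between_def)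

lemma face_Sq_between [simp]: "face (Sq_between M P v x) = diagram_face M"
  by (simp add: Sq_between_def Sq_def)

lemma semi_cubical_Sq_between: "semi_cubical (Sq_between M P v x)"
  unfolding Sq_between_def
  by (intro semi_cubical_restrict_cubes semi_cubical_Sq complex component_closed_diagrams_between)

subsection \<open>Words and diagrams\<close>

lemma valid_diagram_word:
  "thin_diagram M P (u, c) \<Longrightarrow> (\<And>i. i \<in> {1..length c} \<Longrightarrow> s i \<in> {0..1}) \<Longrightarrow>
     valid_word M (cells M - P) (pstart u) (diagram_word (u, c) s) (diagram_end M (u, c))"
proof (induction c arbitrary: u s)
  case Nil
  then show ?case
    using onepaths_iff[of "fst u" "snd u"] by (simp add: valid_word_edges pstart_def)
next
  case (Cons a c)
  obtain f v where a: "a = (f, v)"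
    by (cases a)
  have u: "awalk (pstart u) (snd u) (cstart M f)"
    using Cons.prems(1) onepaths_iff[of "fst u" "snd u"] a by (simp add: pstart_def)
  have "valid_word M (cells M - P) (pstart v) (diagram_word (v, c) (\<lambda>i. s (Suc i))) (diagram_end M (v, c))"
    using Cons.IH[of v "\<lambda>i. s (Suc i)"] Cons.prems a by simp
  then have "valid_word M (cells M - P) (cstart M f)
      (Cell f (s 1) # diagram_word (v, c) (\<lambda>i. s (Suc i))) (diagram_end M (v, c))"
    using Cons.prems(1) Cons.prems(2)[of 1] a by auto
  then show ?case
    using u a by (auto simp: valid_word_append valid_word_edges)
qed

lemma word_diagram_edges:
  assumes "awalk v es y"
  shows "word_diagram M v (map Edge es @ w) =
    ((v, es @ snd (fst (word_diagram M y w))), snd (word_diagram M y w))"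
  using assms
proof (induction es arbitrary: v)
  case Nil
  then show ?case
    using pstart_word_diagram[of y w] by (cases "word_diagram M y w") (auto simp: awalk_Nil_iff pstart_def)
qed (auto simp: awalk_Cons_iff)

lemma word_diagram_diagram_word:
  "thin_diagram M P (u, c) \<Longrightarrow> word_diagram M (pstart u) (diagram_word (u, c) s) = (u, c)"
proof (induction c arbitrary: u s)
  case Nil
  then show ?case
    using word_diagram_edges[of "pstart u" "snd u" _ "[]"] onepaths_iff[of "fst u" "snd u"]
    by (simp add: pstart_def)
next
  case (Cons a c)
  obtain f v where a: "a = (f, v)"
    by (cases a)
  have u: "awalk (pstart u) (snd u) (cstart M f)"
    using Cons.prems(1) onepaths_iff[of "fst u" "snd u"] a by (simp add: pstart_def)
  show ?case
    using word_diagram_edges[OF u] Cons.IH[of v] Cons.prems a by (auto simp: pstart_def)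
qed

lemma weights_diagram_word: "weights (diagram_word (u, c) s) = map s [1..<Suc (length c)]"
proof (induction c arbitrary: u s)
  case (Cons a c)
  have "map s [1..<Suc (Suc n)] = s 1 # map (\<lambda>i. s (Suc i)) [1..<Suc n]" for n
    by (simp add: upt_conv_Cons map_Suc_upt[symmetric] del: upt_Suc map_Suc_upt)
  then show ?case
    using Cons by (cases a) simp
qed simp

lemma word_point_diagram_word:
  assumes "thin_diagram M P c" "length (snd c) = n" "s \<in> topspace (unit_cube n)"
  shows "word_point M (pstart (fst c)) (diagram_word c s) = ((n, c), s)"
proof -
  have "coords (diagram_word c s) = s"
  proof
    fix i
    show "coords (diagram_word c s) i = s i"
      using assms weights_diagram_word[of "fst c" "snd c" s]
      by (auto simp: coords_def topspace_unit_cube PiE_iff extensional_def simp del: upt_Suc)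
  qed
  then show ?thesis
    using assms word_diagram_diagram_word[of P "fst c" "snd c" s] weights_diagram_word[of "fst c" "snd c" s]
    by (simp add: word_point_def del: upt_Suc)
qed

lemma diagram_word_word_point:
  "valid_word M C v w x \<Longrightarrow> (\<And>i. i < length (weights w) \<Longrightarrow> s (Suc i) = weights w ! i) \<Longrightarrow>
    diagram_word (word_diagram M v w) s = w"
proof (induction w arbitrary: v s)
  case (Cons l w)
  show ?case
  proof (cases l)
    case (Edge e)
    obtain u c where uc: "word_diagram M (head (graph M) e) w = (u, c)"
      by fastforce
    have "diagram_word (u, c) s = w"
      using Cons Edge uc by fastforce
    then show ?thesis
      using Edge uc by (cases c) auto
  next
    case (Cell f t)
    have "diagram_word (word_diagram M (cend M f) w) (\<lambda>i. s (Suc i)) = w"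
      using Cons.prems Cell by (intro Cons.IH) (auto dest!: meta_spec[of _ "Suc _"])
    then show ?thesis
      using Cons.prems(2)[of 0] Cell by simp
  qed
qed simp

lemma word_diagram_face:
  "valid_word M (cells M) v (a @ Cell f t # b) x \<Longrightarrow>
    diagram_face M (Suc (length (weights a))) k (word_diagram M v (a @ Cell f t # b)) =
    word_diagram M v (a @ map Edge (snd (cell_side M k f)) @ b)"
proof (induction a arbitrary: v)
  case Nil
  then have "awalk v (snd (cell_side M k f)) (cend M f)"
    using cell_awalk(1)[of f k] by simp
  then show ?case
    using word_diagram_edges by (simp add: pconcat_def)
next
  case (Cons l a)
  show ?case
  proof (cases l)
    case (Edge e)
    let ?w = "a @ Cell f t # b" and ?m = "length (weights a)"
    obtain u c where uc: "word_diagram M (head (graph M) e) ?w = (u, c)"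
      by fastforce
    have "c \<noteq> []"
      using length_word_diagram[of "head (graph M) e" ?w] uc by auto
    then obtain g v' c' where c: "c = (g, v') # c'"
      by (metis list.exhaust surj_pair)
    have "diagram_face M (Suc ?m) k (u, c) =
        word_diagram M (head (graph M) e) (a @ map Edge (snd (cell_side M k f)) @ b)"
      using Cons Edge uc by fastforce
    then show ?thesis
      using Edge uc c by (cases ?m) (auto simp: pconcat_def split: prod.splits)
  next
    case (Cell g t')
    have "diagram_face M (Suc (length (weights a))) k (word_diagram M (cend M g) (a @ Cell f t # b)) =
      word_diagram M (cend M g) (a @ map Edge (snd (cell_side M k f)) @ b)"
      using Cons Cell by auto
    then show ?thesis
      using Cell by (auto split: prod.splits)
  qed
qed

lemma gluing_collapse:
  assumes "valid_word M (cells M - P) v (a @ Cell f (of_bool k) # b) x"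
  shows "(word_point M v (a @ Cell f (of_bool k) # b),
          word_point M v (a @ map Edge (snd (cell_side M k f)) @ b)) \<in> gluing (Sq_between M P v x)"
proof -
  let ?w = "a @ Cell f (of_bool k) # b" and ?w' = "a @ map Edge (snd (cell_side M k f)) @ b"
  let ?m = "length (weights a)" and ?n = "length (weights ?w)"
  have "valid_word M (cells M) v ?w x"
    using valid_word_mono[OF assms] by auto
  from word_diagram_face[OF this, of k]
  have face: "word_diagram M v ?w' = diagram_face M (Suc ?m) k (word_diagram M v ?w)"
    by simp
  have "valid_word M (cells M - P) v ?w' x"
    using assms cell_awalk(1)[of f k] by (auto simp: valid_word_append valid_word_edges)
  have weights_bound: "weights w ! i \<in> {0..1}" if "valid_word M C v w x" "i < length (weights w)" for C v w x i
    using that by (induction M C v w x arbitrary: i rule: valid_word.induct) (auto simp: nth_Cons')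
  have "coords ?w' \<in> topspace (unit_cube (?n - 1))"
    using weights_bound[OF \<open>valid_word M (cells M - P) v ?w' x\<close>]
    by (auto simp: coords_def topspace_unit_cube)
  moreover have "coords ?w = face_inclusion ?n (Suc ?m) k (coords ?w')"
    by (rule ext) (auto simp: coords_def face_inclusion_def nth_append nth_Cons')
  moreover have "word_diagram M v ?w \<in> cubes (Sq_between M P v x) ?n"
    using word_diagram_thin[OF assms] length_word_diagram by (simp add: cubes_Sq_between)
  ultimately show ?thesis
    unfolding gluing_def word_point_def using face by fastforce
qed

end

section \<open>Maps defined on words\<close>

text \<open>Families of words of constant shape with continuously varying weights. They define continuous
  maps since they stay in one cube, and they are stable under letterwise substitution.\<close>

inductive cont_word :: "'z topology \<Rightarrow> ('z \<Rightarrow> ('e, 'f) letter list) \<Rightarrow> bool" for Z where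
  cont_word_Nil: "cont_word Z (\<lambda>z. [])"
| cont_word_Edge: "cont_word Z W \<Longrightarrow> cont_word Z (\<lambda>z. Edge e # W z)"
| cont_word_Cell: "cont_word Z W \<Longrightarrow> continuous_map Z (top_of_set {0..1}) a \<Longrightarrow>
    cont_word Z (\<lambda>z. Cell f (a z) # W z)"

lemma cont_word_append: "cont_word Z W \<Longrightarrow> cont_word Z W' \<Longrightarrow> cont_word Z (\<lambda>z. W z @ W' z)"
  by (induction rule: cont_word.induct) (auto intro: cont_word.intros)

lemma cont_word_edges: "cont_word Z (\<lambda>z. map Edge es)"
  by (induction es) (auto intro: cont_word.intros)

lemma cont_word_concat_map:
  assumes "cont_word Z W" and "\<And>e. cont_word Z (\<lambda>z. g z (Edge e))"
    and "\<And>f a. continuous_map Z (top_of_set {0..1}) a \<Longrightarrow> cont_word Z (\<lambda>z. g z (Cell f (a z)))"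
  shows "cont_word Z (\<lambda>z. concat (map (g z) (W z)))"
  using assms(1) by induction (auto intro: cont_word.intros cont_word_append assms)

lemma cont_word_diagram_word:
  "(\<And>i. i \<in> {1..length c} \<Longrightarrow> continuous_map Z (top_of_set {0..1}) (\<lambda>z. S z i)) \<Longrightarrow>
     cont_word Z (\<lambda>z. diagram_word (u, c) (S z))"
proof (induction c arbitrary: u S)
  case (Cons a c)
  obtain f v where "a = (f, v)"
    by (cases a)
  then show ?case
    using Cons.IH[of "\<lambda>z i. S z (Suc i)" v] Cons.prems
    by (auto intro!: cont_word_append cont_word_edges cont_word_Cell)
qed (simp add: cont_word_edges)

lemma cont_word_shape:
  assumes "cont_word Z W"
  obtains c n where "\<And>v z. word_diagram M v (W z) = c v" "\<And>z. length (weights (W z)) = n"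
    "\<And>i. i < n \<Longrightarrow> continuous_map Z (top_of_set {0..1}) (\<lambda>z. weights (W z) ! i)"
proof -
  have "\<exists>c n. (\<forall>v z. word_diagram M v (W z) = c v) \<and> (\<forall>z. length (weights (W z)) = n) \<and>
      (\<forall>i<n. continuous_map Z (top_of_set {0..1}) (\<lambda>z. weights (W z) ! i))"
    using assms
  proof induction
    case cont_word_Nil
    then show ?case by auto
  next
    case (cont_word_Edge W e)
    then obtain c n where "\<forall>v z. word_diagram M v (W z) = c v" "\<forall>z. length (weights (W z)) = n"
      "\<forall>i<n. continuous_map Z (top_of_set {0..1}) (\<lambda>z. weights (W z) ! i)" by blast
    then show ?case
      by (intro exI[of _ "\<lambda>v. word_diagram M v (Edge e # W undefined)"] exI[of _ n]) simp
  next
    case (cont_word_Cell W a f)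
    then obtain c n where cn: "\<forall>v z. word_diagram M v (W z) = c v" "\<forall>z. length (weights (W z)) = n"
      "\<forall>i<n. continuous_map Z (top_of_set {0..1}) (\<lambda>z. weights (W z) ! i)" by blast
    have "continuous_map Z (top_of_set {0..1}) (\<lambda>z. weights (Cell f (a z) # W z) ! i)" if "i < Suc n" for i
      using that cn cont_word_Cell.hyps by (cases i) auto
    with cn show ?case
      by (intro exI[of _ "\<lambda>v. word_diagram M v (Cell f undefined # W undefined)"] exI[of _ "Suc n"]) simp
  qed
  then show ?thesis
    using that by auto
qed

definition word_class :: "('v, 'e, 'f) two_complex \<Rightarrow> 'f set \<Rightarrow> 'v \<Rightarrow> 'v \<Rightarrow> ('e, 'f) letter list \<Rightarrow>
    ('v, 'e, 'f) diagram cube_point set" where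
  "word_class M P v x w = glue_class (Sq_between M P v x) (word_point M v w)"

definition on_words :: "(('e, 'f) letter list \<Rightarrow> 'b) \<Rightarrow> ('v, 'e, 'f) diagram cube_point \<Rightarrow> 'b" where
  "on_words F = (\<lambda>((n, c), s). F (diagram_word c s))"

lemma diagram_word_face:
  "1 \<le> i \<Longrightarrow> i \<le> length c \<Longrightarrow> (\<And>j. 1 \<le> j \<Longrightarrow> j < i \<Longrightarrow> t j = s j) \<Longrightarrow> t i = of_bool k \<Longrightarrow>
   (\<And>j. i \<le> j \<Longrightarrow> j < length c \<Longrightarrow> t (Suc j) = s j) \<Longrightarrow>
   \<exists>a f b. diagram_word (u, c) t = a @ Cell f (of_bool k) # b \<and>
     diagram_word (diagram_face M i k (u, c)) s = a @ map Edge (snd (cell_side M k f)) @ b"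
proof (induction c arbitrary: u i s t)
  case (Cons d c)
  obtain f v where d: "d = (f, v)"
    by (cases d)
  show ?case
  proof (cases "i = 1")
    case True
    have "diagram_word (v, c) (\<lambda>i. t (Suc i)) = diagram_word (v, c) s"
      by (rule diagram_word_cong) (use Cons.prems(5) True in auto)
    moreover have "diagram_word ((u \<cdot>\<cdot> q \<cdot>\<cdot> v), c) s = map Edge (snd u) @ map Edge (snd q) @ diagram_word (v, c) s" for q
      by (cases c) (auto simp: pconcat_def)
    ultimately show ?thesis
      using True d Cons.prems(4) by auto
  next
    case False
    then obtain i' where i: "i = Suc (Suc i')"
      using Cons.prems(1) by (cases i; cases "i - 1") auto
    obtain v' c' where face: "diagram_face M (Suc i') k (v, c) = (v', c')"
      by fastforce
    have "\<exists>a f b. diagram_word (v, c) (\<lambda>i. t (Suc i)) = a @ Cell f (of_bool k) # b \<and>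
        diagram_word (diagram_face M (Suc i') k (v, c)) (\<lambda>i. s (Suc i)) =
          a @ map Edge (snd (cell_side M k f)) @ b"
      using Cons.prems i by (intro Cons.IH) auto
    then obtain a g b where "diagram_word (v, c) (\<lambda>i. t (Suc i)) = a @ Cell g (of_bool k) # b"
        "diagram_word (v', c') (\<lambda>i. s (Suc i)) = a @ map Edge (snd (cell_side M k g)) @ b"
      using face by auto
    moreover have "t 1 = s 1"
      using Cons.prems(3)[of 1] i by simp
    ultimately show ?thesis
      using d i face by (intro exI[of _ "map Edge (snd u) @ Cell f (s 1) # a"] exI[of _ g] exI[of _ b]) simp
  qed
qed simp

lemma collapseI:
  "f \<in> C \<Longrightarrow> (a @ Cell f (of_bool k) # b, a @ map Edge (snd (cell_side M k f)) @ b) \<in> collapse M C"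
  unfolding collapse_def by blast

context complex2
begin

lemma valid_collapse:
  assumes "(w, w') \<in> collapse M C" "C \<subseteq> cells M" "valid_word M C v w x"
  shows "valid_word M C v w' x"
proof -
  obtain a f k b where w: "w = a @ Cell f (of_bool k) # b" "w' = a @ map Edge (snd (cell_side M k f)) @ b"
      "f \<in> C"
    using assms(1) by (auto simp: collapse_def)
  show ?thesis
    using assms(2,3) cell_awalk(1)[of f k] w by (auto simp: valid_word_append valid_word_edges)
qed

lemma word_class_collapse:
  assumes "(w, w') \<in> (collapse M (cells M - P))\<^sup>*" "valid_word M (cells M - P) v w x"
  shows "valid_word M (cells M - P) v w' x" "word_class M P v x w = word_class M P v x w'"
proof -
  have "valid_word M (cells M - P) v w' x \<and> word_class M P v x w = word_class M P v x w'"
    using assms(1)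
  proof induction
    case base
    then show ?case using assms(2) by simp
  next
    case (step y z)
    then obtain a f k b where yz: "y = a @ Cell f (of_bool k) # b"
        "z = a @ map Edge (snd (cell_side M k f)) @ b"
      by (auto simp: collapse_def)
    have "glue_class (Sq_between M P v x) (word_point M v y) = glue_class (Sq_between M P v x) (word_point M v z)"
      unfolding glue_class_eq_iff using gluing_collapse[of P v a f k b x] step yz by auto
    then show ?case
      using step valid_collapse[OF step(2)] by (auto simp: word_class_def)
  qed
  then show "valid_word M (cells M - P) v w' x" "word_class M P v x w = word_class M P v x w'"
    by auto
qed

text \<open>Restricting a diagram to a face replaces one cell of weight 0 or 1 by its top or bottom.\<close>

lemma respects_gluing_on_words:
  assumes "\<And>a f k b. valid_word M (cells M - P) v (a @ Cell f (of_bool k) # b) x \<Longrightarrow>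
    F (a @ Cell f (of_bool k) # b) = F (a @ map Edge (snd (cell_side M k f)) @ b)"
  shows "respects_gluing (Sq_between M P v x) (on_words F)"
  unfolding respects_gluing_def
proof (intro allI ballI)
  fix n c i k s
  assume c: "c \<in> cubes (Sq_between M P v x) n" and i: "i \<in> {1..n}"
    and s: "s \<in> topspace (unit_cube (n - 1))"
  let ?t = "face_inclusion n i k s"
  have "?t j \<in> {0..1}" if "j \<in> {1..n}" for j
    using face_inclusion_in_unit_cube[OF s i] that by (auto simp: topspace_unit_cube PiE_iff)
  then have valid: "valid_word M (cells M - P) v (diagram_word c ?t) x"
    using valid_diagram_word[of P "fst c" "snd c" ?t] c by (simp add: cubes_Sq_between)
  have "\<exists>a f b. diagram_word (fst c, snd c) ?t = a @ Cell f (of_bool k) # b \<and>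
     diagram_word (diagram_face M i k (fst c, snd c)) s = a @ map Edge (snd (cell_side M k f)) @ b"
    using c i by (intro diagram_word_face) (auto simp: cubes_Sq_between face_inclusion_def)
  then show "on_words F ((n, c), ?t) = on_words F ((n - 1, face (Sq_between M P v x) i k c), s)"
    using assms valid by (auto simp: on_words_def)
qed

lemma glue_lift_on_words:
  assumes "respects_gluing (Sq_between M P v x) (on_words F)" "valid_word M C v w x"
  shows "glue_lift (on_words F) (word_class M P v x w) = F w"
proof -
  have "diagram_word (word_diagram M v w) (coords w) = w"
    by (rule diagram_word_word_point[OF assms(2)]) (auto simp: coords_def)
  then show ?thesis
    unfolding word_class_def glue_lift[OF assms(1)] by (simp add: on_words_def word_point_def)
qed

lemma realization_wordE:
  assumes "C \<in> topspace (realization (Sq_between M P v x))"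
  obtains w where "valid_word M (cells M - P) v w x" "C = word_class M P v x w"
proof -
  obtain a where a: "C = glue_class (Sq_between M P v x) a" "a \<in> topspace (cube_sum (Sq_between M P v x))"
    using assms unfolding topspace_realization by blast
  then obtain n c s where c: "a = ((n, c), s)" "c \<in> cubes (Sq_between M P v x) n" "s \<in> topspace (unit_cube n)"
    by (cases a) auto
  show ?thesis
  proof (rule that)
    show "valid_word M (cells M - P) v (diagram_word c s) x"
      using valid_diagram_word[of P "fst c" "snd c" s] c
      by (auto simp: cubes_Sq_between topspace_unit_cube PiE_iff)
    show "C = word_class M P v x (diagram_word c s)"
      using word_point_diagram_word[of P c n s] c a by (simp add: cubes_Sq_between word_class_def)
  qed
qed

lemma continuous_map_word_class:
  assumes W: "cont_word Z W" and valid: "\<And>z. z \<in> topspace Z \<Longrightarrow> valid_word M (cells M - P) v (W z) x"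
  shows "continuous_map Z (realization (Sq_between M P v x)) (\<lambda>z. word_class M P v x (W z))"
proof (cases "topspace Z = {}")
  case True
  then show ?thesis by (simp add: continuous_map)
next
  case False
  then obtain z0 where z0: "z0 \<in> topspace Z"
    by blast
  obtain c n where cn: "\<And>v z. word_diagram M v (W z) = c v" "\<And>z. length (weights (W z)) = n"
    "\<And>i. i < n \<Longrightarrow> continuous_map Z (top_of_set {0..1}) (\<lambda>z. weights (W z) ! i)"
    using cont_word_shape[OF W, of M] by metis
  have "c v \<in> cubes (Sq_between M P v x) n"
    using word_diagram_thin[OF valid[OF z0]] pstart_word_diagram[of v "W z0"]
      length_word_diagram[of v "W z0"] cn by (simp add: cubes_Sq_between)
  from continuous_map_glue_class[OF this]
  have "continuous_map (unit_cube n) (realization (Sq_between M P v x))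
      (\<lambda>s. glue_class (Sq_between M P v x) ((n, c v), s))" .
  moreover have "continuous_map Z (unit_cube n) (\<lambda>z. coords (W z))"
    unfolding continuous_map_into_unit_cube using cn by (auto simp: coords_def)
  ultimately have "continuous_map Z (realization (Sq_between M P v x))
      ((\<lambda>s. glue_class (Sq_between M P v x) ((n, c v), s)) \<circ> (\<lambda>z. coords (W z)))"
    by (rule continuous_map_compose[rotated])
  then show ?thesis
    by (simp add: o_def word_class_def word_point_def cn)
qed

lemma cont_word_cube:
  assumes "c \<in> cubes (Sq_between M P v x) n"
  shows "cont_word (unit_cube n) (diagram_word c)"
    and "s \<in> topspace (unit_cube n) \<Longrightarrow> valid_word M (cells M - P) v (diagram_word c s) x"
proof -
  have "continuous_map (unit_cube n) (unit_cube n) (\<lambda>z. z)"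
    by simp
  then have "cont_word (unit_cube n) (diagram_word (fst c, snd c))"
    using assms unfolding continuous_map_into_unit_cube
    by (intro cont_word_diagram_word) (auto simp: cubes_Sq_between)
  then show "cont_word (unit_cube n) (diagram_word c)"
    by simp
  show "s \<in> topspace (unit_cube n) \<Longrightarrow> valid_word M (cells M - P) v (diagram_word c s) x"
    using valid_diagram_word[of P "fst c" "snd c" s] assms
    by (auto simp: cubes_Sq_between topspace_unit_cube PiE_iff)
qed

end

section \<open>Independence of the orientation\<close>

fun flip_letter :: "('v, 'e, 'f) two_complex \<Rightarrow> 'f set \<Rightarrow> ('e, 'f) letter \<Rightarrow> ('e, 'f) letter" where
  "flip_letter M P (Edge e) = Edge e"
| "flip_letter M P (Cell f t) = (if f \<in> P then Cell (cinv M f) (1 - t) else Cell f t)"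

lemma cont_word_flip:
  assumes "cont_word Z W"
  shows "cont_word Z (\<lambda>z. map (flip_letter M P) (W z))"
proof -
  have "cont_word Z (\<lambda>z. concat (map (\<lambda>l. [flip_letter M P l]) (W z)))"
  proof (rule cont_word_concat_map[OF assms])
    fix f :: 'c and a :: "'a \<Rightarrow> real" assume a: "continuous_map Z (top_of_set {0..1}) a"
    then have "continuous_map Z (top_of_set {0..1}) (\<lambda>z. 1 - a z)"
      by (auto simp: continuous_map_in_subtopology image_subset_iff intro!: continuous_intros)
    with a show "cont_word Z (\<lambda>z. [flip_letter M P (Cell f (a z))])"
      by (cases "f \<in> P") (auto intro: cont_word.intros)
  qed (auto intro: cont_word.intros)
  then show ?thesis
    by (simp add: concat_map_singleton)
qed

context complex2
begin

lemma orientation_cinv: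
  assumes "orientation M P" "f \<in> cells M"
  shows "cinv M f \<in> P \<longleftrightarrow> f \<notin> P"
proof -
  have P: "cinv M ` P = cells M - P" "P \<subseteq> cells M"
    using assms by (auto simp: orientation_def)
  have "f \<in> P" if "cinv M f \<notin> P"
  proof -
    have "cinv M f \<in> cinv M ` P"
      using P that cinv_cell(1)[OF assms(2)] by blast
    then obtain g where "g \<in> P" "cinv M f = cinv M g"
      by blast
    then show ?thesis
      using P(2) cinv_cell(2)[of f] cinv_cell(2)[of g] assms(2) by auto
  qed
  moreover have "cinv M f \<notin> P" if "f \<in> P"
    using P that by blast
  ultimately show ?thesis
    by blast
qed

lemma valid_flip:
  assumes "orientation M P"
  shows "valid_word M (cells M) v w x \<Longrightarrow> valid_word M (cells M - P) v (map (flip_letter M P) w) x"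
proof (induction w arbitrary: v)
  case (Cons l w)
  then show ?case
    using orientation_cinv[OF assms] cinv_cell by (cases l) auto
qed simp

lemma flip_flip:
  assumes P: "orientation M P"
  shows "valid_word M (cells M - P) v w x \<Longrightarrow> map (flip_letter M P) (map (flip_letter M P') w) = w"
proof (induction w arbitrary: v)
  case (Cons l w)
  then show ?case
    using orientation_cinv[OF P] cinv_cell(2) by (cases l) auto
qed simp

text \<open>A cell of weight \<open>k\<close> and its inverse of weight \<open>1 - k\<close> collapse to the same path.\<close>

lemma flip_respects:
  assumes "orientation M P'"
  shows "respects_gluing (Sq_between M P v x)
    (on_words (\<lambda>w. word_class M P' v x (map (flip_letter M P') w)))"
proof (rule respects_gluing_on_words)
  fix a f k b assume valid: "valid_word M (cells M - P) v (a @ Cell f (of_bool k) # b) x"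
  let ?g = "map (flip_letter M P')"
  have f: "f \<in> cells M"
    using valid by (auto simp: valid_word_append)
  obtain g l where g: "flip_letter M P' (Cell f (of_bool k)) = Cell g (of_bool l)"
      "cell_side M l g = cell_side M k f" "g \<in> cells M - P'"
  proof (cases "f \<in> P'")
    case True
    show ?thesis
    proof (rule that)
      show "flip_letter M P' (Cell f (of_bool k)) = Cell (cinv M f) (of_bool (\<not> k))"
        using True by (cases k) auto
    qed (use True f cinv_cell[OF f] orientation_cinv[OF assms f] in auto)
  next
    case False
    then show ?thesis
      using that[of f k] f by auto
  qed
  have "?g (map Edge es) = map Edge es" for es :: "'e list"
    by simp
  then have "(?g (a @ Cell f (of_bool k) # b), ?g (a @ map Edge (snd (cell_side M k f)) @ b))
      \<in> collapse M (cells M - P')"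
    using collapseI[OF g(3), of "?g a" l "?g b" M] g(1,2) by (simp del: map_map flip_letter.simps)
  moreover have "valid_word M (cells M - P') v (?g (a @ Cell f (of_bool k) # b)) x"
    using valid_flip[OF assms] valid_word_mono[OF valid] by blast
  ultimately show "word_class M P' v x (?g (a @ Cell f (of_bool k) # b)) =
      word_class M P' v x (?g (a @ map Edge (snd (cell_side M k f)) @ b))"
    using word_class_collapse(2)[OF r_into_rtrancl] by blast
qed

text \<open>Inverting the cells on which the orientations differ, with weights \<open>t\<close> replaced by \<open>1 - t\<close>,
  maps words for one orientation to words for the other, and back.\<close>

theorem realization_Sq_between_orientation:
  assumes P: "orientation M P" and P': "orientation M P'"
  shows "realization (Sq_between M P v x) homeomorphic_space realization (Sq_between M P' v x)"
proof -
  let ?F = "\<lambda>P. glue_lift (on_words (\<lambda>w. word_class M P v x (map (flip_letter M P) w)))"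
  have cont: "continuous_map (realization (Sq_between M P v x)) (realization (Sq_between M P' v x)) (?F P')"
    if "orientation M P" "orientation M P'" for P P'
  proof (rule continuous_map_glue_lift[OF flip_respects[OF that(2)]])
    fix n c assume c: "c \<in> cubes (Sq_between M P v x) n"
    show "continuous_map (unit_cube n) (realization (Sq_between M P' v x))
        (\<lambda>s. on_words (\<lambda>w. word_class M P' v x (map (flip_letter M P') w)) ((n, c), s))"
      unfolding on_words_def prod.case
      by (intro continuous_map_word_class cont_word_flip cont_word_cube(1)[OF c] valid_flip that
          valid_word_mono[OF cont_word_cube(2)[OF c]]) auto
  qed
  have inv: "?F P (?F P' C) = C"
    if "orientation M P" "orientation M P'" and C: "C \<in> topspace (realization (Sq_between M P v x))" for P P' C
  proof -
    obtain w where w: "valid_word M (cells M - P) v w x" "C = word_class M P v x w"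
      using C by (rule realization_wordE)
    have w': "valid_word M (cells M - P') v (map (flip_letter M P') w) x"
      using valid_flip[OF that(2)] valid_word_mono[OF w(1)] by blast
    have "?F P' C = word_class M P' v x (map (flip_letter M P') w)"
      using glue_lift_on_words[OF flip_respects[OF that(2)] w(1)] w(2) by simp
    then have "?F P (?F P' C) = word_class M P v x (map (flip_letter M P) (map (flip_letter M P') w))"
      using glue_lift_on_words[OF flip_respects[OF that(1)] w'] by simp
    then show ?thesis
      using flip_flip[OF that(1) w(1)] w(2) by simp
  qed
  show ?thesis
    unfolding homeomorphic_space_def homeomorphic_maps_def
    using cont[OF P P'] cont[OF P' P] inv[OF P P'] inv[OF P' P] by blast
qed

end

section \<open>Rooted 2-trees\<close>

context complex2
begin

lemma simple_arc_edge:
  assumes "awalk u es v" "distinct (awalk_verts u es)" "e \<in> set es"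
  shows "head (graph M) e \<noteq> u" "tail (graph M) e = u \<longleftrightarrow> e = hd es" "tail (graph M) e \<noteq> v"
proof -
  obtain e1 es' where es: "es = e1 # es'"
    using assms(3) by (cases es) auto
  have e1: "tail (graph M) e1 = u" "awalk (head (graph M) e1) es' v"
      "u \<notin> set (awalk_verts (head (graph M) e1) es')"
    using assms(1,2) es by (auto simp: awalk_Cons_iff)
  have tl: "tail (graph M) e' \<noteq> u" "head (graph M) e' \<noteq> u" if "e' \<in> set es'" for e'
    using awalk_verts_arc1[OF that] awalk_verts_arc2[OF e1(2) that] e1(3) by auto
  have "head (graph M) e1 \<in> set (awalk_verts (head (graph M) e1) es')"
    using hd_in_awalk_verts(1)[OF e1(2)] by simp
  then show "head (graph M) e \<noteq> u"
    using tl assms(3) es e1(3) by auto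
  show "tail (graph M) e = u \<longleftrightarrow> e = hd es"
    using tl assms(3) es e1(1) by auto
  show "tail (graph M) e \<noteq> v"
    using assms
  proof (induction es arbitrary: u)
    case (Cons a es)
    have aw: "awalk (head (graph M) a) es v" "tail (graph M) a = u"
      using Cons.prems by (auto simp: awalk_Cons_iff)
    have "v \<in> set (awalk_verts (head (graph M) a) es)"
      using last_in_set[OF awalk_verts_non_Nil, of "head (graph M) a" es] aw(1) by simp
    then show ?case
      using Cons aw by (cases "e = a") auto
  qed simp
qed

fun letter_source :: "('e, 'f) letter \<Rightarrow> 'v" where
  "letter_source (Edge e) = tail (graph M) e"
| "letter_source (Cell f t) = cstart M f"

text \<open>A word has no choice as long as it is at a vertex of the arc other than the last one, since
  there the edges of the arc are the only letters available.\<close>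

lemma forced_arc:
  assumes "awalk v es y" "distinct (awalk_verts v es)" "valid_word M C v w x"
    and "x \<notin> set (butlast (awalk_verts v es))"
    and "\<And>l. l \<in> set w \<Longrightarrow> letter_source l \<in> set (butlast (awalk_verts v es)) \<Longrightarrow> l \<in> Edge ` set es"
  shows "\<exists>w'. w = map Edge es @ w' \<and> valid_word M C y w' x"
  using assms
proof (induction es arbitrary: v w)
  case Nil
  then show ?case by (auto simp: awalk_Nil_iff)
next
  case (Cons e es)
  have aw: "awalk (head (graph M) e) es y" "tail (graph M) e = v"
    using Cons.prems(1) by (auto simp: awalk_Cons_iff)
  have bl: "butlast (awalk_verts v (e # es)) = v # butlast (awalk_verts (head (graph M) e) es)"
    using aw by simp
  then have "v \<noteq> x"
    using Cons.prems(4) by auto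
  then obtain l w1 where w: "w = l # w1"
    using Cons.prems(3) by (cases w) auto
  have src: "letter_source l = v"
    using Cons.prems(3) w by (cases l) auto
  then obtain e' where e': "l = Edge e'" "e' \<in> set (e # es)"
    using Cons.prems(5)[of l] w bl by auto
  then have l: "l = Edge e"
    using simple_arc_edge(2)[OF Cons.prems(1,2) e'(2)] src by simp
  have "l' \<in> Edge ` set es"
    if l': "l' \<in> set w1" "letter_source l' \<in> set (butlast (awalk_verts (head (graph M) e) es))" for l'
  proof -
    have "l' \<in> Edge ` set (e # es)"
      using Cons.prems(5)[of l'] l' w bl by auto
    moreover have "l' \<noteq> Edge e"
      using l'(2) aw(2) Cons.prems(2) in_set_butlastD by fastforce
    ultimately show ?thesis
      by auto
  qed
  moreover have "valid_word M C (head (graph M) e) w1 x"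
    using Cons.prems(3) w l by simp
  ultimately have "\<exists>w'. w1 = map Edge es @ w' \<and> valid_word M C y w' x"
    using Cons.prems bl aw by (intro Cons.IH) auto
  then show ?case
    using w l by auto
qed

end

text \<open>Here \<open>S n\<close> consists of the positive cells attached in the step from stage \<open>n\<close> to stage \<open>n + 1\<close>.
  Every cell belongs to one of the sets \<open>S n\<close> or is inverse to such a cell, but not both.\<close>

locale two_tree = complex2 M for M :: "('v, 'e, 'f) two_complex" +
  fixes trunk :: "('v, 'e) onepath" and V :: "nat \<Rightarrow> 'v set" and E :: "nat \<Rightarrow> 'e set" and S :: "nat \<Rightarrow> 'f set"
  assumes trunk: "trunk \<in> onepaths M" "distinct (pverts M trunk)"
    and V0: "V 0 = set (pverts M trunk)" and E0: "E 0 = set (snd trunk)"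
    and S_cells: "S n \<subseteq> cells M"
    and V_Suc: "V (Suc n) = V n \<union> (\<Union>f\<in>S n. set (pverts M (cbot M f)))"
    and E_Suc: "E (Suc n) = E n \<union> (\<Union>f\<in>S n. set (snd (cbot M f)))"
    and top_old: "f \<in> S n \<Longrightarrow> set (pverts M (ctop M f)) \<subseteq> V n" "f \<in> S n \<Longrightarrow> set (snd (ctop M f)) \<subseteq> E n"
    and bot_simple: "f \<in> S n \<Longrightarrow> distinct (pverts M (cbot M f))"
    and bot_new: "f \<in> S n \<Longrightarrow> set (pverts M (cbot M f)) \<inter> V n = {cstart M f, cend M f}"
      "f \<in> S n \<Longrightarrow> set (snd (cbot M f)) \<inter> E n = {}"
    and bot_apart: "f \<in> S n \<Longrightarrow> g \<in> S n \<Longrightarrow> f \<noteq> g \<Longrightarrow>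
      set (pverts M (cbot M f)) \<inter> set (pverts M (cbot M g)) \<subseteq> {cstart M f, cend M f} \<inter> {cstart M g, cend M g}"
      "f \<in> S n \<Longrightarrow> g \<in> S n \<Longrightarrow> f \<noteq> g \<Longrightarrow> set (snd (cbot M f)) \<inter> set (snd (cbot M g)) = {}"
    and arcs_levels: "arcs (graph M) = (\<Union>n. E n)"
    and S_disjoint: "m \<noteq> n \<Longrightarrow> S m \<inter> S n = {}"
    and S_oriented: "cinv M ` (\<Union>n. S n) = cells M - (\<Union>n. S n)"

lemma rooted_two_tree_levels:
  assumes "rooted_two_tree M trunk"
  obtains V E S where "two_tree M trunk V E S"
proof -
  obtain V E F where *: "directed_two_complex M" "trunk \<in> onepaths M" "distinct (pverts M trunk)"
      "V 0 = set (pverts M trunk)" "E 0 = set (snd trunk)" "F 0 = {}"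
      "\<And>n. growth_step M (V n, E n, F n) (V (Suc n), E (Suc n), F (Suc n))"
      "arcs (graph M) = (\<Union>n. E n)" "cells M = (\<Union>n::nat. F n)"
    using assms unfolding rooted_two_tree_def by auto
  interpret complex2 M
    by unfold_locales (rule *(1))
  define new_cells where "new_cells = (\<lambda>n S. S \<subseteq> cells M \<and>
       S \<inter> F n = {} \<and> cinv M ` S \<inter> F n = {} \<and> S \<inter> cinv M ` S = {} \<and>
       V (Suc n) = V n \<union> (\<Union>f\<in>S. set (pverts M (cbot M f))) \<and>
       E (Suc n) = E n \<union> (\<Union>f\<in>S. set (snd (cbot M f))) \<and>
       F (Suc n) = F n \<union> S \<union> cinv M ` S \<and>
       (\<forall>f\<in>S. set (pverts M (ctop M f)) \<subseteq> V n \<and> set (snd (ctop M f)) \<subseteq> E n \<and>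
          distinct (pverts M (cbot M f)) \<and>
          set (pverts M (cbot M f)) \<inter> V n = {cstart M f, cend M f} \<and>
          set (snd (cbot M f)) \<inter> E n = {}) \<and>
       (\<forall>f\<in>S. \<forall>g\<in>S. f \<noteq> g \<longrightarrow>
          set (pverts M (cbot M f)) \<inter> set (pverts M (cbot M g))
            \<subseteq> {cstart M f, cend M f} \<inter> {cstart M g, cend M g} \<and>
          set (snd (cbot M f)) \<inter> set (snd (cbot M g)) = {}))"
  have "\<exists>S. new_cells n S" for n
    using *(7)[of n, unfolded growth_step_def prod.case] unfolding new_cells_def .
  then obtain S where S': "\<And>n. new_cells n (S n)"
    by metis
  have S_cells: "S n \<subseteq> cells M" and S_new: "S n \<inter> F n = {}" "cinv M ` S n \<inter> F n = {}"
    and S_inv: "S n \<inter> cinv M ` S n = {}"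
    and V_Suc: "V (Suc n) = V n \<union> (\<Union>f\<in>S n. set (pverts M (cbot M f)))"
    and E_Suc: "E (Suc n) = E n \<union> (\<Union>f\<in>S n. set (snd (cbot M f)))"
    and F_Suc: "F (Suc n) = F n \<union> S n \<union> cinv M ` S n" for n
    using S'[of n] unfolding new_cells_def by simp_all
  have S_each: "\<forall>f\<in>S n. set (pverts M (ctop M f)) \<subseteq> V n \<and> set (snd (ctop M f)) \<subseteq> E n \<and>
          distinct (pverts M (cbot M f)) \<and>
          set (pverts M (cbot M f)) \<inter> V n = {cstart M f, cend M f} \<and>
          set (snd (cbot M f)) \<inter> E n = {}" for n
    using S'[of n] unfolding new_cells_def by simp
  have S_pair: "\<forall>f\<in>S n. \<forall>g\<in>S n. f \<noteq> g \<longrightarrow>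
          set (pverts M (cbot M f)) \<inter> set (pverts M (cbot M g))
            \<subseteq> {cstart M f, cend M f} \<inter> {cstart M g, cend M g} \<and>
          set (snd (cbot M f)) \<inter> set (snd (cbot M g)) = {}" for n
    using S'[of n] unfolding new_cells_def by simp
  have F_mono: "F m \<subseteq> F n" if "m \<le> n" for m n
    using lift_Suc_mono_le[of F] F_Suc that by blast
  have SF: "S m \<subseteq> F n \<and> cinv M ` S m \<subseteq> F n" if "m < n" for m n
    using F_Suc[of m] F_mono[of "Suc m" n] that by (simp add: Suc_leI)
  have disj: "S m \<inter> S n = {}" if "m < n" for m n
    using SF[OF that] S_new[of n] by blast
  have not_inv: "cinv M f \<notin> S n" if f: "f \<in> S m" for f m n
  proof
    assume n: "cinv M f \<in> S n"
    consider "m < n" | "m = n" | "n < m"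
      by linarith
    then show False
    proof cases
      case 1
      then show ?thesis
        using SF[OF 1] S_new[of n] n f by blast
    next
      case 2
      then show ?thesis
        using S_inv[of n] n f by blast
    next
      case 3
      have "f = cinv M (cinv M f)"
        using cinv_cell(2) f S_cells by (metis subsetD)
      then have "f \<in> F m"
        using SF[OF 3] n by (metis image_eqI subsetD)
      then show ?thesis
        using S_new[of m] f by blast
    qed
  qed
  have F_S: "F n \<subseteq> (\<Union>n. S n) \<union> cinv M ` (\<Union>n. S n)" for n
  proof (induction n)
    case (Suc n)
    have "cinv M ` S n \<subseteq> cinv M ` (\<Union>n. S n)"
      by blast
    with Suc show ?case
      unfolding F_Suc by blast
  qed (simp add: *(6))
  have "two_tree M trunk V E S"
  proof unfold_locales
    show "S m \<inter> S n = {}" if "m \<noteq> n" for m n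
      using disj[of m n] disj[of n m] that by (cases m n rule: linorder_cases) auto
    show "cinv M ` (\<Union>n. S n) = cells M - (\<Union>n. S n)"
    proof
      show "cinv M ` (\<Union>n. S n) \<subseteq> cells M - (\<Union>n. S n)"
      proof
        fix y assume "y \<in> cinv M ` (\<Union>n. S n)"
        then obtain f n where "f \<in> S n" "y = cinv M f"
          by blast
        then show "y \<in> cells M - (\<Union>n. S n)"
          using not_inv[of f n] S_cells[of n] cinv_cell(1)[of f] by auto
      qed
      show "cells M - (\<Union>n. S n) \<subseteq> cinv M ` (\<Union>n. S n)"
      proof
        fix y assume y: "y \<in> cells M - (\<Union>n. S n)"
        then obtain n where "y \<in> F n"
          using *(9) by auto
        then show "y \<in> cinv M ` (\<Union>n. S n)"
          using F_S[of n] y by auto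
      qed
    qed
    show "trunk \<in> onepaths M" "distinct (pverts M trunk)" "V 0 = set (pverts M trunk)" "E 0 = set (snd trunk)"
        "arcs (graph M) = (\<Union>n. E n)"
      by (fact *)+
    show "S n \<subseteq> cells M" "V (Suc n) = V n \<union> (\<Union>f\<in>S n. set (pverts M (cbot M f)))"
        "E (Suc n) = E n \<union> (\<Union>f\<in>S n. set (snd (cbot M f)))" for n
      by (fact S_cells V_Suc E_Suc)+
    show "set (pverts M (ctop M f)) \<subseteq> V n" "set (snd (ctop M f)) \<subseteq> E n" "distinct (pverts M (cbot M f))"
        "set (pverts M (cbot M f)) \<inter> V n = {cstart M f, cend M f}"
        "set (snd (cbot M f)) \<inter> E n = {}" if "f \<in> S n" for f n
      using bspec[OF S_each that] by simp_all
    show "set (pverts M (cbot M f)) \<inter> set (pverts M (cbot M g))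
            \<subseteq> {cstart M f, cend M f} \<inter> {cstart M g, cend M g}"
        "set (snd (cbot M f)) \<inter> set (snd (cbot M g)) = {}"
      if "f \<in> S n" "g \<in> S n" "f \<noteq> g" for f g n
      using bspec[OF bspec[OF S_pair that(1)] that(2)] that(3) by simp_all
  qed
  then show ?thesis
    by (rule that)
qed

section \<open>Pushing words down a rooted 2-tree\<close>

context two_tree
begin

definition tree_cells :: "'f set" where
  "tree_cells = (\<Union>n. S n)"

lemma tree_cells_subset: "tree_cells \<subseteq> cells M"
  using S_cells by (auto simp: tree_cells_def)

text \<open>The orientation of choice: the cells that occur in thin diagrams are those with a new arc as
  bottom.\<close>

lemma tree_orientation: "orientation M (cells M - tree_cells)" "cells M - (cells M - tree_cells) = tree_cells"
proof -
  show eq: "cells M - (cells M - tree_cells) = tree_cells"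
    using tree_cells_subset by blast
  have inv: "cinv M ` tree_cells = cells M - tree_cells"
    using S_oriented by (simp add: tree_cells_def)
  have "cinv M ` cinv M ` tree_cells = tree_cells"
    using tree_cells_subset cinv_cell(2) by (force simp: image_image image_iff)
  then show "orientation M (cells M - tree_cells)"
    unfolding orientation_def eq using inv by auto
qed

lemma bottom:
  assumes "f \<in> S n"
  shows "awalk (cstart M f) (snd (cbot M f)) (cend M f)" "snd (cbot M f) \<noteq> []"
    "distinct (awalk_verts (cstart M f) (snd (cbot M f)))"
    "pverts M (cbot M f) = awalk_verts (cstart M f) (snd (cbot M f))"
    "cell_side M True f = cbot M f"
proof -
  have f: "f \<in> cells M"
    using S_cells assms by blast
  show side: "cell_side M True f = cbot M f"
    by (simp add: cell_side_def)
  show "awalk (cstart M f) (snd (cbot M f)) (cend M f)" "snd (cbot M f) \<noteq> []"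
    using cell_awalk[OF f, of True] side by auto
  show "pverts M (cbot M f) = awalk_verts (cstart M f) (snd (cbot M f))"
    using cell_awalk(2)[OF f, of True] side by (simp add: pverts_def)
  then show "distinct (awalk_verts (cstart M f) (snd (cbot M f)))"
    using bot_simple[OF assms] by simp
qed

lemma top_walk:
  assumes "f \<in> S n"
  shows "awalk (cstart M f) (snd (ctop M f)) (cend M f)"
  using cell_awalk[of f False] S_cells assms by (auto simp: cell_side_def)

lemma cell_ends:
  assumes "f \<in> S n"
  shows "cstart M f \<in> V n" "cend M f \<in> V n"
  using bot_new(1)[OF assms] by auto

lemma V_mono: "m \<le> n \<Longrightarrow> V m \<subseteq> V n"
  using lift_Suc_mono_le[of V m n] V_Suc by blast

lemma E_mono: "m \<le> n \<Longrightarrow> E m \<subseteq> E n"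
  using lift_Suc_mono_le[of E m n] E_Suc by blast

lemma edge_ends:
  "e \<in> E n \<Longrightarrow> tail (graph M) e \<in> V n \<and> head (graph M) e \<in> V n"
proof (induction n)
  case 0
  have "awalk (fst trunk) (snd trunk) (pend M trunk)"
    using trunk(1) onepaths_iff by (metis prod.collapse)
  then show ?case
    using 0 awalk_verts_arc1[of e "snd trunk"] awalk_verts_arc2 by (auto simp: E0 V0 pverts_def)
next
  case (Suc n)
  show ?case
  proof (cases "e \<in> E n")
    case True
    then show ?thesis
      using Suc V_mono[of n "Suc n"] by auto
  next
    case False
    then obtain f where f: "f \<in> S n" "e \<in> set (snd (cbot M f))"
      using Suc.prems E_Suc by auto
    then have "tail (graph M) e \<in> set (pverts M (cbot M f))" "head (graph M) e \<in> set (pverts M (cbot M f))"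
      using awalk_verts_arc1[OF f(2)] awalk_verts_arc2[OF bottom(1)[OF f(1)] f(2)] bottom(4)[OF f(1)] by auto
    then show ?thesis
      using f V_Suc by auto
  qed
qed

text \<open>A cell attached in step \<open>m\<close> belongs to the stages from \<open>m + 1\<close> on.\<close>

fun in_level :: "nat \<Rightarrow> ('e, 'f) letter \<Rightarrow> bool" where
  "in_level n (Edge e) \<longleftrightarrow> e \<in> E n"
| "in_level n (Cell f t) \<longleftrightarrow> (\<exists>m<n. f \<in> S m)"

abbreviation level_word :: "nat \<Rightarrow> ('e, 'f) letter list \<Rightarrow> bool" where
  "level_word n w \<equiv> list_all (in_level n) w"

lemma in_level_mono: "in_level m l \<Longrightarrow> m \<le> n \<Longrightarrow> in_level n l"
  using E_mono by (cases l) (auto intro: less_le_trans)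

lemma level_word_mono: "level_word m w \<Longrightarrow> m \<le> n \<Longrightarrow> level_word n w"
  by (auto simp: list_all_iff intro: in_level_mono)

lemma level_word_side:
  assumes "f \<in> S m" "m < n"
  shows "level_word n (map Edge (snd (cell_side M k f)))"
proof -
  have "set (snd (cell_side M k f)) \<subseteq> E (Suc m)"
    using top_old(2)[OF assms(1)] assms(1) by (auto simp: cell_side_def E_Suc)
  then show ?thesis
    using E_mono[of "Suc m" n] assms(2) by (auto simp: list_all_iff)
qed

lemma level_exists:
  assumes "valid_word M tree_cells v w x"
  shows "\<exists>n. level_word n w"
  using assms
proof (induction w arbitrary: v)
  case (Cons l w)
  obtain n where n: "level_word n w"
    using Cons by (cases l) auto
  obtain m where "in_level m l"
    using Cons.prems arcs_levels by (cases l) (auto simp: tree_cells_def intro: lessI)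
  then have "level_word (max m n) (l # w)"
    using level_word_mono[OF n, of "max m n"] in_level_mono[of m l "max m n"] by simp
  then show ?case ..
qed simp

definition owner :: "nat \<Rightarrow> 'e \<Rightarrow> 'f" where
  "owner m e = (THE f. f \<in> S m \<and> e \<in> set (snd (cbot M f)))"

lemma owner_eq: "f \<in> S m \<Longrightarrow> e \<in> set (snd (cbot M f)) \<Longrightarrow> owner m e = f"
  unfolding owner_def using bot_apart(2) by (intro the_equality) blast+

lemma new_edgeE:
  assumes "e \<in> E (Suc m)" "e \<notin> E m"
  obtains f where "f \<in> S m" "e \<in> set (snd (cbot M f))" "owner m e = f"
  using assms owner_eq by (auto simp: E_Suc)

text \<open>A substitution for the new arcs and cells of one step. What replaces an arc is put in the place
  of its first edge, and its other edges are deleted. This makes the substitution letterwise, and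
  words need not be parsed into arcs.\<close>

fun stage :: "nat \<Rightarrow> ('f \<Rightarrow> ('e, 'f) letter list) \<Rightarrow> ('f \<Rightarrow> real \<Rightarrow> ('e, 'f) letter list) \<Rightarrow>
    ('e, 'f) letter \<Rightarrow> ('e, 'f) letter list" where
  "stage m A B (Edge e) =
     (if e \<in> E (Suc m) - E m then if e = hd (snd (cbot M (owner m e))) then A (owner m e) else []
      else [Edge e])"
| "stage m A B (Cell f t) = (if f \<in> S m then B f t else [Cell f t])"

definition stage_word :: "nat \<Rightarrow> ('f \<Rightarrow> ('e, 'f) letter list) \<Rightarrow> ('f \<Rightarrow> real \<Rightarrow> ('e, 'f) letter list) \<Rightarrow>
    ('e, 'f) letter list \<Rightarrow> ('e, 'f) letter list" where
  "stage_word m A B w = concat (map (stage m A B) w)"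

lemma stage_word_simps [simp]:
  "stage_word m A B [] = []" "stage_word m A B (l # w) = stage m A B l @ stage_word m A B w"
  "stage_word m A B (w @ w') = stage_word m A B w @ stage_word m A B w'"
  by (simp_all add: stage_word_def)

lemma stage_old: "in_level m l \<Longrightarrow> stage m A B l = [l]"
proof (cases l)
  case (Cell f t)
  assume "in_level m l"
  then obtain j where "j < m" "f \<in> S j"
    using Cell by auto
  then have "f \<notin> S m"
    using S_disjoint[of j m] by auto
  then show ?thesis
    using Cell by simp
qed auto

lemma stage_word_old: "level_word m w \<Longrightarrow> stage_word m A B w = w"
  by (induction w) (auto simp: stage_old)

lemma stage_word_bottom:
  assumes f: "f \<in> S m"
  shows "stage_word m A B (map Edge (snd (cbot M f))) = A f"
proof -
  have new: "stage m A B (Edge e) = (if e = hd (snd (cbot M f)) then A f else [])"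
    if "e \<in> set (snd (cbot M f))" for e
    using that owner_eq[OF f that] bot_new(2)[OF f] f by (auto simp: E_Suc)
  obtain e es where es: "snd (cbot M f) = e # es"
    using bottom(2)[OF f] by (cases "snd (cbot M f)") auto
  have "tail (graph M) e' \<noteq> cstart M f" if "e' \<in> set es" for e'
    using bottom(1,3)[OF f] awalk_verts_arc1[OF that, of "head (graph M) e"] es
    by (auto simp: awalk_Cons_iff)
  then have ne: "e' \<noteq> e" if "e' \<in> set es" for e'
    using bottom(1)[OF f] es that by (auto simp: awalk_Cons_iff)
  have "stage_word m A B (map Edge es') = []" if "set es' \<subseteq> set es" for es'
    using that new es ne by (induction es') auto
  then show ?thesis
    using new[of e] es by simp
qed

text \<open>Since an arc is concentrated in its first edge, all vertices of the arc beyond the first one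
  have to be moved to its end.\<close>

definition retract_vertex :: "nat \<Rightarrow> 'v \<Rightarrow> 'v" where
  "retract_vertex m v = (if v \<in> V m then v
     else cend M (THE f. f \<in> S m \<and> v \<in> set (pverts M (cbot M f))))"

lemma retract_vertex_bottom:
  assumes f: "f \<in> S m" "v \<in> set (pverts M (cbot M f))" "v \<noteq> cstart M f"
  shows "retract_vertex m v = cend M f"
proof (cases "v \<in> V m")
  case True
  then show ?thesis
    using assms bot_new(1)[OF f(1)] by (auto simp: retract_vertex_def)
next
  case False
  have "(THE f. f \<in> S m \<and> v \<in> set (pverts M (cbot M f))) = f"
  proof (rule the_equality)
    fix g assume g: "g \<in> S m \<and> v \<in> set (pverts M (cbot M g))"
    show "g = f"
    proof (rule ccontr)
      assume "g \<noteq> f"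
      then have "v \<in> {cstart M f, cend M f}"
        using bot_apart(1)[of g m f] g f by auto
      then show False
        using False cell_ends[OF f(1)] by auto
    qed
  qed (use f in blast)
  then show ?thesis
    using False by (simp add: retract_vertex_def)
qed

lemma V_verts: "v \<in> V n \<Longrightarrow> v \<in> verts (graph M)"
proof (induction n)
  case 0
  have "awalk (fst trunk) (snd trunk) (pend M trunk)"
    using trunk(1) onepaths_iff by (metis prod.collapse)
  then show ?case
    using 0 awalk_verts_in_verts[of "fst trunk" "snd trunk" v] by (auto simp: V0 pverts_def)
next
  case (Suc n)
  show ?case
  proof (cases "v \<in> V n")
    case False
    then obtain f where f: "f \<in> S n" "v \<in> set (pverts M (cbot M f))"
      using Suc.prems V_Suc by auto
    then show ?thesis
      using bottom(1)[OF f(1)] bottom(4)[OF f(1)]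
        awalk_verts_in_verts[of "cstart M f" "snd (cbot M f)" v] by auto
  qed (use Suc in simp)
qed

lemma retract_vertex_in: "v \<in> V (Suc m) \<Longrightarrow> retract_vertex m v \<in> V m"
proof (cases "v \<in> V m")
  case False
  assume "v \<in> V (Suc m)"
  then obtain f where f: "f \<in> S m" "v \<in> set (pverts M (cbot M f))"
    using False V_Suc by auto
  then have "retract_vertex m v = cend M f"
    using False cell_ends[OF f(1)] by (intro retract_vertex_bottom) auto
  then show ?thesis
    using cell_ends[OF f(1)] by simp
qed (simp add: retract_vertex_def)

text \<open>The substitution of an edge or cell leads from the retracted source to the retracted target
  of that letter, hence substituted words are again composable.\<close>

lemma valid_stage_word:
  assumes A: "\<And>f. f \<in> S m \<Longrightarrow> valid_word M tree_cells (cstart M f) (A f) (cend M f)"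
    and B: "\<And>f t. f \<in> S m \<Longrightarrow> t \<in> {0..1} \<Longrightarrow> valid_word M tree_cells (cstart M f) (B f t) (cend M f)"
  shows "valid_word M tree_cells v w x \<Longrightarrow> level_word (Suc m) w \<Longrightarrow> v \<in> V (Suc m) \<Longrightarrow>
    valid_word M tree_cells (retract_vertex m v) (stage_word m A B w) (retract_vertex m x)"
proof (induction w arbitrary: v)
  case Nil
  then show ?case
    using V_verts retract_vertex_in by auto
next
  case (Cons l w)
  have old: "retract_vertex m u = u" if "u \<in> V m" for u
    using that by (simp add: retract_vertex_def)
  show ?case
  proof (cases l)
    case (Edge e)
    let ?h = "head (graph M) e"
    have e: "e \<in> E (Suc m)" "tail (graph M) e = v" "valid_word M tree_cells ?h w x" "e \<in> arcs (graph M)"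
      using Cons.prems Edge by auto
    then have IH: "valid_word M tree_cells (retract_vertex m ?h) (stage_word m A B w) (retract_vertex m x)"
      using Cons.IH Cons.prems(2) edge_ends[OF e(1)] by simp
    have "valid_word M tree_cells (retract_vertex m v) (stage m A B l) (retract_vertex m ?h)"
    proof (cases "e \<in> E m")
      case True
      then show ?thesis
        using edge_ends[OF True] e old Edge V_verts by auto
    next
      case False
      then obtain f where f: "f \<in> S m" "e \<in> set (snd (cbot M f))" "owner m e = f"
        using e new_edgeE by blast
      have ends: "?h \<in> set (pverts M (cbot M f))" "v \<in> set (pverts M (cbot M f))"
        using awalk_verts_arc1[OF f(2)] awalk_verts_arc2[OF bottom(1)[OF f(1)] f(2)] bottom(4)[OF f(1)] e
        by auto
      have "?h \<noteq> cstart M f" and hd: "v = cstart M f \<longleftrightarrow> e = hd (snd (cbot M f))"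
        using simple_arc_edge[OF bottom(1,3)[OF f(1)] f(2)] e by auto
      then have h: "retract_vertex m ?h = cend M f"
        using retract_vertex_bottom[OF f(1) ends(1)] by simp
      show ?thesis
      proof (cases "e = hd (snd (cbot M f))")
        case True
        then show ?thesis
          using hd h A[OF f(1)] Edge e f False old cell_ends[OF f(1)] by simp
      next
        case not_hd: False
        then have "retract_vertex m v = cend M f"
          using retract_vertex_bottom[OF f(1) ends(2)] hd by simp
        then show ?thesis
          using not_hd h Edge e f False V_verts cell_ends[OF f(1)] by simp
      qed
    qed
    then show ?thesis
      using IH by (auto simp: valid_word_append[OF tree_cells_subset])
  next
    case (Cell f t)
    have f: "f \<in> tree_cells" "t \<in> {0..1}" "cstart M f = v" "valid_word M tree_cells (cend M f) w x"
      using Cons.prems Cell by auto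
    obtain j where j: "j \<le> m" "f \<in> S j"
      using Cons.prems(2) Cell by (auto simp: less_Suc_eq_le)
    then have ends: "cstart M f \<in> V m" "cend M f \<in> V m"
      using cell_ends[OF j(2)] V_mono[OF j(1)] by auto
    have IH: "valid_word M tree_cells (cend M f) (stage_word m A B w) (retract_vertex m x)"
      using Cons.IH[OF f(4)] Cons.prems(2) ends V_mono[of m "Suc m"] old[OF ends(2)] by auto
    have "valid_word M tree_cells v (stage m A B l) (cend M f)"
      using B[of f t] f Cell V_verts ends by auto
    then show ?thesis
      using IH f ends old by (auto simp: valid_word_append[OF tree_cells_subset])
  qed
qed

lemma level_word_collapse:
  assumes "(w, w') \<in> (collapse M tree_cells)\<^sup>*" "level_word n w"
  shows "level_word n w'"
  using assms
proof induction
  case (step y z)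
  then obtain a f k b where yz: "y = a @ Cell f (of_bool k) # b" "z = a @ map Edge (snd (cell_side M k f)) @ b"
    by (auto simp: collapse_def)
  moreover have "level_word n y"
    using step by simp
  ultimately obtain j where "j < n" "f \<in> S j"
    by auto
  then show ?case
    using level_word_side[of f j n k] yz \<open>level_word n y\<close> by simp
qed

text \<open>A cell attached in step \<open>m\<close> is replaced by \<open>B\<close>, its bottom by \<open>A\<close>, and its top is left alone; the
  premise says that these choices fit together. Older cells and their sides are left alone.\<close>

lemma collapse_stage_word:
  assumes A: "\<And>f k. f \<in> S m \<Longrightarrow>
      (B f (of_bool k), if k then A f else map Edge (snd (ctop M f))) \<in> (collapse M tree_cells)\<^sup>*"
    and w: "(w, w') \<in> (collapse M tree_cells)\<^sup>*" "level_word (Suc m) w"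
  shows "(stage_word m A B w, stage_word m A B w') \<in> (collapse M tree_cells)\<^sup>*"
  using w(1)
proof induction
  case base
  then show ?case using w(2) by simp
next
  case (step y z)
  obtain a f k b where yz: "y = a @ Cell f (of_bool k) # b" "z = a @ map Edge (snd (cell_side M k f)) @ b"
    using step(2) by (auto simp: collapse_def)
  have level: "level_word (Suc m) y"
    using level_word_collapse[OF step(1) w(2)] .
  then obtain j where j: "j < Suc m" "f \<in> S j"
    using yz by auto
  have "(stage m A B (Cell f (of_bool k)), stage_word m A B (map Edge (snd (cell_side M k f))))
      \<in> (collapse M tree_cells)\<^sup>*"
  proof (cases "j = m")
    case True
    have "stage_word m A B (map Edge (snd (cell_side M k f))) = (if k then A f else map Edge (snd (ctop M f)))"
    proof (cases k)
      case False
      have "level_word m (map Edge (snd (ctop M f)))"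
        using top_old(2)[of f m] j True by (auto simp: list_all_iff)
      then show ?thesis
        using False stage_word_old by (simp add: cell_side_def)
    qed (use stage_word_bottom j True in \<open>simp add: cell_side_def\<close>)
    then show ?thesis
      using A[of f k] j True by simp
  next
    case False
    then have "j < m"
      using j by simp
    then have "stage_word m A B (map Edge (snd (cell_side M k f))) = map Edge (snd (cell_side M k f))"
      by (intro stage_word_old level_word_side[OF j(2)])
    moreover have "f \<notin> S m"
      using S_disjoint[OF False] j by blast
    moreover have "f \<in> tree_cells"
      using j by (auto simp: tree_cells_def)
    ultimately show ?thesis
      using collapseI[of f tree_cells "[]" k "[]" M] by auto
  qed
  then have "(stage_word m A B y, stage_word m A B z) \<in> (collapse M tree_cells)\<^sup>*"
    using collapse_context[of "stage m A B (Cell f (of_bool k))" _ M tree_cells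
        "stage_word m A B a" "stage_word m A B b"] unfolding yz by (simp del: stage.simps)
  then show ?case
    using step.IH by (rule rtrancl_trans[rotated])
qed

text \<open>\<open>retract m\<close> pushes words across the cells of step \<open>m\<close>, and \<open>slide m\<close> with decreasing \<open>\<tau>\<close> is the
  motion that leads there: new arcs become cells of weight \<open>\<tau>\<close>, which is also an upper bound for
  the weights of the new cells.\<close>

definition retract :: "nat \<Rightarrow> ('e, 'f) letter list \<Rightarrow> ('e, 'f) letter list" where
  "retract m = stage_word m (\<lambda>f. map Edge (snd (ctop M f))) (\<lambda>f t. map Edge (snd (ctop M f)))"

definition slide :: "nat \<Rightarrow> real \<Rightarrow> ('e, 'f) letter list \<Rightarrow> ('e, 'f) letter list" where
  "slide m \<tau> = stage_word m (\<lambda>f. [Cell f \<tau>]) (\<lambda>f t. [Cell f (min t \<tau>)])"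

abbreviation start :: 'v where "start \<equiv> pstart trunk"
abbreviation finish :: 'v where "finish \<equiv> pend M trunk"

lemma root_walk: "awalk start (snd trunk) finish" "distinct (awalk_verts start (snd trunk))"
  using trunk onepaths_iff[of "fst trunk" "snd trunk"] by (auto simp: pstart_def pverts_def)

lemma root_ends: "start \<in> V n" "finish \<in> V n"
proof -
  have V0: "V 0 = set (awalk_verts start (snd trunk))"
    by (simp add: V0 pverts_def pstart_def)
  have "last (awalk_verts start (snd trunk)) = finish"
    using root_walk(1) by simp
  then have "start \<in> V 0" "finish \<in> V 0"
    using hd_in_awalk_verts(1)[OF root_walk(1)] last_in_set[OF awalk_verts_non_Nil, of start "snd trunk"]
    by (auto simp: V0)
  then show "start \<in> V n" "finish \<in> V n"
    using V_mono[of 0 n] by auto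
qed

lemma valid_word_letter:
  "valid_word M C v w x \<Longrightarrow> Cell f t \<in> set w \<Longrightarrow> f \<in> C \<and> t \<in> {0..1}"
proof (induction w arbitrary: v)
  case (Cons l w)
  then show ?case by (cases l) auto
qed simp

lemma stage_cell_in_tree: "f \<in> S m \<Longrightarrow> f \<in> tree_cells"
  by (auto simp: tree_cells_def)

lemma collapse_top: "f \<in> S m \<Longrightarrow> ([Cell f 0], map Edge (snd (ctop M f))) \<in> (collapse M tree_cells)\<^sup>*"
  using collapseI[OF stage_cell_in_tree, of f m "[]" False "[]" M] by (auto simp: cell_side_def)

lemma collapse_bottom: "f \<in> S m \<Longrightarrow> ([Cell f 1], map Edge (snd (cbot M f))) \<in> (collapse M tree_cells)\<^sup>*"
  using collapseI[OF stage_cell_in_tree, of f m "[]" True "[]" M] by (auto simp: cell_side_def)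

lemma slide_0:
  assumes "level_word (Suc m) w" "valid_word M C v w x"
  shows "(slide m 0 w, retract m w) \<in> (collapse M tree_cells)\<^sup>*"
  unfolding slide_def retract_def stage_word_def
proof (rule collapse_concat_map)
  fix l assume l: "l \<in> set w"
  let ?s = "stage m (\<lambda>f. [Cell f 0]) (\<lambda>f t. [Cell f (min t 0)]) l"
  let ?r = "stage m (\<lambda>f. map Edge (snd (ctop M f))) (\<lambda>f t. map Edge (snd (ctop M f))) l"
  show "(?s, ?r) \<in> (collapse M tree_cells)\<^sup>*"
  proof (cases l)
    case (Edge e)
    show ?thesis
    proof (cases "e \<in> E (Suc m) - E m")
      case True
      then obtain f where "f \<in> S m" "owner m e = f"
        using new_edgeE by blast
      then show ?thesis
        using Edge collapse_top by auto
    qed (use Edge in auto)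
  next
    case (Cell f t)
    then have "min t 0 = 0"
      using valid_word_letter[OF assms(2), of f t] l by simp
    then show ?thesis
      using collapse_top[of f m] Cell by simp
  qed
qed

text \<open>At an inner vertex of a new arc the only letter available is the next edge of the arc: inner
  vertices are new, older edges start at old vertices and so do all cells, and different arcs share
  only end points. A word from an old vertex to an old vertex therefore traverses every new arc
  that it enters, and putting the whole arc in the place of its first edge changes nothing.\<close>

lemma bottoms_traversed:
  assumes "valid_word M tree_cells v w x" "level_word (Suc m) w" "v \<in> V m" "x \<in> V m"
  shows "stage_word m (\<lambda>f. map Edge (snd (cbot M f))) (\<lambda>f t. [Cell f t]) w = w"
  using assms
proof (induction "length w" arbitrary: v w rule: less_induct)
  case less
  let ?\<sigma> = "stage_word m (\<lambda>f. map Edge (snd (cbot M f))) (\<lambda>f t. [Cell f t])"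
  show ?case
  proof (cases w)
    case (Cons l w')
    show ?thesis
    proof (cases l)
      case (Cell f t)
      obtain j where "j \<le> m" "f \<in> S j"
        using less.prems(2) Cons Cell by (auto simp: less_Suc_eq_le)
      then have "cend M f \<in> V m"
        using cell_ends V_mono by blast
      then have "?\<sigma> w' = w'"
        using less.prems Cons Cell by (intro less.hyps[of w' "cend M f"]) auto
      then show ?thesis
        using Cons Cell by simp
    next
      case (Edge e)
      show ?thesis
      proof (cases "e \<in> E m")
        case True
        then have "?\<sigma> w' = w'"
          using less.prems Cons Edge edge_ends[OF True]
          by (intro less.hyps[of w' "head (graph M) e"]) auto
        then show ?thesis
          using Cons Edge True by simp
      next
        case False
        then obtain f where f: "f \<in> S m" "e \<in> set (snd (cbot M f))"
          using less.prems(2) Cons Edge new_edgeE by auto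
        have tail: "tail (graph M) e = v"
          using less.prems(1) Cons Edge by simp
        note arc = simple_arc_edge[OF bottom(1,3)[OF f(1)] f(2)]
        have "v \<in> set (pverts M (cbot M f))"
          using awalk_verts_arc1[OF f(2)] bottom(4)[OF f(1)] tail by auto
        then have v: "v = cstart M f"
          using bot_new(1)[OF f(1)] less.prems(3) arc(3) tail by auto
        then obtain es where es: "snd (cbot M f) = e # es"
          using arc(2) tail bottom(2)[OF f(1)] by (cases "snd (cbot M f)") auto
        let ?h = "head (graph M) e"
        have walk: "awalk ?h es (cend M f)" "distinct (awalk_verts ?h es)"
            "cstart M f \<notin> set (awalk_verts ?h es)"
          using bottom(1,3)[OF f(1)] es tail v by (auto simp: awalk_Cons_iff)
        have inner: "u \<in> set (pverts M (cbot M f))" "u \<notin> V m" "u \<noteq> cstart M f"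
          if u: "u \<in> set (butlast (awalk_verts ?h es))" for u
        proof -
          have "awalk_verts ?h es = butlast (awalk_verts ?h es) @ [cend M f]"
            using walk(1) append_butlast_last_id[OF awalk_verts_non_Nil, of ?h es] by auto
          then have "u \<noteq> cend M f"
            using walk(2) u by (metis distinct_append disjoint_insert(2) list.simps(15))
          moreover show "u \<in> set (pverts M (cbot M f))"
            using u in_set_butlastD[OF u] es bottom(4)[OF f(1)] by simp
          moreover show "u \<noteq> cstart M f"
            using in_set_butlastD[OF u] walk(3) by auto
          ultimately show "u \<notin> V m"
            using bot_new(1)[OF f(1)] by auto
        qed
        have "\<exists>w''. w' = map Edge es @ w'' \<and> valid_word M tree_cells (cend M f) w'' x"
        proof (rule forced_arc[OF walk(1,2)])
          show "valid_word M tree_cells ?h w' x"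
            using less.prems(1) Cons Edge by simp
          show "x \<notin> set (butlast (awalk_verts ?h es))"
            using inner less.prems(4) by auto
          fix l assume l: "l \<in> set w'" "letter_source l \<in> set (butlast (awalk_verts ?h es))"
          have level: "in_level (Suc m) l"
            using less.prems(2) Cons l(1) by (auto simp: list_all_iff)
          show "l \<in> Edge ` set es"
          proof (cases l)
            case (Cell g t)
            then obtain j where "j \<le> m" "g \<in> S j"
              using level by (auto simp: less_Suc_eq_le)
            then have "cstart M g \<in> V m"
              using cell_ends V_mono by blast
            then show ?thesis
              using inner(2)[OF l(2)] Cell by simp
          next
            case (Edge e')
            then have "e' \<notin> E m"
              using inner(2)[OF l(2)] edge_ends by auto
            then obtain g where g: "g \<in> S m" "e' \<in> set (snd (cbot M g))"
              using level Edge new_edgeE by auto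
            have "tail (graph M) e' \<in> set (pverts M (cbot M g))"
              using awalk_verts_arc1[OF g(2)] bottom(4)[OF g(1)] by auto
            then have "letter_source l \<in> set (pverts M (cbot M f)) \<inter> set (pverts M (cbot M g))"
              using inner(1)[OF l(2)] Edge by simp
            moreover have "letter_source l \<notin> {cstart M f, cend M f}"
              using inner(2)[OF l(2)] cell_ends[OF f(1)] by auto
            ultimately have "g = f"
              using bot_apart(1)[OF f(1) g(1)] by blast
            moreover have "e' \<noteq> e"
              using inner(3)[OF l(2)] Edge tail v by auto
            ultimately show ?thesis
              using g es Edge by auto
          qed
        qed
        then obtain w'' where w'': "w' = map Edge es @ w''" "valid_word M tree_cells (cend M f) w'' x"
          by blast
        have "?\<sigma> w'' = w''"
          using less.prems Cons w'' cell_ends[OF f(1)]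
          by (intro less.hyps[of w'' "cend M f"]) auto
        moreover have "w = map Edge (snd (cbot M f)) @ w''"
          using Cons Edge w'' es by simp
        ultimately show ?thesis
          using stage_word_bottom[OF f(1)] by simp
      qed
    qed
  qed simp
qed

lemma slide_1:
  assumes "valid_word M tree_cells start w finish" "level_word (Suc m) w"
  shows "(slide m 1 w, w) \<in> (collapse M tree_cells)\<^sup>*"
proof -
  have "(slide m 1 w, stage_word m (\<lambda>f. map Edge (snd (cbot M f))) (\<lambda>f t. [Cell f t]) w)
      \<in> (collapse M tree_cells)\<^sup>*"
    unfolding slide_def stage_word_def
  proof (rule collapse_concat_map)
    fix l assume l: "l \<in> set w"
    let ?s = "stage m (\<lambda>f. [Cell f 1]) (\<lambda>f t. [Cell f (min t 1)]) l"
    let ?r = "stage m (\<lambda>f. map Edge (snd (cbot M f))) (\<lambda>f t. [Cell f t]) l"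
    show "(?s, ?r) \<in> (collapse M tree_cells)\<^sup>*"
    proof (cases l)
      case (Edge e)
      show ?thesis
      proof (cases "e \<in> E (Suc m) - E m")
        case True
        then obtain f where "f \<in> S m" "owner m e = f"
          using new_edgeE by blast
        then show ?thesis
          using Edge collapse_bottom by auto
      qed (use Edge in auto)
    next
      case (Cell f t)
      then show ?thesis
        using valid_word_letter[OF assms(1)] l by (auto simp: min_def)
    qed
  qed
  then show ?thesis
    using bottoms_traversed[OF assms] root_ends by simp
qed

lemma valid_slide:
  assumes "valid_word M tree_cells start w finish" "level_word (Suc m) w" "\<tau> \<in> {0..1}"
  shows "valid_word M tree_cells start (slide m \<tau> w) finish"
proof -
  have "valid_word M tree_cells (retract_vertex m start) (slide m \<tau> w) (retract_vertex m finish)"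
    unfolding slide_def
  proof (rule valid_stage_word[OF _ _ assms(1,2) root_ends(1)])
    fix f assume "f \<in> S m"
    then show "valid_word M tree_cells (cstart M f) [Cell f \<tau>] (cend M f)"
        "\<And>t. t \<in> {0..1} \<Longrightarrow> valid_word M tree_cells (cstart M f) [Cell f (min t \<tau>)] (cend M f)"
      using assms(3) stage_cell_in_tree V_verts[OF cell_ends(2), of f m] by auto
  qed
  then show ?thesis
    using root_ends by (simp add: retract_vertex_def)
qed

lemma valid_retract:
  assumes "valid_word M tree_cells start w finish" "level_word (Suc m) w"
  shows "valid_word M tree_cells start (retract m w) finish"
proof -
  have "valid_word M tree_cells (retract_vertex m start) (retract m w) (retract_vertex m finish)"
    unfolding retract_def
    by (rule valid_stage_word[OF _ _ assms(1,2) root_ends(1)]) (use top_walk valid_word_edges in blast)+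
  then show ?thesis
    using root_ends by (simp add: retract_vertex_def)
qed

lemma level_retract:
  "level_word (Suc m) w \<Longrightarrow> level_word m (retract m w)"
proof (induction w)
  case (Cons l w)
  have top: "level_word m (map Edge (snd (ctop M f)))" if "f \<in> S m" for f
    using top_old(2)[OF that] by (auto simp: list_all_iff)
  have "level_word m (stage m (\<lambda>f. map Edge (snd (ctop M f))) (\<lambda>f t. map Edge (snd (ctop M f))) l)"
  proof (cases l)
    case (Edge e)
    then have "e \<in> E (Suc m)"
      using Cons.prems by simp
    then show ?thesis
      using Edge top new_edgeE[of e m] by (cases "e \<in> E m") auto
  next
    case (Cell f t)
    then show ?thesis
      using Cons.prems top by (auto simp: less_Suc_eq)
  qed
  then show ?case
    using Cons by (simp add: retract_def)
qed (simp add: retract_def)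

text \<open>The steps \<open>N - 1, \<dots>, n\<close> are undone in this order.\<close>

primrec descend :: "nat \<Rightarrow> nat \<Rightarrow> ('e, 'f) letter list \<Rightarrow> ('e, 'f) letter list" where
  "descend n 0 w = w"
| "descend n (Suc N) w = (if n \<le> N then descend n N (retract N w) else w)"

lemma descend_id: "N \<le> n \<Longrightarrow> descend n N w = w"
  by (cases N) auto

lemma descend_Suc: "level_word N w \<Longrightarrow> descend n (Suc N) w = descend n N w"
  using descend_id[of N n] by (simp add: retract_def stage_word_old)

text \<open>Undoing steps that a word does not reach has no effect, so the number \<open>N\<close> only has to be large
  enough for the word.\<close>

lemma descend_mono:
  assumes "level_word N w" "N \<le> N'"
  shows "descend n N' w = descend n N w"
  using assms(2)
proof (induction rule: dec_induct)
  case (step k)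
  then show ?case
    using descend_Suc[of k w n] level_word_mono[OF assms(1), of k] by simp
qed simp

lemma retract_descend:
  "level_word N w \<Longrightarrow> retract n (descend (Suc n) N w) = descend n N w"
proof (induction N arbitrary: w)
  case 0
  then show ?case
    using level_word_mono[of 0 w n] by (simp add: retract_def stage_word_old)
next
  case (Suc N)
  consider "n < N" | "n = N" | "N < n"
    by linarith
  then show ?case
  proof cases
    case 1
    then show ?thesis
      using Suc.IH[OF level_retract[OF Suc.prems]] by simp
  next
    case 2
    then show ?thesis
      using descend_id by simp
  next
    case 3
    then show ?thesis
      using level_word_mono[OF Suc.prems, of n] by (simp add: retract_def stage_word_old)
  qed
qed

lemma level_descend: "level_word N w \<Longrightarrow> level_word n (descend n N w)"
proof (induction N arbitrary: w)
  case 0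
  then show ?case using level_word_mono[of 0 w n] by simp
next
  case (Suc N)
  then show ?case
    using level_retract level_word_mono[OF Suc.prems, of n] by auto
qed

lemma valid_descend:
  "valid_word M tree_cells start w finish \<Longrightarrow> level_word N w \<Longrightarrow>
    valid_word M tree_cells start (descend n N w) finish"
  by (induction N arbitrary: w) (auto simp: valid_retract level_retract)

lemma collapse_retract:
  assumes "(w, w') \<in> (collapse M tree_cells)\<^sup>*" "level_word (Suc m) w"
  shows "(retract m w, retract m w') \<in> (collapse M tree_cells)\<^sup>*"
  unfolding retract_def by (rule collapse_stage_word[OF _ assms]) auto

lemma collapse_slide:
  assumes "(w, w') \<in> (collapse M tree_cells)\<^sup>*" "level_word (Suc m) w" "\<tau> \<in> {0..1}"
  shows "(slide m \<tau> w, slide m \<tau> w') \<in> (collapse M tree_cells)\<^sup>*"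
  unfolding slide_def
  by (rule collapse_stage_word[OF _ assms(1,2)]) (use assms(3) collapse_top in \<open>auto simp: min_def\<close>)

lemma collapse_descend:
  "(w, w') \<in> (collapse M tree_cells)\<^sup>* \<Longrightarrow> level_word N w \<Longrightarrow>
    (descend n N w, descend n N w') \<in> (collapse M tree_cells)\<^sup>*"
proof (induction N arbitrary: w w')
  case (Suc N)
  then show ?case
    using collapse_retract[of w w' N] level_retract by auto
qed simp

text \<open>The root is a simple arc, and it is all that is left of the 2-tree.\<close>

lemma level_0_word:
  assumes "valid_word M tree_cells start w finish" "level_word 0 w"
  shows "w = map Edge (snd trunk)"
proof -
  have letters: "\<exists>e\<in>set (snd trunk). l = Edge e" if "l \<in> set w" for l
    using assms(2) that by (cases l) (auto simp: list_all_iff E0)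
  have "awalk_verts start (snd trunk) = butlast (awalk_verts start (snd trunk)) @ [finish]"
    using root_walk(1) append_butlast_last_id[OF awalk_verts_non_Nil, of start "snd trunk"] by auto
  then have "finish \<notin> set (butlast (awalk_verts start (snd trunk)))"
    using root_walk(2) by (metis distinct_append disjoint_insert(2) list.simps(15))
  then obtain w' where w': "w = map Edge (snd trunk) @ w'" "valid_word M tree_cells finish w' finish"
    using forced_arc[OF root_walk assms(1)] letters by blast
  have "w' = []"
  proof (cases w')
    case (Cons l w1)
    then obtain e where e: "e \<in> set (snd trunk)" "l = Edge e"
      using letters w'(1) by auto
    then show ?thesis
      using simple_arc_edge(3)[OF root_walk e(1)] w'(2) Cons by simp
  qed
  then show ?thesis
    using w' by simp
qed

lemma cont_word_stage:
  assumes "cont_word Z W" and "\<And>f. cont_word Z (A f)"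
    and "\<And>f a. continuous_map Z (top_of_set {0..1}) a \<Longrightarrow> cont_word Z (\<lambda>z. B z f (a z))"
  shows "cont_word Z (\<lambda>z. stage_word m (\<lambda>f. A f z) (B z) (W z))"
  unfolding stage_word_def
proof (rule cont_word_concat_map[OF assms(1)])
  show "cont_word Z (\<lambda>z. stage m (\<lambda>f. A f z) (B z) (Edge e))" for e
    using assms(2) cont_word_edges[of Z "[]"] cont_word_edges[of Z "[e]"]
    by (cases "e \<in> E (Suc m)"; cases "e \<in> E m"; cases "e = hd (snd (cbot M (owner m e)))") simp_all
  show "cont_word Z (\<lambda>z. stage m (\<lambda>f. A f z) (B z) (Cell f (a z)))"
    if "continuous_map Z (top_of_set {0..1}) a" for f a
    using assms(3)[OF that] cont_word_Cell[OF cont_word_Nil that] by (cases "f \<in> S m") simp_all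
qed

lemma cont_word_retract: "cont_word Z W \<Longrightarrow> cont_word Z (\<lambda>z. retract m (W z))"
  unfolding retract_def by (rule cont_word_stage) (auto intro: cont_word_edges)

lemma cont_word_slide:
  assumes "cont_word Z W" "continuous_map Z (top_of_set {0..1}) \<tau>"
  shows "cont_word Z (\<lambda>z. slide m (\<tau> z) (W z))"
  unfolding slide_def
proof (rule cont_word_stage[OF assms(1)])
  show "cont_word Z (\<lambda>z. [Cell f (\<tau> z)])" for f
    using assms(2) by (auto intro: cont_word.intros)
  show "cont_word Z (\<lambda>z. [Cell f (min (a z) (\<tau> z))])"
    if "continuous_map Z (top_of_set {0..1}) a" for f a
  proof -
    have "continuous_map Z euclideanreal (\<lambda>z. min (a z) (\<tau> z))"
      using that assms(2) by (intro continuous_map_real_min) (auto simp: continuous_map_in_subtopology)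
    moreover have "min (a z) (\<tau> z) \<in> {0..1}" if "z \<in> topspace Z" for z
      using \<open>continuous_map Z (top_of_set {0..1}) a\<close> assms(2) that
      by (auto simp: continuous_map_in_subtopology Pi_iff min_def)
    ultimately have "continuous_map Z (top_of_set {0..1}) (\<lambda>z. min (a z) (\<tau> z))"
      by (simp add: continuous_map_in_subtopology Pi_iff)
    then show ?thesis
      by (auto intro: cont_word.intros)
  qed
qed

lemma cont_word_descend: "cont_word Z W \<Longrightarrow> cont_word Z (\<lambda>z. descend n N (W z))"
proof (induction N arbitrary: W)
  case (Suc N)
  then show ?case
    using cont_word_retract[of Z W N] by (cases "n \<le> N") auto
qed simp

end

section \<open>Contraction of the Squier complex of a rooted 2-tree\<close>

text \<open>Step \<open>i\<close> of the contraction takes place in the time interval \<open>[1/(i+2), 1/(i+1)]\<close>. There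
  \<open>ramp i\<close> decreases from 1 to 0; it is truncated to be defined for all times.\<close>

definition piece :: "real \<Rightarrow> nat" where
  "piece t = nat \<lfloor>1 / t - 1\<rfloor>"

definition ramp :: "nat \<Rightarrow> real \<Rightarrow> real" where
  "ramp i t = max 0 (min 1 ((real i + 2) * (1 - (real i + 1) * t)))"

lemma piece_bounds:
  assumes "0 < t" "t \<le> 1"
  shows "1 / (real (piece t) + 2) \<le> t" "t \<le> 1 / (real (piece t) + 1)"
proof -
  have "0 \<le> 1 / t - 1"
    using assms by simp
  then have "real (piece t) \<le> 1 / t - 1" "1 / t - 1 < real (piece t) + 1"
    unfolding piece_def by linarith+
  then have "real (piece t) + 1 \<le> 1 / t" "1 / t \<le> real (piece t) + 2"
    by linarith+
  with assms show "1 / (real (piece t) + 2) \<le> t" "t \<le> 1 / (real (piece t) + 1)"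
    by (auto simp: field_simps)
qed

lemma ramp_bounds: "ramp i t \<in> {0..1}"
  by (auto simp: ramp_def)

lemma ramp_0: "ramp i (1 / (real i + 1)) = 0"
  by (simp add: ramp_def)

lemma ramp_1: "ramp i (1 / (real i + 2)) = 1"
  by (simp add: ramp_def field_simps)

context two_tree
begin

abbreviation tree_Sq :: "('v, 'e, 'f) diagram cubical" where
  "tree_Sq \<equiv> Sq_between M (cells M - tree_cells) start finish"

abbreviation tree_point :: "('e, 'f) letter list \<Rightarrow> ('v, 'e, 'f) diagram cube_point set" where
  "tree_point \<equiv> word_class M (cells M - tree_cells) start finish"

abbreviation full_word :: "('e, 'f) letter list \<Rightarrow> bool" where
  "full_word w \<equiv> valid_word M tree_cells start w finish"

definition word_level :: "('e, 'f) letter list \<Rightarrow> nat" where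
  "word_level w = (LEAST n. level_word n w)"

text \<open>The identity at time 0, and step \<open>i\<close> during the \<open>i\<close>-th interval, applied to what is left when the
  later steps of the construction have been undone.\<close>

definition contract :: "('e, 'f) letter list \<Rightarrow> real \<Rightarrow> ('v, 'e, 'f) diagram cube_point set" where
  "contract w t = (if t \<le> 0 then tree_point w
     else tree_point (slide (piece t) (ramp (piece t) t) (descend (Suc (piece t)) (word_level w) w)))"

lemma tree_point_collapse:
  "(w, w') \<in> (collapse M tree_cells)\<^sup>* \<Longrightarrow> full_word w \<Longrightarrow> tree_point w = tree_point w'"
  using word_class_collapse(2)[of w w' "cells M - tree_cells"] tree_orientation(2) by simp

lemma descend_word_level:
  assumes "level_word N w"
  shows "descend n (word_level w) w = descend n N w"
proof -
  have "level_word (word_level w) w" "word_level w \<le> N"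
    unfolding word_level_def using assms by (rule LeastI, rule Least_le)
  from descend_mono[OF this] show ?thesis
    by (rule sym)
qed

text \<open>These are the values of step \<open>i\<close> of the contraction at the beginning and the end of its interval,
  which match those of the neighbouring steps.\<close>

lemma slide_end:
  assumes "full_word w" "level_word N w"
  shows "tree_point (slide i 1 (descend (Suc i) N w)) = tree_point (descend (Suc i) N w)"
    and "tree_point (slide i 0 (descend (Suc i) N w)) = tree_point (descend i N w)"
proof -
  let ?w = "descend (Suc i) N w"
  have w: "full_word ?w" "level_word (Suc i) ?w"
    using valid_descend[OF assms] level_descend[OF assms(2)] by auto
  show "tree_point (slide i 1 ?w) = tree_point ?w"
    using tree_point_collapse[OF slide_1[OF w]] valid_slide[OF w, of 1] by simp
  show "tree_point (slide i 0 ?w) = tree_point (descend i N w)"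
    using tree_point_collapse[OF slide_0[OF w(2,1)]] valid_slide[OF w, of 0] retract_descend[OF assms(2), of i]
    by simp
qed

lemma contract_collapse:
  assumes w: "(w, w') \<in> (collapse M tree_cells)\<^sup>*" "full_word w"
  shows "contract w t = contract w' t"
proof (cases "t \<le> 0")
  case True
  then show ?thesis
    using tree_point_collapse[OF w] by (simp add: contract_def)
next
  case False
  obtain N where N: "level_word N w"
    using level_exists[OF w(2)] by blast
  have N': "level_word N w'"
    using level_word_collapse[OF w(1) N] .
  let ?n = "Suc (piece t)"
  have level: "level_word ?n (descend ?n N w)"
    using level_descend[OF N] .
  have "(slide (piece t) (ramp (piece t) t) (descend ?n N w), slide (piece t) (ramp (piece t) t) (descend ?n N w'))
      \<in> (collapse M tree_cells)\<^sup>*"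
    by (intro collapse_slide collapse_descend w(1) N level ramp_bounds)
  moreover have "full_word (slide (piece t) (ramp (piece t) t) (descend ?n N w))"
    by (intro valid_slide valid_descend w(2) N level ramp_bounds)
  ultimately have "tree_point (slide (piece t) (ramp (piece t) t) (descend ?n N w)) =
      tree_point (slide (piece t) (ramp (piece t) t) (descend ?n N w'))"
    by (rule tree_point_collapse)
  then show ?thesis
    unfolding contract_def descend_word_level[OF N] descend_word_level[OF N'] using False by simp
qed

lemma respects_gluing_contract: "respects_gluing tree_Sq (on_words (\<lambda>w. contract w t))"
proof (rule respects_gluing_on_words)
  fix a b :: "('e, 'f) letter list" and f k
  let ?w = "a @ Cell f (of_bool k) # b"
  assume "valid_word M (cells M - (cells M - tree_cells)) start ?w finish"
  then have w: "full_word ?w"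
    by (simp add: tree_orientation)
  then have "f \<in> tree_cells"
    by (auto simp: valid_word_append[OF tree_cells_subset])
  then show "contract ?w t = contract (a @ map Edge (snd (cell_side M k f)) @ b) t"
    by (intro contract_collapse w r_into_rtrancl collapseI)
qed

lemma level_diagram_word: "level_word N (diagram_word (u, c) s) \<longleftrightarrow> level_word N (diagram_word (u, c) s')"
proof (induction c arbitrary: u s s')
  case (Cons a c)
  then show ?case
    by (cases a) auto
qed simp

text \<open>All words of a cube belong to one stage \<open>N\<close>, so the contraction does not move them before time
  \<open>1/(N+1)\<close>. The rest of the time is divided into finitely many intervals, on each of which the
  shape of the words is constant.\<close>

lemma continuous_map_contract:
  assumes c: "c \<in> cubes tree_Sq n"
  shows "continuous_map (prod_topology (unit_cube n) (top_of_set {0..1})) (realization tree_Sq)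
    (\<lambda>(s, t). on_words (\<lambda>w. contract w t) ((n, c), s))"
proof -
  let ?Z = "prod_topology (unit_cube n) (top_of_set {0..1::real})"
  have full: "full_word (diagram_word c s)" if "s \<in> topspace (unit_cube n)" for s
    using cont_word_cube(2)[OF c that] by (simp add: tree_orientation)
  have cube_ne: "(\<lambda>i\<in>{1..n}. 0) \<in> topspace (unit_cube n)"
    by (auto simp: topspace_unit_cube)
  obtain N where "level_word N (diagram_word c (\<lambda>i\<in>{1..n}. 0))"
    using level_exists[OF full[OF cube_ne]] by blast
  then have N: "level_word N (diagram_word c s)" for s
    using level_diagram_word[of N "fst c" "snd c" s "\<lambda>i\<in>{1..n}. 0"] by simp
  have cont_t: "continuous_map ?Z euclideanreal snd"
    using continuous_map_snd[of "unit_cube n" "top_of_set {0..1::real}"]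
    by (simp add: continuous_map_in_subtopology)
  have cont_fst: "cont_word ?Z (\<lambda>z. diagram_word c (fst z))"
  proof -
    have "continuous_map ?Z (unit_cube n) fst"
      by (rule continuous_map_fst)
    then have "cont_word ?Z (\<lambda>z. diagram_word (fst c, snd c) (fst z))"
      unfolding continuous_map_into_unit_cube using c
      by (intro cont_word_diagram_word) (auto simp: cubes_Sq_between)
    then show ?thesis
      by simp
  qed
  \<comment> \<open>The formula valid on the interval \<open>J i\<close>; the last index \<open>N\<close> stands for the times up to \<open>1/(N+1)\<close>.\<close>
  define W where "W i z = (if i < N then slide i (ramp i (snd z)) (descend (Suc i) N (diagram_word c (fst z)))
      else diagram_word c (fst z))" for i z
  define J where "J i = (if i < N then {1 / (real i + 2)..1 / (real i + 1)} else {..1 / (real N + 1)})" for i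
  have contW: "continuous_map ?Z (realization tree_Sq) (\<lambda>z. tree_point (W i z))" for i
  proof (rule continuous_map_word_class)
    have "continuous_map ?Z (top_of_set {0..1}) (\<lambda>z. ramp i (snd z))"
      unfolding continuous_map_in_subtopology
      using ramp_bounds cont_t
      by (auto simp: ramp_def intro!: continuous_intros continuous_map_real_max continuous_map_real_min
          continuous_map_real_mult continuous_map_diff)
    then show "cont_word ?Z (W i)"
      unfolding W_def using cont_fst by (cases "i < N") (simp_all add: cont_word_slide cont_word_descend)
    fix z assume "z \<in> topspace ?Z"
    then have "fst z \<in> topspace (unit_cube n)"
      by auto
    then have "full_word (W i z)"
      unfolding W_def using full N valid_slide valid_descend level_descend ramp_bounds by auto
    then show "valid_word M (cells M - (cells M - tree_cells)) start (W i z) finish"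
      by (simp add: tree_orientation)
  qed
  have agree: "tree_point (W i z) = tree_point (W j z)"
    if z: "z \<in> topspace ?Z" "snd z \<in> J i" "snd z \<in> J j" and ij: "i < j" "j \<le> N" for i j z
  proof -
    let ?w = "diagram_word c (fst z)"
    have w: "full_word ?w"
      using full z by auto
    have i: "i < N" "1 / (real i + 2) \<le> snd z"
      using ij z(2) by (auto simp: J_def)
    have "snd z \<le> 1 / (real j + 1)"
      using z(3) ij by (auto simp: J_def split: if_splits)
    moreover have "1 / (real j + 1) \<le> 1 / (real i + 2)"
      using ij by (intro divide_left_mono) auto
    ultimately have eq: "snd z = 1 / (real i + 2)" "1 / (real j + 1) = 1 / (real i + 2)"
      using i by linarith+
    then have j: "j = Suc i"
      by (simp add: field_simps)
    have "tree_point (W i z) = tree_point (descend j N ?w)"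
      using i(1) eq slide_end(1)[OF w N, of i] j by (simp add: W_def ramp_1)
    also have "\<dots> = tree_point (W j z)"
    proof (cases "j < N")
      case True
      have "ramp j (snd z) = 0"
        using ramp_0[of j] eq by simp
      then show ?thesis
        using True slide_end(2)[OF w N, of j] by (simp add: W_def)
    next
      case False
      then show ?thesis
        using descend_id ij by (simp add: W_def)
    qed
    finally show ?thesis .
  qed
  have "continuous_map ?Z (realization tree_Sq) (\<lambda>z. contract (diagram_word c (fst z)) (snd z))"
  proof (rule pasting_lemma_closed)
    show "finite {0..N}"
      by simp
    show "closedin ?Z {z \<in> topspace ?Z. snd z \<in> J i}" for i
      by (rule closedin_continuous_map_preimage[OF cont_t]) (auto simp: J_def)
    show "continuous_map (subtopology ?Z {z \<in> topspace ?Z. snd z \<in> J i}) (realization tree_Sq)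
        (\<lambda>z. tree_point (W i z))" for i
      by (rule continuous_map_from_subtopology[OF contW])
    show "tree_point (W i z) = tree_point (W j z)"
      if "i \<in> {0..N}" "j \<in> {0..N}"
        "z \<in> topspace ?Z \<inter> {z \<in> topspace ?Z. snd z \<in> J i} \<inter> {z \<in> topspace ?Z. snd z \<in> J j}" for i j z
    proof (cases i j rule: linorder_cases)
      case less
      show ?thesis
        by (rule agree[OF _ _ _ less]) (use that in auto)
    next
      case greater
      show ?thesis
        by (rule agree[OF _ _ _ greater, symmetric]) (use that in auto)
    qed simp
    show "\<exists>i. i \<in> {0..N} \<and> z \<in> {z \<in> topspace ?Z. snd z \<in> J i} \<and>
        contract (diagram_word c (fst z)) (snd z) = tree_point (W i z)" if z: "z \<in> topspace ?Z" for z
    proof -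
      let ?t = "snd z" and ?w = "diagram_word c (fst z)"
      have t: "0 \<le> ?t" "?t \<le> 1"
        using z by auto
      consider "?t = 0" | "0 < ?t" "piece ?t < N" | "0 < ?t" "N \<le> piece ?t"
        using t by linarith
      then show ?thesis
      proof cases
        case 1
        then show ?thesis
          using z by (intro exI[of _ N]) (auto simp: J_def W_def contract_def)
      next
        case 2
        then show ?thesis
          using z piece_bounds[OF 2(1) t(2)]
          by (intro exI[of _ "piece ?t"]) (auto simp: J_def W_def contract_def descend_word_level[OF N])
      next
        case 3
        have "?t \<le> 1 / (real (piece ?t) + 1)"
          using piece_bounds[OF 3(1) t(2)] by simp
        also have "\<dots> \<le> 1 / (real N + 1)"
          using 3 by (intro divide_left_mono) auto
        finally have "?t \<in> J N"
          by (simp add: J_def)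
        moreover have "contract ?w ?t = tree_point (W N z)"
          using 3 level_word_mono[OF N 3(2), of "fst z"] descend_id[of N "Suc (piece ?t)"]
          by (simp add: contract_def W_def descend_word_level[OF N] slide_def stage_word_old)
        ultimately show ?thesis
          using z by (intro exI[of _ N]) auto
      qed
    qed
  qed
  then show ?thesis
    by (simp add: on_words_def case_prod_unfold)
qed

theorem simply_connected_tree_Sq: "simply_connected_topology (realization tree_Sq)"
proof (rule simply_connected_topology_contraction)
  let ?D = "\<lambda>(C, t). glue_lift (on_words (\<lambda>w. contract w t)) C"
  have "locally_compact_space (top_of_set {0..1::real})"
    by (intro compact_imp_locally_compact_space) (simp add: compact_space_subtopology)
  then show "continuous_map (prod_topology (realization tree_Sq) (top_of_set {0..1})) (realization tree_Sq) ?D"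
    using continuous_map_glue_lift_prod[of "top_of_set {0..1::real}" tree_Sq "\<lambda>a t. on_words (\<lambda>w. contract w t) a"]
      respects_gluing_contract continuous_map_contract
    by (auto simp: Hausdorff_space_subtopology)
  fix C assume "C \<in> topspace (realization tree_Sq)"
  then obtain w where w: "full_word w" "C = tree_point w"
    using realization_wordE[of C "cells M - tree_cells" start finish] tree_orientation(2) by metis
  have D: "?D (C, t) = contract w t" for t
    using glue_lift_on_words[OF respects_gluing_contract w(1)] w(2) by simp
  show "?D (C, 0) = C"
    unfolding D using w(2) by (simp add: contract_def)
  obtain N where N: "level_word N w"
    using level_exists[OF w(1)] by blast
  have "piece 1 = 0" "ramp 0 1 = 0"
    using ramp_0[of 0] by (auto simp: piece_def)
  then have "contract w 1 = tree_point (descend 0 N w)"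
    using slide_end(2)[OF w(1) N, of 0] by (simp add: contract_def descend_word_level[OF N])
  also have "descend 0 N w = map Edge (snd trunk)"
    using level_0_word[OF valid_descend[OF w(1) N] level_descend[OF N]] .
  finally show "?D (C, 1) = tree_point (map Edge (snd trunk))"
    unfolding D .
qed

end

section \<open>Lifting cubes along a universal 2-cover\<close>

fun top_path :: "('v, 'e, 'f) two_complex \<Rightarrow> ('v, 'e, 'f) diagram \<Rightarrow> ('v, 'e) onepath" where
  "top_path M (u, []) = u"
| "top_path M (u, (f, v) # c) = u \<cdot>\<cdot> ctop M f \<cdot>\<cdot> top_path M (v, c)"

definition diagram_map :: "('w, 'd, 'g, 'v, 'e, 'f) two_complex_map \<Rightarrow> ('w, 'd, 'g) diagram \<Rightarrow>
    ('v, 'e, 'f) diagram" where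
  "diagram_map \<phi> c = (pmap \<phi> (fst c), map (\<lambda>(f, v). (cmap \<phi> f, pmap \<phi> v)) (snd c))"

lemma pmap_pconcat: "pmap \<phi> (q \<cdot>\<cdot> r) = pmap \<phi> q \<cdot>\<cdot> pmap \<phi> r"
  by (simp add: pmap_def pconcat_def)

lemma pstart_pmap: "pstart (pmap \<phi> q) = vmap \<phi> (pstart q)"
  by (simp add: pmap_def pstart_def)

lemma length_pmap: "length (snd (pmap \<phi> q)) = length (snd q)"
  by (simp add: pmap_def)

lemma (in complex2) top_path:
  "thin_diagram M P (u, c) \<Longrightarrow> top_path M (u, c) \<in> onepaths M \<and>
     pstart (top_path M (u, c)) = pstart u \<and> pend M (top_path M (u, c)) = diagram_end M (u, c)"
proof (induction c arbitrary: u)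
  case (Cons a c)
  obtain f v where a: "a = (f, v)"
    by (cases a)
  have u: "u \<in> onepaths M" "pend M u = cstart M f" and f: "f \<in> cells M" "cend M f = pstart v"
    and v: "thin_diagram M P (v, c)"
    using Cons.prems a by auto
  have t: "ctop M f \<in> onepaths M" "pstart (ctop M f) = cstart M f" "pend M (ctop M f) = cend M f"
    using complex f(1) by (auto simp: directed_two_complex_def cstart_def cend_def)
  have "pend M (ctop M f) = pstart (top_path M (v, c))"
    using Cons.IH[OF v] t f by simp
  note ft = onepaths_pconcat[OF complex t(1) _ this]
  have "pend M u = pstart (ctop M f \<cdot>\<cdot> top_path M (v, c))"
    using ft t u Cons.IH[OF v] by simp
  note onepaths_pconcat[OF complex u(1) _ this]
  then show ?case
    using ft Cons.IH[OF v] a by simp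
qed simp

locale two_cover = K: complex2 K + M: complex2 M
  for K :: "('v, 'e, 'f) two_complex" and M :: "('w, 'd, 'g) two_complex" +
  fixes \<phi> :: "('w, 'd, 'g, 'v, 'e, 'f) two_complex_map" and P :: "'f set" and a0 b0 :: 'w
  assumes morphism: "two_complex_morphism M K \<phi>"
    and P: "orientation K P"
    and bij: "q \<in> onepaths M \<Longrightarrow> pstart q = a0 \<Longrightarrow> pend M q = b0 \<Longrightarrow>
      bij_betw (local_map \<phi>) (two_star M q) (two_star K (pmap \<phi> q))"
begin

text \<open>With this orientation the morphism preserves thin diagrams.\<close>

definition lifted_orientation :: "'g set" where
  "lifted_orientation = {f \<in> cells M. cmap \<phi> f \<in> P}"

lemma awalk_map: "M.awalk u es v \<Longrightarrow> K.awalk (vmap \<phi> u) (map (emap \<phi>) es) (vmap \<phi> v)"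
proof (induction es arbitrary: u)
  case Nil
  then show ?case
    using morphism by (auto simp: M.awalk_Nil_iff K.awalk_Nil_iff two_complex_morphism_def)
next
  case (Cons e es)
  then show ?case
    using morphism by (auto simp: M.awalk_Cons_iff K.awalk_Cons_iff two_complex_morphism_def)
qed

lemma onepath_map:
  assumes "q \<in> onepaths M"
  shows "pmap \<phi> q \<in> onepaths K" "pend K (pmap \<phi> q) = vmap \<phi> (pend M q)"
proof -
  have "M.awalk (fst q) (snd q) (pend M q)"
    using assms M.onepaths_iff by (metis prod.collapse)
  from awalk_map[OF this] show "pmap \<phi> q \<in> onepaths K" "pend K (pmap \<phi> q) = vmap \<phi> (pend M q)"
    using K.pend_awalk by (auto simp: pmap_def onepaths_def)
qed

lemma cell_map:
  assumes "f \<in> cells M"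
  shows "cmap \<phi> f \<in> cells K" "cell_side K k (cmap \<phi> f) = pmap \<phi> (cell_side M k f)"
    "cinv K (cmap \<phi> f) = cmap \<phi> (cinv M f)"
    "cstart K (cmap \<phi> f) = vmap \<phi> (cstart M f)" "cend K (cmap \<phi> f) = vmap \<phi> (cend M f)"
proof -
  show "cmap \<phi> f \<in> cells K" "cinv K (cmap \<phi> f) = cmap \<phi> (cinv M f)"
    using morphism assms by (auto simp: two_complex_morphism_def)
  show *: "cell_side K k (cmap \<phi> f) = pmap \<phi> (cell_side M k f)" for k
    using morphism assms by (auto simp: two_complex_morphism_def cell_side_def)
  have "ctop M f \<in> onepaths M"
    using M.complex assms by (simp add: directed_two_complex_def)
  then show "cstart K (cmap \<phi> f) = vmap \<phi> (cstart M f)" "cend K (cmap \<phi> f) = vmap \<phi> (cend M f)"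
    using *[of False] onepath_map(2) by (auto simp: cell_side_def cstart_def cend_def pstart_pmap)
qed

lemma side_path:
  assumes "f \<in> cells M"
  shows "cell_side M k f \<in> onepaths M" "pstart (cell_side M k f) = cstart M f"
    "pend M (cell_side M k f) = cend M f"
  using M.complex assms by (auto simp: directed_two_complex_def cell_side_def cstart_def cend_def)

lemma orientation_lifted: "orientation M lifted_orientation"
proof -
  have sub: "lifted_orientation \<subseteq> cells M"
    by (auto simp: lifted_orientation_def)
  have iff: "cinv M f \<in> lifted_orientation \<longleftrightarrow> f \<notin> lifted_orientation" if "f \<in> cells M" for f
    using that K.orientation_cinv[OF P cell_map(1)[OF that]] cell_map(3)[OF that] M.cinv_cell(1)[OF that]
    by (simp add: lifted_orientation_def)
  have "f \<in> cinv M ` lifted_orientation" if "f \<in> cells M - lifted_orientation" for f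
  proof (rule image_eqI)
    show "f = cinv M (cinv M f)" "cinv M f \<in> lifted_orientation"
      using that iff M.cinv_cell(2) by auto
  qed
  moreover have "cinv M f \<in> cells M - lifted_orientation" if "f \<in> lifted_orientation" for f
    using that sub iff M.cinv_cell(1) by blast
  ultimately show ?thesis
    unfolding orientation_def using sub by blast
qed

lemma thin_diagram_map:
  "thin_diagram M lifted_orientation (u, c) \<Longrightarrow> thin_diagram K P (diagram_map \<phi> (u, c))"
proof (induction c arbitrary: u)
  case Nil
  then show ?case
    by (simp add: diagram_map_def onepath_map)
next
  case (Cons a c)
  obtain f v where a: "a = (f, v)"
    by (cases a)
  then have "f \<in> cells M" "cmap \<phi> f \<notin> P" "u \<in> onepaths M" "thin_diagram M lifted_orientation (v, c)"
      "pend M u = cstart M f" "cend M f = pstart v"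
    using Cons.prems by (auto simp: lifted_orientation_def)
  then show ?case
    using Cons.IH[of v] a cell_map[of f] onepath_map[of u] by (simp add: diagram_map_def pstart_pmap)
qed

lemma diagram_map_face:
  "thin_diagram M Q (u, c) \<Longrightarrow> 1 \<le> i \<Longrightarrow> i \<le> length c \<Longrightarrow>
    diagram_map \<phi> (diagram_face M i k (u, c)) = diagram_face K i k (diagram_map \<phi> (u, c))"
proof (induction c arbitrary: u i)
  case (Cons a c)
  obtain f v where a: "a = (f, v)"
    by (cases a)
  then have f: "f \<in> cells M" "thin_diagram M Q (v, c)"
    using Cons.prems by auto
  show ?case
  proof (cases "i = 1")
    case True
    then show ?thesis
      using a cell_map(2)[OF f(1)] by (simp add: diagram_map_def pmap_pconcat)
  next
    case False
    then obtain j where j: "i = Suc (Suc j)"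
      using Cons.prems by (cases i; cases "i - 1") auto
    have "diagram_map \<phi> (diagram_face M (Suc j) k (v, c)) = diagram_face K (Suc j) k (diagram_map \<phi> (v, c))"
      using Cons.IH[OF f(2), of "Suc j"] Cons.prems j by simp
    then show ?thesis
      using a j by (auto simp: diagram_map_def split: prod.splits)
  qed
qed simp

text \<open>Property (U2) is applied to the 1-path \<open>a \<cdot>\<cdot> s \<cdot>\<cdot> b\<close>. The morphism preserves lengths, so an atomic
  2-path over the given one splits this 1-path in the same places.\<close>

lemma unique_cell_top:
  assumes a: "a \<in> onepaths M" "pstart a = a0" and s: "s \<in> onepaths M" "pend M a = pstart s"
    and b: "b \<in> onepaths M" "pend M s = pstart b" "pend M b = b0"
    and g: "g \<in> cells K" "ctop K g = pmap \<phi> s"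
  shows "\<exists>!f. f \<in> cells M \<and> cmap \<phi> f = g \<and> ctop M f = s"
proof -
  let ?q = "a \<cdot>\<cdot> s \<cdot>\<cdot> b"
  note sb = onepaths_pconcat[OF M.complex s(1) b(1,2)]
  have "pend M a = pstart (s \<cdot>\<cdot> b)"
    using s sb by simp
  note asb = onepaths_pconcat[OF M.complex a(1) sb(1) this]
  have bq: "bij_betw (local_map \<phi>) (two_star M ?q) (two_star K (pmap \<phi> ?q))"
    using bij[OF asb(1)] asb(2,3) sb(3) a(2) b(3) by simp
  have "(pmap \<phi> a, g, pmap \<phi> b) \<in> two_star K (pmap \<phi> ?q)"
    using onepath_map[OF a(1)] onepath_map[OF b(1)] onepath_map[OF s(1)] g s(2) b(2)
    by (simp add: two_star_def atomic_two_paths_def cstart_def cend_def pstart_pmap pmap_pconcat)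
  then obtain z where z: "z \<in> two_star M ?q" "local_map \<phi> z = (pmap \<phi> a, g, pmap \<phi> b)"
    using bij_betw_imp_surj_on[OF bq] by (metis imageE)
  obtain a' f b' where "z = (a', f, b')"
    by (cases z)
  with z have f: "f \<in> cells M" "cmap \<phi> f = g" "a' \<cdot>\<cdot> ctop M f \<cdot>\<cdot> b' = ?q"
      "pmap \<phi> a' = pmap \<phi> a" "pend M a' = cstart M f"
    by (auto simp: two_star_def atomic_two_paths_def local_map_def)
  have len: "length (snd a') = length (snd a)" "length (snd (ctop M f)) = length (snd s)"
    using length_pmap[of \<phi> a'] length_pmap[of \<phi> a] length_pmap[of \<phi> "ctop M f"] length_pmap[of \<phi> s]
      f(4) g(2) cell_map(2)[OF f(1), of False] f(2) by (simp_all add: cell_side_def)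
  then have eqs: "a' = a" "snd (ctop M f) = snd s"
    using f(3) by (auto simp: pconcat_def prod_eq_iff)
  have "fst (ctop M f) = fst s"
    using f(5) eqs(1) s(2) by (simp add: cstart_def pstart_def)
  then have top: "ctop M f = s"
    using eqs by (simp add: prod_eq_iff)
  have "f' = f" if f': "f' \<in> cells M" "cmap \<phi> f' = g" "ctop M f' = s" for f'
  proof -
    have "(a, h, b) \<in> two_star M ?q" if "h \<in> cells M" "ctop M h = s" for h
      using a b s that by (simp add: two_star_def atomic_two_paths_def cstart_def cend_def)
    then have "(a, f, b) \<in> two_star M ?q" "(a, f', b) \<in> two_star M ?q"
      using f top f' by auto
    moreover have "local_map \<phi> (a, f, b) = local_map \<phi> (a, f', b)"
      using f f' by (simp add: local_map_def)
    ultimately show ?thesis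
      using bij_betw_imp_inj_on[OF bq] by (auto dest: inj_onD)
  qed
  then show ?thesis
    using f top by blast
qed

lemma unique_cell:
  assumes a: "a \<in> onepaths M" "pstart a = a0" and s: "s \<in> onepaths M" "pend M a = pstart s"
    and b: "b \<in> onepaths M" "pend M s = pstart b" "pend M b = b0"
    and g: "g \<in> cells K" "cell_side K k g = pmap \<phi> s"
  shows "\<exists>!f. f \<in> cells M \<and> cmap \<phi> f = g \<and> cell_side M k f = s"
proof (cases k)
  case False
  then show ?thesis
    using unique_cell_top[OF a s b g(1)] g(2) by (simp add: cell_side_def)
next
  case True
  have "ctop K (cinv K g) = pmap \<phi> s"
    using K.cinv_cell(3)[OF g(1), of False] g(2) True by (simp add: cell_side_def)
  then have ex1: "\<exists>!f. f \<in> cells M \<and> cmap \<phi> f = cinv K g \<and> ctop M f = s"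
    by (rule unique_cell_top[OF a s b K.cinv_cell(1)[OF g(1)]])
  then obtain f where f: "f \<in> cells M" "cmap \<phi> f = cinv K g" "ctop M f = s"
    by blast
  show ?thesis
  proof (rule ex1I[of _ "cinv M f"])
    show "cinv M f \<in> cells M \<and> cmap \<phi> (cinv M f) = g \<and> cell_side M k (cinv M f) = s"
      using M.cinv_cell[OF f(1)] cell_map(3)[OF f(1)] f K.cinv_cell(2)[OF g(1)] True
      by (simp add: cell_side_def)
    fix h assume h: "h \<in> cells M \<and> cmap \<phi> h = g \<and> cell_side M k h = s"
    then have "cinv M h \<in> cells M" "cmap \<phi> (cinv M h) = cinv K g"
      using M.cinv_cell(1)[of h] cell_map(3)[of h] by auto
    moreover have "ctop M (cinv M h) = s"
      using M.cinv_cell(3)[of h False] h True by (simp add: cell_side_def)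
    ultimately have "cinv M h = f"
      using ex1 f by blast
    then show "h = cinv M f"
      using h M.cinv_cell(2)[of h] by auto
  qed
qed

text \<open>Given a lift of a face of a diagram, only the cell that has been replaced by its top or bottom
  has to be found, and the 1-path that has absorbed it is cut by lengths. The path \<open>a\<close>, together with
  the tops of the cells that follow, extends the lift to a 1-path to which (U2) applies.\<close>

lemma unique_coface_lift:
  "thin_diagram K P (u, c) \<Longrightarrow> 1 \<le> i \<Longrightarrow> i \<le> length c \<Longrightarrow>
   thin_diagram M lifted_orientation (u', c') \<Longrightarrow> diagram_map \<phi> (u', c') = diagram_face K i k (u, c) \<Longrightarrow>
   a \<in> onepaths M \<Longrightarrow> pstart a = a0 \<Longrightarrow> pend M a = pstart u' \<Longrightarrow> diagram_end M (u', c') = b0 \<Longrightarrow>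
   \<exists>!x. thin_diagram M lifted_orientation x \<and> diagram_map \<phi> x = (u, c) \<and> diagram_face M i k x = (u', c')"
proof (induction c arbitrary: u i u' c' a)
  case (Cons d c)
  obtain f v where d: "d = (f, v)"
    by (cases d)
  have K: "u \<in> onepaths K" "f \<in> cells K" "f \<notin> P" "pend K u = cstart K f" "cend K f = pstart v"
      "thin_diagram K P (v, c)"
    using Cons.prems(1) d by auto
  have u': "u' \<in> onepaths M"
    using thin_diagram_start[OF Cons.prems(4)] by simp
  show ?case
  proof (cases "i = 1")
    case True
    have eq: "pmap \<phi> u' = u \<cdot>\<cdot> cell_side K k f \<cdot>\<cdot> v" "map (\<lambda>(f, v). (cmap \<phi> f, pmap \<phi> v)) c' = c"
      using Cons.prems(5) True d by (auto simp: diagram_map_def)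
    \<comment> \<open>\<open>u'\<close> is cut into pieces over \<open>u\<close>, the side of \<open>f\<close>, and \<open>v\<close>.\<close>
    define m n where "m = length (snd u)" and "n = length (snd (cell_side K k f))"
    define es1 es2 es3 where "es1 = take m (snd u')" and "es2 = take n (drop m (snd u'))"
      and "es3 = drop n (drop m (snd u'))"
    have snd_u': "snd u' = es1 @ es2 @ es3"
      by (simp only: es1_def es2_def es3_def append_take_drop_id)
    have maps: "map (emap \<phi>) es1 = snd u" "map (emap \<phi>) es2 = snd (cell_side K k f)"
        "map (emap \<phi>) es3 = snd v" "vmap \<phi> (fst u') = fst u"
      using eq(1) by (auto simp: pmap_def pconcat_def es1_def es2_def es3_def m_def n_def
          take_map[symmetric] drop_map[symmetric])
    define u1 where "u1 = (fst u', es1)"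
    define s where "s = (pend M u1, es2)"
    define v1 where "v1 = (pend M s, es3)"
    have "M.awalk (fst u') (es1 @ es2 @ es3) (pend M u')"
      using u' M.onepaths_iff snd_u' by (metis prod.collapse)
    then obtain y z where walks: "M.awalk (fst u') es1 y" "M.awalk y es2 z" "M.awalk z es3 (pend M u')"
      by auto
    have ends: "pend M u1 = y" "pend M s = z" "pend M v1 = pend M u'"
      using walks M.pend_awalk by (simp_all add: u1_def s_def v1_def)
    have paths: "u1 \<in> onepaths M" "s \<in> onepaths M" "v1 \<in> onepaths M"
      using walks ends M.onepaths_iff by (auto simp: u1_def s_def v1_def)
    have pm: "pmap \<phi> u1 = u"
      using maps by (simp add: pmap_def u1_def)
    then have "vmap \<phi> y = cstart K f"
      using onepath_map(2)[OF paths(1)] ends K(4) by simp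
    then have ps: "pmap \<phi> s = cell_side K k f"
      using maps K.cell_awalk(2)[OF K(2), of k] ends by (simp add: pmap_def s_def prod_eq_iff)
    have "cend K f = vmap \<phi> z"
      using onepath_map(2)[OF paths(2)] ends ps K.cell_awalk(1,2)[OF K(2), of k] K.pend_awalk
      by (metis prod.collapse)
    then have pv: "pmap \<phi> v1 = v"
      using maps ends K(5) by (simp add: pmap_def v1_def prod_eq_iff pstart_def)
    have thin_v1: "thin_diagram M lifted_orientation (v1, c')"
      using Cons.prems(4) paths(3) ends by (cases c') auto
    have end_v1: "diagram_end M (v1, c') = b0"
      using Cons.prems(9) ends by (cases c') auto
    \<comment> \<open>A 1-path from the end of the cell to \<open>b0\<close>, needed to apply (U2).\<close>
    note top = M.top_path[OF thin_v1]
    have pa: "pend M a = pstart u1"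
      using Cons.prems(8) by (simp add: u1_def pstart_def)
    note au1 = onepaths_pconcat[OF M.complex Cons.prems(6) paths(1) pa]
    have ex1: "\<exists>!f'. f' \<in> cells M \<and> cmap \<phi> f' = f \<and> cell_side M k f' = s"
    proof (rule unique_cell[OF au1(1) _ paths(2)])
      show "pstart (a \<cdot>\<cdot> u1) = a0"
        using au1 Cons.prems(7) by simp
      show "pend M (a \<cdot>\<cdot> u1) = pstart s"
        using au1 by (simp add: s_def pstart_def)
      show "top_path M (v1, c') \<in> onepaths M" "pend M s = pstart (top_path M (v1, c'))"
          "pend M (top_path M (v1, c')) = b0"
        using top end_v1 by (auto simp: v1_def pstart_def)
    qed (use K ps in auto)
    then obtain f' where f': "f' \<in> cells M" "cmap \<phi> f' = f" "cell_side M k f' = s"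
      by blast
    have f'_ends: "cstart M f' = pend M u1" "cend M f' = pend M s"
      using side_path[OF f'(1), of k] f'(3) by (auto simp: s_def pstart_def)
    show ?thesis
    proof (rule ex1I[of _ "(u1, (f', v1) # c')"])
      have "u1 \<cdot>\<cdot> s \<cdot>\<cdot> v1 = u'"
        using snd_u' by (simp add: pconcat_def u1_def s_def v1_def prod_eq_iff)
      then show "thin_diagram M lifted_orientation (u1, (f', v1) # c') \<and>
          diagram_map \<phi> (u1, (f', v1) # c') = (u, d # c) \<and> diagram_face M i k (u1, (f', v1) # c') = (u', c')"
        using paths f' f'_ends thin_v1 K(3) pm pv eq(2) d True
        by (auto simp: lifted_orientation_def diagram_map_def v1_def pstart_def)
      fix x assume x: "thin_diagram M lifted_orientation x \<and> diagram_map \<phi> x = (u, d # c) \<and>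
        diagram_face M i k x = (u', c')"
      then obtain u2 f2 v2 c2 where x2: "x = (u2, (f2, v2) # c2)"
        by (cases x; cases "snd x") (auto simp: diagram_map_def)
      have t2: "f2 \<in> cells M" "pend M u2 = cstart M f2" "cend M f2 = pstart v2"
        using x x2 by auto
      have m2: "pmap \<phi> u2 = u" "cmap \<phi> f2 = f" "pmap \<phi> v2 = v"
        using x x2 d by (auto simp: diagram_map_def)
      have face2: "u2 \<cdot>\<cdot> cell_side M k f2 \<cdot>\<cdot> v2 = u'" "c2 = c'"
        using x x2 True by auto
      have "length (snd u2) = length es1" "length (snd (cell_side M k f2)) = length es2"
        using m2(1) maps(1,2) cell_map(2)[OF t2(1), of k] m2(2) length_pmap[of \<phi> u2]
          length_pmap[of \<phi> "cell_side M k f2"] length_map[of "emap \<phi>" es1] length_map[of "emap \<phi>" es2]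
        by simp_all
      then have snd2: "snd u2 = es1" "snd (cell_side M k f2) = es2" "snd v2 = es3" "fst u2 = fst u'"
        using face2(1) snd_u' by (auto simp: pconcat_def)
      then have u2: "u2 = u1"
        by (simp add: u1_def prod_eq_iff)
      have "cell_side M k f2 = s"
        using snd2(2) M.cell_awalk(2)[OF t2(1), of k] t2(2) u2 by (simp add: s_def prod_eq_iff)
      then have f2: "f2 = f'"
        using ex1 f' t2(1) m2(2) by blast
      have "v2 = v1"
        using snd2(3) t2(3) f2 f'_ends by (simp add: v1_def prod_eq_iff pstart_def)
      then show "x = (u1, (f', v1) # c')"
        using x2 u2 f2 face2 by simp
    qed
  next
    case False
    then obtain j where j: "i = Suc (Suc j)"
      using Cons.prems(2) by (cases i; cases "i - 1") auto
    obtain vk ck where face: "diagram_face K (Suc j) k (v, c) = (vk, ck)"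
      by fastforce
    have "diagram_map \<phi> (u', c') = (u, (f, vk) # ck)"
      using Cons.prems(5) j d face by simp
    then obtain f' v' c'' where c': "c' = (f', v') # c''" "pmap \<phi> u' = u" "cmap \<phi> f' = f"
        "diagram_map \<phi> (v', c'') = (vk, ck)"
      by (cases c') (auto simp: diagram_map_def)
    have M: "f' \<in> cells M - lifted_orientation" "pend M u' = cstart M f'" "cend M f' = pstart v'"
        "thin_diagram M lifted_orientation (v', c'')"
      using Cons.prems(4) c' by auto
    then have f': "f' \<in> cells M"
      by simp
    have top: "ctop M f' \<in> onepaths M" "pstart (ctop M f') = cstart M f'" "pend M (ctop M f') = cend M f'"
      using side_path[OF f', of False] by (auto simp: cell_side_def)
    note au = onepaths_pconcat[OF M.complex Cons.prems(6) u' Cons.prems(8)]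
    have "pend M (a \<cdot>\<cdot> u') = pstart (ctop M f')"
      using au M top by simp
    note auf = onepaths_pconcat[OF M.complex au(1) top(1) this]
    have ex1: "\<exists>!x. thin_diagram M lifted_orientation x \<and> diagram_map \<phi> x = (v, c) \<and>
        diagram_face M (Suc j) k x = (v', c'')"
    proof (rule Cons.IH[OF K(6) _ _ M(4)])
      show "diagram_map \<phi> (v', c'') = diagram_face K (Suc j) k (v, c)"
        using c' face by simp
      show "(a \<cdot>\<cdot> u') \<cdot>\<cdot> ctop M f' \<in> onepaths M" "pstart ((a \<cdot>\<cdot> u') \<cdot>\<cdot> ctop M f') = a0"
          "pend M ((a \<cdot>\<cdot> u') \<cdot>\<cdot> ctop M f') = pstart v'"
        using auf au top M Cons.prems(7) by auto
      show "diagram_end M (v', c'') = b0"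
        using Cons.prems(9) c' by simp
    qed (use Cons.prems(3) j in auto)
    then obtain x where x: "thin_diagram M lifted_orientation x" "diagram_map \<phi> x = (v, c)"
        "diagram_face M (Suc j) k x = (v', c'')"
      by blast
    obtain v1 c1 where x1: "x = (v1, c1)"
      by (cases x)
    have pv1: "pstart v1 = pstart v'"
      using pstart_diagram_face[of "Suc j" M k x] x x1 by simp
    show ?thesis
    proof (rule ex1I[of _ "(u', (f', v1) # c1)"])
      show "thin_diagram M lifted_orientation (u', (f', v1) # c1) \<and>
          diagram_map \<phi> (u', (f', v1) # c1) = (u, d # c) \<and>
          diagram_face M i k (u', (f', v1) # c1) = (u', c')"
        using x x1 M u' pv1 c' d j by (auto simp: diagram_map_def)
      fix z assume z: "thin_diagram M lifted_orientation z \<and> diagram_map \<phi> z = (u, d # c) \<and>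
        diagram_face M i k z = (u', c')"
      then obtain u2 f2 v2 c2 where z2: "z = (u2, (f2, v2) # c2)"
        by (cases z; cases "snd z") (auto simp: diagram_map_def)
      have "thin_diagram M lifted_orientation (v2, c2)" "diagram_map \<phi> (v2, c2) = (v, c)"
        using z z2 d by (auto simp: diagram_map_def)
      moreover have "u2 = u'" "f2 = f'" "diagram_face M (Suc j) k (v2, c2) = (v', c'')"
        using z z2 c' j by (auto split: prod.splits)
      ultimately show "z = (u', (f', v1) # c1)"
        using ex1 x x1 z2 by blast
    qed
  qed
qed simp

definition lifted_cubes :: "('w, 'd, 'g) diagram set" where
  "lifted_cubes = {c. thin_diagram M lifted_orientation c \<and> c \<in> diagrams_between M a0 b0}"

abbreviation cover_Sq :: "('w, 'd, 'g) diagram cubical" where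
  "cover_Sq \<equiv> Sq_between M lifted_orientation a0 b0"

abbreviation base_Sq :: "('v, 'e, 'f) diagram cubical" where
  "base_Sq \<equiv> restrict_cubes (Sq K P) (diagram_map \<phi> ` lifted_cubes)"

lemma cubes_cover_Sq: "cubes cover_Sq n = {c \<in> lifted_cubes. length (snd c) = n}"
  by (auto simp: Sq_between_def Sq_def lifted_cubes_def)

lemma length_diagram_map [simp]: "length (snd (diagram_map \<phi> c)) = length (snd c)"
  by (simp add: diagram_map_def)

lemma cubes_base_Sq: "cubes base_Sq n = diagram_map \<phi> ` cubes cover_Sq n"
  using thin_diagram_map by (auto simp: cubes_cover_Sq Sq_def lifted_cubes_def)

lemma unique_coface_cube:
  assumes y: "y \<in> cubes (Sq K P) n" and i: "i \<in> {1..n}" and x': "x' \<in> cubes cover_Sq (n - 1)"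
    and eq: "diagram_map \<phi> x' = diagram_face K i k y"
  shows "\<exists>!x. x \<in> cubes cover_Sq n \<and> diagram_map \<phi> x = y \<and> diagram_face M i k x = x'"
proof -
  have x'_thin: "thin_diagram M lifted_orientation x'" "pstart (fst x') = a0" "diagram_end M x' = b0"
    using x' M.cubes_Sq_between by auto
  have "fst x' \<in> onepaths M"
    using thin_diagram_start[OF x'_thin(1)] .
  then have "M.awalk (fst (fst x')) (snd (fst x')) (pend M (fst x'))"
    using M.onepaths_iff[of "fst (fst x')" "snd (fst x')"] by simp
  then have "M.awalk a0 [] a0"
    using x'_thin(2) by (auto simp: M.awalk_Nil_iff pstart_def)
  then have a: "(a0, []) \<in> onepaths M" "pend M (a0, []) = a0"
    using M.pend_awalk by (auto simp: onepaths_def)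
  have "\<exists>!x. thin_diagram M lifted_orientation x \<and> diagram_map \<phi> x = (fst y, snd y) \<and>
      diagram_face M i k x = (fst x', snd x')"
    by (rule unique_coface_lift[of _ _ _ _ _ _ "(a0, [])"])
      (use y i eq x'_thin a in \<open>auto simp: Sq_def pstart_def\<close>)
  then have ex1: "\<exists>!x. thin_diagram M lifted_orientation x \<and> diagram_map \<phi> x = y \<and> diagram_face M i k x = x'"
    by simp
  moreover have "x \<in> cubes cover_Sq n"
    if "thin_diagram M lifted_orientation x" "diagram_map \<phi> x = y" "diagram_face M i k x = x'" for x
  proof -
    have len: "length (snd x) = n"
      using that(2) y length_diagram_map[of x] by (simp add: Sq_def)
    have "diagram_end M x = b0"
      using M.diagram_end_face[of lifted_orientation "fst x" "snd x" i k] that x'_thin(3) i len by simp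
    moreover have "pstart (fst x) = a0"
      using pstart_diagram_face[of i M k x] that(3) x'_thin(2) i by simp
    ultimately show ?thesis
      using that(1) len M.cubes_Sq_between by blast
  qed
  ultimately show ?thesis
    using M.cubes_Sq_between by metis
qed

text \<open>Faces of lifted diagrams are lifted, and cofaces lift by \<open>unique_coface_lift\<close>.\<close>

lemma component_closed_image: "component_closed (Sq K P) (diagram_map \<phi> ` lifted_cubes)"
  unfolding component_closed_def
proof (intro allI ballI iffI)
  fix n y i k
  assume y: "y \<in> cubes (Sq K P) n" and i: "i \<in> {1..n}"
  have face: "face (Sq K P) i k y = diagram_face K i k y"
    by (simp add: Sq_def)
  {
    assume "y \<in> diagram_map \<phi> ` lifted_cubes"
    then obtain x where x: "x \<in> lifted_cubes" "y = diagram_map \<phi> x"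
      by blast
    then have "x \<in> cubes cover_Sq n"
      using y by (simp add: cubes_cover_Sq Sq_def)
    then have "diagram_face M i k x \<in> cubes cover_Sq (n - 1)"
      using M.semi_cubical_Sq_between[of lifted_orientation a0 b0] i unfolding semi_cubical_def by simp
    then have "diagram_face M i k x \<in> lifted_cubes"
      by (simp add: cubes_cover_Sq)
    moreover have "diagram_map \<phi> (diagram_face M i k x) = diagram_face K i k y"
      using diagram_map_face[of lifted_orientation "fst x" "snd x" i k] x y i
      by (simp add: lifted_cubes_def Sq_def)
    ultimately show "face (Sq K P) i k y \<in> diagram_map \<phi> ` lifted_cubes"
      unfolding face by (metis imageI)
  next
    assume "face (Sq K P) i k y \<in> diagram_map \<phi> ` lifted_cubes"
    then obtain x' where x': "x' \<in> lifted_cubes" "diagram_map \<phi> x' = diagram_face K i k y"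
      unfolding face by (metis imageE)
    have "length (snd (diagram_face K i k y)) = n - 1"
      using thin_diagram_face[OF K.complex, of P y i k] y i by (simp add: Sq_def)
    then have "x' \<in> cubes cover_Sq (n - 1)"
      using x' length_diagram_map[of x'] by (simp add: cubes_cover_Sq)
    from unique_coface_cube[OF y i this x'(2)]
    show "y \<in> diagram_map \<phi> ` lifted_cubes"
      by (auto simp: cubes_cover_Sq)
  }
qed

sublocale cover: cubical_covering cover_Sq base_Sq "diagram_map \<phi>"
proof
  show "semi_cubical cover_Sq"
    by (rule M.semi_cubical_Sq_between)
  show "semi_cubical base_Sq"
    by (intro semi_cubical_restrict_cubes semi_cubical_Sq K.complex component_closed_image)
  show "diagram_map \<phi> ` cubes cover_Sq n = cubes base_Sq n" for n
    by (simp add: cubes_base_Sq del: restrict_cubes_simps)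
  show "diagram_map \<phi> (face cover_Sq i k x) = face base_Sq i k (diagram_map \<phi> x)"
    if "x \<in> cubes cover_Sq n" "i \<in> {1..n}" for x n i k
    using diagram_map_face[of lifted_orientation "fst x" "snd x" i k] that
    by (simp add: M.cubes_Sq_between Sq_def)
  show "\<exists>!x. x \<in> cubes cover_Sq n \<and> diagram_map \<phi> x = y \<and> face cover_Sq i k x = x'"
    if "y \<in> cubes base_Sq n" "i \<in> {1..n}" "x' \<in> cubes cover_Sq (n - 1)"
      "diagram_map \<phi> x' = face base_Sq i k y" for y n i x' k
    using unique_coface_cube[of y n i x' k] that by (simp add: Sq_def)
qed

end

section \<open>The universal cover\<close>

theorem theorem8p4:
  fixes K :: "('v, 'e, 'f) two_complex"
    and Kt :: "('w, 'd, 'g) two_complex"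
    and \<phi> :: "('w, 'd, 'g, 'v, 'e, 'f) two_complex_map"
  assumes "directed_two_complex K"
    and "p \<in> onepaths K"
    and "universal_two_cover K p Kt \<phi> pt"
    and "orientation K P"
    and "orientation Kt Pt"
  shows "\<exists>(E :: ('w, 'd, 'g) diagram cube_point set topology) \<pi>.
           universal_cover E (Sq_component K P p) \<pi> \<and>
           Sq_component Kt Pt pt homeomorphic_space E"
proof -
  have cover: "directed_two_complex Kt" "two_complex_morphism Kt K \<phi>" "rooted_two_tree Kt pt"
      "pmap \<phi> pt = p"
    and bij: "\<And>q. q \<in> onepaths Kt \<Longrightarrow> pstart q = pstart pt \<Longrightarrow> pend Kt q = pend Kt pt \<Longrightarrow>
        bij_betw (local_map \<phi>) (two_star Kt q) (two_star K (pmap \<phi> q))"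
    using assms(3) unfolding universal_two_cover_def by blast+
  interpret two_cover K Kt \<phi> P "pstart pt" "pend Kt pt"
    by unfold_locales (fact assms(1) cover(1,2) assms(4) bij)+
  obtain V E S where "two_tree Kt pt V E S"
    using rooted_two_tree_levels[OF cover(3)] .
  then interpret tree: two_tree Kt pt V E S .
  let ?X = "\<lambda>Q. realization (Sq_between Kt Q (pstart pt) (pend Kt pt))"
  have simply: "simply_connected_topology (?X Q)" if "orientation Kt Q" for Q
    using M.realization_Sq_between_orientation[OF tree.tree_orientation(1) that]
      tree.simply_connected_tree_Sq by (rule homeomorphic_simply_connected_topology)
  then have connected: "connected_space (?X Q)" if "orientation Kt Q" for Q
    using that path_connected_imp_connected_space unfolding simply_connected_topology_def by blast
  have pt: "thin_diagram Kt Q (pt, [])" for Q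
    using tree.trunk(1) by simp
  have Kt: "Sq_component Kt Pt pt = ?X Pt"
    unfolding Sq_component_def Sq_between_def
  proof (rule realization_component_eq[OF M.component_closed_diagrams_between])
    show "connected_space (realization (restrict_cubes (Sq Kt Pt) (diagrams_between Kt (pstart pt) (pend Kt pt))))"
      using connected[OF assms(5)] by (simp add: Sq_between_def)
  qed (use pt in \<open>auto simp: Sq_def diagrams_between_def\<close>)
  have onto: "cover.proj ` topspace (?X lifted_orientation) = topspace (realization base_Sq)"
    and cont: "continuous_map (?X lifted_orientation) (realization base_Sq) cover.proj"
    using cover.covering_projection_proj unfolding covering_projection_def by auto
  \<comment> \<open>The image of the covering is connected, so it is a single component.\<close>
  have "connectedin (realization base_Sq) (cover.proj ` topspace (?X lifted_orientation))"
    using connected[OF orientation_lifted] cont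
    by (intro connectedin_continuous_map_image[OF cont]) (simp add: connectedin_topspace)
  then have "connected_space (realization base_Sq)"
    unfolding onto by (simp add: connectedin_topspace)
  moreover have "(p, []) = diagram_map \<phi> (pt, [])" "(pt, []) \<in> lifted_cubes"
    using cover(4) pt by (auto simp: diagram_map_def lifted_cubes_def diagrams_between_def)
  then have "(p, []) \<in> diagram_map \<phi> ` lifted_cubes"
    by (rule image_eqI)
  moreover have "(p, []) \<in> cubes (Sq K P) 0"
    using assms(2) by (simp add: Sq_def)
  ultimately have "Sq_component K P p = realization base_Sq"
    unfolding Sq_component_def by (intro realization_component_eq[OF component_closed_image])
  then have "universal_cover (?X lifted_orientation) (Sq_component K P p) cover.proj"
    using cover.covering_projection_proj simply[OF orientation_lifted] by (simp add: universal_cover_def)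
  moreover have "Sq_component Kt Pt pt homeomorphic_space ?X lifted_orientation"
    unfolding Kt by (rule M.realization_Sq_between_orientation[OF assms(5) orientation_lifted])
  ultimately show ?thesis
    by blast
qed

end
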